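(* Assume that all of the following hold. (1) There exists $\gamma>0$ such that $p(n)=O(n^\gamma)$ as $n\to\infty$. (2) For all $n\in\mathbb{N}$ and $a\in\Gamma(n)$, $\mathrm{Var}(X_a)=1$; and there exists $v^2>0$ such that $\mathrm{Var}(X_a\mid X_{\Gamma(n)\setminus\{a\}})\ge v^2$ for all $n\in\mathbb{N}$ and $a\in\Gamma(n)$. (3) There exists $0\le\kappa<1$ such that $\max_{a\in\Gamma(n)}|\mathrm{ne}_a|=O(n^\kappa)$ as $n\to\infty$. (4) There exists $\vartheta<\infty$ such that for all $n\in\mathbb{N}$ and all neighboring nodes $a,b\in\Gamma(n)$, $\|\theta^{a,\mathrm{ne}_b\setminus\{a\}}\|_1\le\vartheta$. (5) There exist $\delta>0$ and $\xi>\kappa$ (with $\kappa$ as in (3)) such that for all $n\in\mathbb{N}$ and every $(a,b)\in E$, $|\pi_{ab}|\ge\delta n^{-(1-\xi)/2}$. (6) There exists $\delta'<1$ such that for all $n\in\mathbb{N}$ and all $a,b\in\Gamma(n)$ with $b\ne a$ and $b\notin\mathrm{ne}_a$, $|S_a(b)|<\delta'$. Let the penalty parameter $\lambda=\lambda_n$ satisfy $\lambda_n\sim d\,n^{-(1-\varepsilon)/2}$ with some $\kappa<\varepsilon<\xi$ and $d>0$. Then there exists $c>0$ such that, for all $a\in\Gamma(n)$, $$P(\mathrm{ne}_a\subseteq\hat{\mathrm{ne}}_a^{\lambda})=1-O(\exp(-cn^\varepsilon))\qquad\text{as }n\to\infty.$$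
   Context: For each $n\in\mathbb{N}$ let $\Gamma(n)=\{1,\dots,p(n)\}$ be a finite set of nodes and let $X=(X_k)_{k\in\Gamma(n)}\sim\mathcal{N}(0,\Sigma(n))$ with $\Sigma(n)$ nonsingular; write $K=\Sigma^{-1}(n)$. The dependence on $n$ of the objects below is suppressed. $\mathbf{X}$ is the $n\times p(n)$ random matrix whose rows are $n$ independent observations of $X$; $\mathbf{X}_a\in\mathbb{R}^n$ is its column for node $a$; $\|\cdot\|_2$ is the Euclidean norm on $\mathbb{R}^n$, and $\|\theta\|_1=\sum_{b\in\Gamma(n)}|\theta_b|$. Graph: the edge set $E\subseteq\Gamma(n)\times\Gamma(n)$ consists of the pairs $(a,b)$, $a\ne b$, such that $X_a$ and $X_b$ are conditionally dependent given all remaining variables (equivalently $K_{ab}\neq0$). The neighborhood of $a$ is $\mathrm{ne}_a=\{b\in\Gamma(n)\setminus\{a\}:(a,b)\in E\}$; $a,b$ are neighboring if $b\in\mathrm{ne}_a$. The partial correlation is $\pi_{ab}=-K_{ab}/\sqrt{K_{aa}K_{bb}}$, the correlation of $X_a$ and $X_b$ after eliminating the linear effects of all remaining variables. Optimal prediction: for $\mathcal{A}\subseteq\Gamma(n)\setminus\{a\}$, $\theta^{a,\mathcal{A}}=\arg\min\{E(X_a-\sum_{k\in\Gamma(n)}\theta_kX_k)^2:\theta\in\mathbb{R}^{p(n)},\ \theta_k=0\ \forall k\notin\mathcal{A}\}$. For $a,b\in\Gamma(n)$ with $b\notin\mathrm{ne}_a\cup\{a\}$, $S_a(b)=\sum_{k\in\mathrm{ne}_a}\mathrm{sign}(\theta_k^{a,\mathrm{ne}_a})\,\theta_k^{b,\mathrm{ne}_a}$.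 Lasso: $\hat\theta^{a,\lambda}$ is any minimizer of $n^{-1}\|\mathbf{X}_a-\mathbf{X}\theta\|_2^2+\lambda\|\theta\|_1$ over $\theta\in\mathbb{R}^{p(n)}$ with $\theta_a=0$ (if it is not unique, the result is for any solution), and $\hat{\mathrm{ne}}_a^{\lambda}=\{b\in\Gamma(n):\hat\theta_b^{a,\lambda}\ne0\}$. $\lambda_n\sim d\,n^{-(1-\varepsilon)/2}$ means that the ratio tends to $1$. The $O(\cdot)$ bound is understood uniformly over $a\in\Gamma(n)$. *)

theory Defs
  imports
    "HOL-Probability.Probability"
    "HOL-Library.Landau_Symbols"
    "Jordan_Normal_Form.Determinant"
    "Jordan_Normal_Form.Gauss_Jordan_Elimination"
begin

text \<open>Nodes are labelled by \<open>{..<p}\<close>, as in the index convention of \<^typ>\<open>'a mat\<close>. A family of real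
  random variables \<open>X\<close> on \<open>M\<close> has type \<open>nat \<Rightarrow> 'w \<Rightarrow> real\<close>, and a vector of coefficients is a
  function \<open>nat \<Rightarrow> real\<close> that vanishes outside the set of nodes.\<close>

subsection \<open>Gaussian vectors\<close>

definition nonsingular_covariance :: "nat \<Rightarrow> real mat \<Rightarrow> bool" where
  "nonsingular_covariance p S \<longleftrightarrow>
     S \<in> carrier_mat p p \<and> transpose_mat S = S \<and>
     (\<forall>x \<in> carrier_vec p. 0 \<le> scalar_prod x (S *\<^sub>v x)) \<and> invertible_mat S"

definition precision_mat :: "real mat \<Rightarrow> real mat" where
  "precision_mat S = the (mat_inverse S)"

definition random_vec :: "nat set \<Rightarrow> (nat \<Rightarrow> 'w \<Rightarrow> real) \<Rightarrow> 'w \<Rightarrow> nat \<Rightarrow> real" where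
  "random_vec I X \<omega> = (\<lambda>k\<in>I. X k \<omega>)"

definition normal_vec_density :: "nat \<Rightarrow> real mat \<Rightarrow> (nat \<Rightarrow> real) \<Rightarrow> real" where
  "normal_vec_density p S x =
     exp (- (\<Sum>i<p. \<Sum>j<p. x i * precision_mat S $$ (i, j) * x j) / 2)
       / sqrt ((2 * pi) ^ p * Determinant.det S)"

definition multivariate_normal ::
  "'w measure \<Rightarrow> nat \<Rightarrow> real mat \<Rightarrow> (nat \<Rightarrow> 'w \<Rightarrow> real) \<Rightarrow> bool" where
  "multivariate_normal M p S X \<longleftrightarrow>
     nonsingular_covariance p S \<and>
     distributed M (\<Pi>\<^sub>M k\<in>{..<p}. lborel) (random_vec {..<p} X)
       (\<lambda>x. ennreal (normal_vec_density p S x))"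

subsection \<open>Conditioning\<close>

definition generated_algebra ::
  "'w measure \<Rightarrow> nat set \<Rightarrow> (nat \<Rightarrow> 'w \<Rightarrow> real) \<Rightarrow> 'w measure" where
  "generated_algebra M I X =
     vimage_algebra (space M) (random_vec I X) (\<Pi>\<^sub>M k\<in>I. (borel :: real measure))"

definition cond_variance ::
  "'w measure \<Rightarrow> 'w measure \<Rightarrow> ('w \<Rightarrow> real) \<Rightarrow> 'w \<Rightarrow> real" where
  "cond_variance M F Y =
     real_cond_exp M F (\<lambda>\<omega>. (Y \<omega> - real_cond_exp M F Y \<omega>)\<^sup>2)"

definition cond_prob_given :: "'w measure \<Rightarrow> 'w measure \<Rightarrow> 'w set \<Rightarrow> 'w \<Rightarrow> real" where
  "cond_prob_given M F A = real_cond_exp M F (indicator A)"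

definition cond_indep ::
  "'w measure \<Rightarrow> 'w measure \<Rightarrow> ('w \<Rightarrow> real) \<Rightarrow> ('w \<Rightarrow> real) \<Rightarrow> bool" where
  "cond_indep M F Y Z \<longleftrightarrow>
     (\<forall>A \<in> sets borel. \<forall>B \<in> sets borel.
        AE \<omega> in M. cond_prob_given M F {\<eta> \<in> space M. Y \<eta> \<in> A \<and> Z \<eta> \<in> B} \<omega> =
          cond_prob_given M F {\<eta> \<in> space M. Y \<eta> \<in> A} \<omega> *
          cond_prob_given M F {\<eta> \<in> space M. Z \<eta> \<in> B} \<omega>)"

subsection \<open>The conditional independence graph\<close>

definition edges :: "'w measure \<Rightarrow> nat \<Rightarrow> (nat \<Rightarrow> 'w \<Rightarrow> real) \<Rightarrow> (nat \<times> nat) set" where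
  "edges M p X = {(a, b). a < p \<and> b < p \<and> a \<noteq> b \<and>
     \<not> cond_indep M (generated_algebra M ({..<p} - {a, b}) X) (X a) (X b)}"

definition ne :: "'w measure \<Rightarrow> nat \<Rightarrow> (nat \<Rightarrow> 'w \<Rightarrow> real) \<Rightarrow> nat \<Rightarrow> nat set" where
  "ne M p X a = {b \<in> {..<p} - {a}. (a, b) \<in> edges M p X}"

definition partial_correlation :: "real mat \<Rightarrow> nat \<Rightarrow> nat \<Rightarrow> real" where
  "partial_correlation S a b =
     - (precision_mat S $$ (a, b)) /
       sqrt (precision_mat S $$ (a, a) * precision_mat S $$ (b, b))"

subsection \<open>Optimal prediction\<close>

definition opt_coeff ::
  "'w measure \<Rightarrow> nat \<Rightarrow> (nat \<Rightarrow> 'w \<Rightarrow> real) \<Rightarrow> nat \<Rightarrow> nat set \<Rightarrow> nat \<Rightarrow> real" where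
  "opt_coeff M p X a A =
     arg_min (\<lambda>\<theta>. \<integral>\<omega>. (X a \<omega> - (\<Sum>k<p. \<theta> k * X k \<omega>))\<^sup>2 \<partial>M)
       (\<lambda>\<theta>. \<forall>k. k \<notin> A \<longrightarrow> \<theta> k = 0)"

definition S_sum ::
  "'w measure \<Rightarrow> nat \<Rightarrow> (nat \<Rightarrow> 'w \<Rightarrow> real) \<Rightarrow> nat \<Rightarrow> nat \<Rightarrow> real" where
  "S_sum M p X a b =
     (\<Sum>k \<in> ne M p X a.
        sgn (opt_coeff M p X a (ne M p X a) k) * opt_coeff M p X b (ne M p X a) k)"

subsection \<open>The Lasso\<close>

definition norm1 :: "nat \<Rightarrow> (nat \<Rightarrow> real) \<Rightarrow> real" where
  "norm1 p \<theta> = (\<Sum>k<p. \<bar>\<theta> k\<bar>)"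

text \<open>\<open>D i k\<close> is the entry in row \<open>i\<close> and column \<open>k\<close> of an \<open>n \<times> p\<close> data matrix.\<close>

definition is_lasso ::
  "nat \<Rightarrow> nat \<Rightarrow> (nat \<Rightarrow> nat \<Rightarrow> real) \<Rightarrow> nat \<Rightarrow> real \<Rightarrow> (nat \<Rightarrow> real) \<Rightarrow> bool" where
  "is_lasso n p D a l =
     is_arg_min
       (\<lambda>\<theta>. (L2_set (\<lambda>i. D i a - (\<Sum>k<p. D i k * \<theta> k)) {..<n})\<^sup>2 / real n + l * norm1 p \<theta>)
       (\<lambda>\<theta>. \<theta> a = 0 \<and> (\<forall>k\<ge>p. \<theta> k = 0))"

definition est_ne :: "nat \<Rightarrow> (nat \<Rightarrow> real) \<Rightarrow> nat set" where
  "est_ne p \<theta> = {b \<in> {..<p}. \<theta> b \<noteq> 0}"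

end

theory Submission
  imports Defs "HOL-Real_Asymp.Real_Asymp"
begin

text \<open>Write \<open>N\<close> for the neighbourhood of \<open>a\<close>, and for each node \<open>k\<close> let \<open>w k\<close> be the residual of the
  population regression of \<open>X k\<close> on \<open>N - {k}\<close>. A Lasso problem only sees the data through the quadratic
  form of empirical second moments, so the proof splits into a deterministic statement about that form
  and a probability estimate.

  Deterministic part (\<open>lasso_detects_neighbours\<close>). Consider the Lasso restricted to coefficients supported
  in \<open>N\<close>. Its stationarity conditions bound the correlation of the Lasso residual with \<open>w b\<close>, for
  \<open>b \<in> N\<close>, by a constant times the penalty; here the bound on the regression coefficients of neighbours
  enters. Since \<open>w b\<close> is almost orthogonal to everything else in the residual, this correlation is
  essentially the error in coefficient \<open>b\<close> times the squared length of \<open>w b\<close>. So each coefficient is off by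
  \<open>O(\<lambda>)\<close>, which is less than the true coefficient, and the restricted solution has the right signs. For a
  node \<open>k\<close> outside \<open>N\<close> the gradient is then \<open>\<lambda>\<close> times the sum \<open>S a k\<close>, up to the negligible correlation of
  the residual with \<open>w k\<close>. As \<open>\<bar>S a k\<bar> < \<delta>' < 1\<close>, the gradient is strictly smaller than \<open>\<lambda>\<close>, and by
  convexity every solution of the full problem is supported in \<open>N\<close>, hence solves the restricted one and
  has the right signs on \<open>N\<close>.

  The main random input is that \<open>w k\<close>, which is uncorrelated with all combinations \<open>\<beta>\<close> of the nodes in
  \<open>orth_nodes a N k\<close>, has empirical covariance at most \<open>\<rho> * \<lambda>\<close> with them, uniformly on the empirical
  unit ball (\<open>near_orthogonality\<close>). A Bernstein bound makes this fail for a single \<open>\<beta>\<close> with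
  probability \<open>exp (- c * n * \<lambda>\<^sup>2)\<close>, where \<open>n * \<lambda>\<^sup>2\<close> is of order \<open>n powr \<epsilon>\<close>, and a grid for \<open>\<beta>\<close> has only
  \<open>exp (O (n powr \<kappa> * ln n))\<close> points because the supports have \<open>O (n powr \<kappa>)\<close> nodes. As \<open>\<kappa> < \<epsilon>\<close>, the union
  bound costs nothing in the exponent.

  The Gaussian facts all come from one identity (\<open>exponential_tilt\<close>): tilting the density by an
  exponential translates it. It yields the moments of linear combinations and their independence of the
  nodes with which they are uncorrelated. From this follow that conditionally independent pairs have zero
  precision entry (\<open>prec_zero_if_cond_indep\<close>), so that the regression of \<open>X a\<close> on \<open>N\<close> is its regression on
  all nodes, that the diagonal of the precision matrix is bounded by the inverse of the conditional
  variance (\<open>prec_diag_le\<close>), and hence that a lower bound on partial correlations is one on regression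
  coefficients (\<open>regress_nbh_ge\<close>).\<close>

section \<open>Quadratic forms\<close>

definition qform :: "nat \<Rightarrow> (nat \<Rightarrow> nat \<Rightarrow> real) \<Rightarrow> (nat \<Rightarrow> real) \<Rightarrow> (nat \<Rightarrow> real) \<Rightarrow> real" where
  "qform p C u v = (\<Sum>i<p. \<Sum>j<p. u i * C i j * v j)"

definition unit_coeff :: "nat \<Rightarrow> nat \<Rightarrow> real" where
  "unit_coeff k = (\<lambda>i. if i = k then 1 else 0)"

definition residual :: "nat \<Rightarrow> (nat \<Rightarrow> real) \<Rightarrow> nat \<Rightarrow> real" where
  "residual a \<theta> = (\<lambda>i. unit_coeff a i - \<theta> i)"

definition supported :: "nat set \<Rightarrow> (nat \<Rightarrow> real) \<Rightarrow> bool" where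
  "supported A u \<longleftrightarrow> (\<forall>k. k \<notin> A \<longrightarrow> u k = 0)"

lemma qform_add_left: "qform p C (\<lambda>i. u i + u' i) v = qform p C u v + qform p C u' v"
  and qform_add_right: "qform p C u (\<lambda>i. v i + v' i) = qform p C u v + qform p C u v'"
  and qform_diff_left: "qform p C (\<lambda>i. u i - u' i) v = qform p C u v - qform p C u' v"
  and qform_diff_right: "qform p C u (\<lambda>i. v i - v' i) = qform p C u v - qform p C u v'"
  and qform_scale_left: "qform p C (\<lambda>i. c * u i) v = c * qform p C u v"
  and qform_scale_right: "qform p C u (\<lambda>i. c * v i) = c * qform p C u v"
  by (simp_all add: qform_def sum.distrib sum_subtractf sum_distrib_left algebra_simps)

lemmas qform_linear = qform_add_left qform_add_right qform_diff_left qform_diff_right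
  qform_scale_left qform_scale_right

lemma sum_unit_coeff: "k < p \<Longrightarrow> (\<Sum>i<p. unit_coeff k i * f i) = f k"
  by (simp add: unit_coeff_def if_distrib[where f = "\<lambda>x. x * _"] sum.delta cong: if_cong)

lemma qform_unit_left: "k < p \<Longrightarrow> qform p C (unit_coeff k) v = (\<Sum>j<p. C k j * v j)"
  unfolding qform_def
  by (simp add: sum_unit_coeff[of k p "\<lambda>i. \<Sum>j<p. C i j * v j", symmetric] sum_distrib_left mult.assoc)

lemma qform_unit_right: "k < p \<Longrightarrow> qform p C u (unit_coeff k) = (\<Sum>i<p. u i * C i k)"
  unfolding qform_def
proof (rule sum.cong[OF refl])
  fix i assume "k < p"
  then show "(\<Sum>j<p. u i * C i j * unit_coeff k j) = u i * C i k"
    using sum_unit_coeff[of k p "\<lambda>j. u i * C i j"] by (simp only: mult.commute)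
qed

lemma qform_unit_unit: "i < p \<Longrightarrow> j < p \<Longrightarrow> qform p C (unit_coeff i) (unit_coeff j) = C i j"
  using sum_unit_coeff[of j p "\<lambda>k. C i k"] by (simp add: qform_unit_left mult.commute)

lemma qform_expand_right: "qform p C u v = (\<Sum>j<p. v j * qform p C u (unit_coeff j))"
proof -
  have "(\<Sum>j<p. v j * qform p C u (unit_coeff j)) = (\<Sum>j<p. \<Sum>i<p. u i * C i j * v j)"
    by (intro sum.cong) (simp_all add: qform_unit_right sum_distrib_left mult_ac)
  also have "\<dots> = qform p C u v" unfolding qform_def by (rule sum.swap)
  finally show ?thesis ..
qed

lemma qform_expand_supported:
  assumes "supported A v" "A \<subseteq> {..<p}"
  shows "qform p C u v = (\<Sum>j\<in>A. v j * qform p C u (unit_coeff j))"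
  unfolding qform_expand_right[of p C u v]
  by (rule sum.mono_neutral_right) (use assms in \<open>auto simp: supported_def\<close>)

lemma supported_mono: "supported A u \<Longrightarrow> A \<subseteq> B \<Longrightarrow> supported B u"
  by (auto simp: supported_def)

locale psd_form =
  fixes p :: nat and C :: "nat \<Rightarrow> nat \<Rightarrow> real"
  assumes sym: "i < p \<Longrightarrow> j < p \<Longrightarrow> C i j = C j i"
    and nonneg: "0 \<le> qform p C u u"
begin

abbreviation q where "q \<equiv> qform p C"

lemma q_sym: "q u v = q v u"
  unfolding qform_def
  by (subst sum.swap) (intro sum.cong, auto simp: sym mult_ac)

lemma q_add_self: "q (\<lambda>i. u i + v i) (\<lambda>i. u i + v i) = q u u + 2 * q u v + q v v"
  by (simp add: qform_linear q_sym[of v u])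

lemma q_diff_self: "q (\<lambda>i. u i - v i) (\<lambda>i. u i - v i) = q u u - 2 * q u v + q v v"
  by (simp add: qform_linear q_sym[of v u])

lemma Cauchy_Schwarz: "(q u v)\<^sup>2 \<le> q u u * q v v"
proof -
  have quad: "0 \<le> q u u - 2 * t * q u v + t\<^sup>2 * q v v" for t
    using nonneg[of "\<lambda>i. u i - t * v i"] by (simp add: qform_linear q_sym[of v u] power2_eq_square algebra_simps)
  show ?thesis
  proof (cases "q v v = 0")
    case True
    have "q u v = 0"
    proof (rule ccontr)
      assume "q u v \<noteq> 0"
      then show False using quad[of "(q u u + 1) / (2 * q u v)"] True by simp
    qed
    then show ?thesis using True by simp
  next
    case False
    then have pos: "q v v > 0" using nonneg[of v] by linarith
    have "0 \<le> q u u - (q u v)\<^sup>2 / q v v"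
      using quad[of "q u v / q v v"] pos by (simp add: power2_eq_square field_simps)
    then show ?thesis using pos by (simp add: field_simps)
  qed
qed

lemma Cauchy_Schwarz_sqrt: "\<bar>q u v\<bar> \<le> sqrt (q u u) * sqrt (q v v)"
  using real_le_rsqrt[of "\<bar>q u v\<bar>" "q u u * q v v"] Cauchy_Schwarz[of u v]
  by (simp add: real_sqrt_mult)

lemma triangle_diff: "sqrt (q (\<lambda>i. u i - v i) (\<lambda>i. u i - v i)) \<le> sqrt (q u u) + sqrt (q v v)"
proof (rule real_le_lsqrt)
  show "q (\<lambda>i. u i - v i) (\<lambda>i. u i - v i) \<le> (sqrt (q u u) + sqrt (q v v))\<^sup>2"
    using Cauchy_Schwarz_sqrt[of u v] nonneg[of u] nonneg[of v]
    by (simp add: q_diff_self power2_sum)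
qed (simp_all add: nonneg)

lemma sqrt_q_le_sum:
  assumes "supported A u" "A \<subseteq> {..<p}" "\<And>k. k \<in> A \<Longrightarrow> q (unit_coeff k) (unit_coeff k) \<le> c\<^sup>2" "0 \<le> c"
  shows "sqrt (q u u) \<le> c * (\<Sum>k\<in>A. \<bar>u k\<bar>)"
proof -
  have "q u u \<le> sqrt (q u u) * (c * (\<Sum>k\<in>A. \<bar>u k\<bar>))"
  proof -
    have "q u u = (\<Sum>j\<in>A. u j * q u (unit_coeff j))"
      by (rule qform_expand_supported[OF assms(1,2)])
    also have "\<dots> \<le> (\<Sum>j\<in>A. \<bar>u j\<bar> * (sqrt (q u u) * c))"
    proof (rule sum_mono)
      fix j assume j: "j \<in> A"
      have "sqrt (q (unit_coeff j) (unit_coeff j)) \<le> c"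
        using assms(3)[OF j] assms(4) by (simp add: real_le_lsqrt)
      then have "\<bar>q u (unit_coeff j)\<bar> \<le> sqrt (q u u) * c"
        using Cauchy_Schwarz_sqrt[of u "unit_coeff j"] nonneg[of u]
        by (meson mult_left_mono order_trans real_sqrt_ge_zero)
      then have "\<bar>u j * q u (unit_coeff j)\<bar> \<le> \<bar>u j\<bar> * (sqrt (q u u) * c)"
        by (simp add: abs_mult mult_left_mono)
      then show "u j * q u (unit_coeff j) \<le> \<bar>u j\<bar> * (sqrt (q u u) * c)" by linarith
    qed
    also have "\<dots> = sqrt (q u u) * (c * (\<Sum>k\<in>A. \<bar>u k\<bar>))"
      by (simp add: sum_distrib_left sum_distrib_right mult_ac)
    finally show ?thesis .
  qed
  then have "sqrt (q u u) * sqrt (q u u) \<le> sqrt (q u u) * (c * (\<Sum>k\<in>A. \<bar>u k\<bar>))"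
    using nonneg[of u] by simp
  moreover have "0 \<le> c * (\<Sum>k\<in>A. \<bar>u k\<bar>)" using assms(4) by (simp add: sum_nonneg)
  ultimately show ?thesis
    using nonneg[of u] mult_le_cancel_left_pos[of "sqrt (q u u)" "sqrt (q u u)" "c * (\<Sum>k\<in>A. \<bar>u k\<bar>)"]
    by (cases "q u u = 0") auto
qed

end

text \<open>Least squares, with or without an absolute-value penalty, over the coefficients supported in a finite
  set is minimisation of a continuous function, so all that existence needs is a bounded sublevel set.\<close>

lemma minimizer_exists:
  fixes f :: "(nat \<Rightarrow> real) \<Rightarrow> real"
  assumes "finite A" and cont: "continuous_on UNIV f"
    and bdd: "\<And>u k. supported A u \<Longrightarrow> f u \<le> f (\<lambda>_. 0) \<Longrightarrow> k \<in> A \<Longrightarrow> \<bar>u k\<bar> \<le> R"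
  shows "\<exists>u. is_arg_min f (supported A) u"
proof -
  define R' where "R' = max 0 R"
  define K where "K = (\<lambda>k::nat. if k \<in> A then {- R'..R'} else {0})"
  have PK: "PiE UNIV K = {u. \<forall>k. u k \<in> K k}" by auto
  have "compactin (product_topology (\<lambda>i. euclidean) UNIV) (PiE UNIV K)"
    by (subst compactin_PiE) (auto simp: K_def compactin_euclidean_iff)
  then have comp: "compact (PiE UNIV K)"
    by (simp add: euclidean_product_topology compactin_euclidean_iff)
  have z: "(\<lambda>_. 0) \<in> PiE UNIV K" by (auto simp: K_def R'_def)
  obtain u where u: "u \<in> PiE UNIV K" and umin: "\<And>w. w \<in> PiE UNIV K \<Longrightarrow> f u \<le> f w"
    using continuous_attains_inf[OF comp _ continuous_on_subset[OF cont]] z by blast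
  have su: "supported A u"
    unfolding supported_def
  proof (intro allI impI)
    fix k assume "k \<notin> A"
    then have "K k = {0}" by (simp add: K_def)
    moreover have "u k \<in> K k" using u PK by blast
    ultimately show "u k = 0" by simp
  qed
  have "f u \<le> f w" if w: "supported A w" for w
  proof (cases "f w \<le> f (\<lambda>_. 0)")
    case True
    have "w k \<in> K k" for k
    proof (cases "k \<in> A")
      case True
      then have "\<bar>w k\<bar> \<le> R'" using bdd[OF w \<open>f w \<le> f (\<lambda>_. 0)\<close>] by (simp add: R'_def max.coboundedI2)
      then show ?thesis using True by (simp add: K_def abs_le_iff)
    next
      case False
      then show ?thesis using w by (simp add: K_def supported_def)
    qed
    then have "w \<in> PiE UNIV K" using PK by blast
    then show ?thesis by (rule umin)
  next
    case False then show ?thesis using umin[OF z] by linarith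
  qed
  then show ?thesis using su by (auto simp: is_arg_min_linorder)
qed

lemma continuous_qform_residual:
  "continuous_on UNIV (\<lambda>\<theta>::nat\<Rightarrow>real. qform p C (\<lambda>i. u i - \<theta> i) (\<lambda>i. u i - \<theta> i))"
  unfolding qform_def
  by (intro continuous_intros continuous_on_product_coordinates)

section \<open>Restricted Lasso solutions\<close>

lemma nonpos_of_linear_le_quadratic:
  fixes y c e :: real
  assumes "\<And>s. 0 < s \<Longrightarrow> s < e \<Longrightarrow> s * y \<le> s\<^sup>2 * c" "0 < e"
  shows "y \<le> 0"
proof (rule ccontr)
  assume "\<not> y \<le> 0"
  then have y: "y > 0" by simp
  define s where "s = min (e / 2) (y / (2 * (\<bar>c\<bar> + 1)))"
  have s: "0 < s" "s < e" using y assms(2) by (auto simp: s_def min_less_iff_disj)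
  then have "y \<le> s * c" using assms(1)[OF s] by (simp add: power2_eq_square)
  also have "\<dots> \<le> s * (\<bar>c\<bar> + 1)" using s by (intro mult_left_mono) auto
  also have "\<dots> \<le> y / (2 * (\<bar>c\<bar> + 1)) * (\<bar>c\<bar> + 1)" by (intro mult_right_mono) (auto simp: s_def)
  also have "\<dots> = y / 2" by (simp add: field_simps)
  finally show False using y by simp
qed

text \<open>One coordinate of the Lasso objective, as a function of the shift \<open>s\<close>: its one-sided derivatives
  in \<open>s = 0\<close> give the stationarity conditions.\<close>

lemma penalized_quadratic_minimum:
  fixes x g c l :: real
  assumes min: "\<And>s::real. 0 \<le> - 2 * s * g + s\<^sup>2 * c + l * (\<bar>x + s\<bar> - \<bar>x\<bar>)" and l: "0 \<le> l"
  shows "\<bar>2 * g\<bar> \<le> l" and "x \<noteq> 0 \<Longrightarrow> 2 * g = l * sgn x"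
proof -
  have tri: "l * (\<bar>x + s\<bar> - \<bar>x\<bar>) \<le> l * \<bar>s\<bar>" for s using l by (intro mult_left_mono) auto
  have "2 * g - l \<le> 0"
  proof (rule nonpos_of_linear_le_quadratic[where e = 1 and c = c])
    fix s :: real assume "0 < s" then show "s * (2 * g - l) \<le> s\<^sup>2 * c"
      using min[of s] tri[of s] by (simp add: algebra_simps)
  qed simp
  moreover have "- 2 * g - l \<le> 0"
  proof (rule nonpos_of_linear_le_quadratic[where e = 1 and c = c])
    fix s :: real assume "0 < s" then show "s * (- 2 * g - l) \<le> s\<^sup>2 * c"
      using min[of "-s"] tri[of "-s"] by (simp add: algebra_simps)
  qed simp
  ultimately show "\<bar>2 * g\<bar> \<le> l" by linarith
  assume x: "x \<noteq> 0"
  have lin: "\<bar>x + s\<bar> - \<bar>x\<bar> = s * sgn x" if "\<bar>s\<bar> < \<bar>x\<bar>" for s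
    using that x by (cases "x > 0") auto
  have "2 * g - l * sgn x \<le> 0"
  proof (rule nonpos_of_linear_le_quadratic[where e = "\<bar>x\<bar>" and c = c])
    fix s :: real assume "0 < s" "s < \<bar>x\<bar>" then show "s * (2 * g - l * sgn x) \<le> s\<^sup>2 * c"
      using min[of s] lin[of s] by (simp add: algebra_simps)
  qed (simp add: x)
  moreover have "l * sgn x - 2 * g \<le> 0"
  proof (rule nonpos_of_linear_le_quadratic[where e = "\<bar>x\<bar>" and c = c])
    fix s :: real assume s: "0 < s" "s < \<bar>x\<bar>"
    then have l2: "\<bar>x + - s\<bar> - \<bar>x\<bar> = - s * sgn x" by (intro lin) simp
    show "s * (l * sgn x - 2 * g) \<le> s\<^sup>2 * c"
      using min[of "-s"] unfolding l2
      by (simp add: algebra_simps)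
  qed (simp add: x)
  ultimately show "2 * g = l * sgn x" by linarith
qed

context psd_form
begin

definition lasso_obj :: "nat \<Rightarrow> real \<Rightarrow> (nat \<Rightarrow> real) \<Rightarrow> real" where
  "lasso_obj a l \<theta> = q (residual a \<theta>) (residual a \<theta>) + l * norm1 p \<theta>"

lemma norm1_add_unit:
  assumes "k < p"
  shows "norm1 p (\<lambda>i. \<theta> i + s * unit_coeff k i) - norm1 p \<theta> = \<bar>\<theta> k + s\<bar> - \<bar>\<theta> k\<bar>"
proof -
  have "norm1 p (\<lambda>i. \<theta> i + s * unit_coeff k i) - norm1 p \<theta>
      = (\<Sum>i<p. \<bar>\<theta> i + s * unit_coeff k i\<bar> - \<bar>\<theta> i\<bar>)"
    by (simp add: norm1_def sum_subtractf)
  also have "\<dots> = (\<Sum>i<p. if i = k then \<bar>\<theta> k + s\<bar> - \<bar>\<theta> k\<bar> else 0)"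
    by (rule sum.cong) (auto simp: unit_coeff_def)
  finally show ?thesis using assms by simp
qed

lemma residual_obj_add:
  "q (residual a (\<lambda>i. \<theta> i + h i)) (residual a (\<lambda>i. \<theta> i + h i))
     = q (residual a \<theta>) (residual a \<theta>) - 2 * q (residual a \<theta>) h + q h h"
proof -
  have "residual a (\<lambda>i. \<theta> i + h i) = (\<lambda>i. residual a \<theta> i - h i)"
    by (auto simp: residual_def)
  then show ?thesis by (simp add: q_diff_self)
qed

lemma restricted_lasso_KKT:
  assumes l: "0 \<le> l" and min: "is_arg_min (lasso_obj a l) (supported A) \<theta>"
    and k: "k \<in> A" "A \<subseteq> {..<p}"
  shows "\<bar>2 * q (residual a \<theta>) (unit_coeff k)\<bar> \<le> l"
    and "\<theta> k \<noteq> 0 \<Longrightarrow> 2 * q (residual a \<theta>) (unit_coeff k) = l * sgn (\<theta> k)"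
proof -
  have *: "0 \<le> - 2 * s * q (residual a \<theta>) (unit_coeff k)
        + s\<^sup>2 * q (unit_coeff k) (unit_coeff k) + l * (\<bar>\<theta> k + s\<bar> - \<bar>\<theta> k\<bar>)" for s
  proof -
    let ?h = "\<lambda>i. s * unit_coeff k i"
    have "supported A (\<lambda>i. \<theta> i + ?h i)"
      using min k by (auto simp: is_arg_min_linorder supported_def unit_coeff_def)
    then have "lasso_obj a l \<theta> \<le> lasso_obj a l (\<lambda>i. \<theta> i + ?h i)"
      using min by (auto simp: is_arg_min_linorder)
    moreover have "norm1 p (\<lambda>i. \<theta> i + ?h i) = norm1 p \<theta> + (\<bar>\<theta> k + s\<bar> - \<bar>\<theta> k\<bar>)"
      using norm1_add_unit[of k \<theta> s] k by auto
    ultimately show ?thesis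
      by (simp add: lasso_obj_def residual_obj_add qform_linear power2_eq_square algebra_simps)
  qed
  show "\<bar>2 * q (residual a \<theta>) (unit_coeff k)\<bar> \<le> l"
    and "\<theta> k \<noteq> 0 \<Longrightarrow> 2 * q (residual a \<theta>) (unit_coeff k) = l * sgn (\<theta> k)"
    using penalized_quadratic_minimum[of "q (residual a \<theta>) (unit_coeff k)", OF * l] by auto
qed

lemma restricted_lasso_exists:
  assumes "finite A" "A \<subseteq> {..<p}" and l: "0 < l"
  shows "\<exists>\<theta>. is_arg_min (lasso_obj a l) (supported A) \<theta>"
proof (rule minimizer_exists[OF \<open>finite A\<close>, where R = "lasso_obj a l (\<lambda>_. 0) / l"])
  show "continuous_on UNIV (lasso_obj a l)"
    unfolding lasso_obj_def residual_def norm1_def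
    by (intro continuous_intros continuous_qform_residual continuous_on_product_coordinates)
  fix u k assume u: "lasso_obj a l u \<le> lasso_obj a l (\<lambda>_. 0)" and k: "k \<in> A"
  have "l * \<bar>u k\<bar> \<le> l * norm1 p u"
    unfolding norm1_def using l k assms(2) by (intro mult_left_mono member_le_sum) auto
  also have "\<dots> \<le> lasso_obj a l u" using nonneg by (simp add: lasso_obj_def)
  finally show "\<bar>u k\<bar> \<le> lasso_obj a l (\<lambda>_. 0) / l" using u l by (simp add: field_simps)
qed

text \<open>The subgradient inequality is strict in every coordinate in which the dual certificate is
  strictly below the penalty, so no minimiser can use such a coordinate.\<close>

lemma lasso_supported_if_strictly_dual_feasible:
  assumes l: "0 < l" and min: "is_arg_min (lasso_obj a l) (supported A) \<theta>"
    and A: "A \<subseteq> B" "B \<subseteq> {..<p}"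
    and strict: "\<And>k. k \<in> B - A \<Longrightarrow> \<bar>2 * q (residual a \<theta>) (unit_coeff k)\<bar> < l"
    and full: "is_arg_min (lasso_obj a l) (supported B) \<theta>'"
  shows "is_arg_min (lasso_obj a l) (supported A) \<theta>'"
proof -
  have s: "supported A \<theta>" "supported B \<theta>'" using min full by (auto simp: is_arg_min_linorder)
  have sB: "supported B \<theta>" using s(1) A by (rule_tac supported_mono) auto
  define h where "h = (\<lambda>i. \<theta>' i - \<theta> i)"
  have th': "\<theta>' = (\<lambda>i. \<theta> i + h i)" by (auto simp: h_def)
  have hB: "supported B h" using s(2) sB by (auto simp: h_def supported_def)
  let ?g = "\<lambda>k. 2 * q (residual a \<theta>) (unit_coeff k)"
  have trm: "h k * ?g k \<le> l * \<bar>\<theta>' k\<bar> - l * \<bar>\<theta> k\<bar>"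
    and trm_strict: "k \<notin> A \<Longrightarrow> \<theta>' k \<noteq> 0 \<Longrightarrow> h k * ?g k < l * \<bar>\<theta>' k\<bar> - l * \<bar>\<theta> k\<bar>" if k: "k \<in> B" for k
  proof -
    have ub: "\<theta>' k * ?g k \<le> l * \<bar>\<theta>' k\<bar>" if "\<bar>?g k\<bar> \<le> l"
    proof -
      have "\<theta>' k * ?g k \<le> \<bar>\<theta>' k\<bar> * \<bar>?g k\<bar>" by (metis abs_ge_self abs_mult)
      also have "\<dots> \<le> \<bar>\<theta>' k\<bar> * l" using that by (intro mult_left_mono) auto
      finally show ?thesis by (simp add: mult.commute)
    qed
    have str: "h k * ?g k < l * \<bar>\<theta>' k\<bar> - l * \<bar>\<theta> k\<bar>" if "k \<notin> A" "\<theta>' k \<noteq> 0"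
    proof -
      have t0: "\<theta> k = 0" using s(1) that by (auto simp: supported_def)
      have "\<theta>' k * ?g k \<le> \<bar>\<theta>' k\<bar> * \<bar>?g k\<bar>" by (metis abs_ge_self abs_mult)
      also have "\<dots> < \<bar>\<theta>' k\<bar> * l" using that strict[of k] k by (intro mult_strict_left_mono) auto
      finally show ?thesis using t0 by (simp add: h_def mult.commute)
    qed
    then show "k \<notin> A \<Longrightarrow> \<theta>' k \<noteq> 0 \<Longrightarrow> h k * ?g k < l * \<bar>\<theta>' k\<bar> - l * \<bar>\<theta> k\<bar>" .
    show "h k * ?g k \<le> l * \<bar>\<theta>' k\<bar> - l * \<bar>\<theta> k\<bar>"
    proof (cases "k \<in> A")
      case True
      have kkt: "\<bar>?g k\<bar> \<le> l" "\<theta> k \<noteq> 0 \<Longrightarrow> ?g k = l * sgn (\<theta> k)"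
        using restricted_lasso_KKT[OF _ min True] l A by auto
      have "\<theta> k * ?g k = l * \<bar>\<theta> k\<bar>"
        using kkt(2) by (cases "\<theta> k = 0") (auto simp: abs_sgn mult_ac)
      then show ?thesis using ub[OF kkt(1)] by (simp add: h_def algebra_simps)
    next
      case False
      then have t0: "\<theta> k = 0" using s(1) by (auto simp: supported_def)
      show ?thesis
        using str[OF False] t0 by (cases "\<theta>' k = 0") (auto simp: h_def)
    qed
  qed
  have lin: "2 * q (residual a \<theta>) h = (\<Sum>k\<in>B. h k * ?g k)"
    using qform_expand_supported[OF hB A(2), of C "residual a \<theta>"]
    by (simp add: sum_distrib_left mult_ac)
  have norms: "norm1 p u = (\<Sum>k\<in>B. \<bar>u k\<bar>)" if "supported B u" for u
    unfolding norm1_def by (rule sum.mono_neutral_right) (use that A in \<open>auto simp: supported_def\<close>)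
  have finB: "finite B" using A finite_subset by blast
  have obj: "lasso_obj a l \<theta>' - lasso_obj a l \<theta>
      = q h h + ((\<Sum>k\<in>B. l * \<bar>\<theta>' k\<bar> - l * \<bar>\<theta> k\<bar>) - (\<Sum>k\<in>B. h k * ?g k))"
    unfolding lasso_obj_def norms[OF s(2)] norms[OF sB] lin[symmetric]
    by (subst (1 2) th') (simp add: residual_obj_add sum_subtractf sum_distrib_left)
  have le: "lasso_obj a l \<theta>' \<le> lasso_obj a l \<theta>" using full sB by (auto simp: is_arg_min_linorder)
  have "supported A \<theta>'"
  proof (rule ccontr)
    assume "\<not> supported A \<theta>'"
    then obtain k where k: "k \<notin> A" "\<theta>' k \<noteq> 0" by (auto simp: supported_def)
    then have kB: "k \<in> B" using s(2) by (auto simp: supported_def)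
    have "(\<Sum>k\<in>B. h k * ?g k) < (\<Sum>k\<in>B. l * \<bar>\<theta>' k\<bar> - l * \<bar>\<theta> k\<bar>)"
      by (rule sum_strict_mono_ex1[OF finB]) (use trm trm_strict[OF kB k] kB in auto)
    then show False using obj le nonneg[of h] by linarith
  qed
  then show ?thesis using le min by (auto simp: is_arg_min_linorder intro: order_trans)
qed

end

section \<open>Sign recovery under near-orthogonality\<close>

lemma sgn_eq_of_close: "\<bar>x - y\<bar> < \<bar>x\<bar> \<Longrightarrow> sgn y = sgn (x::real)"
  by (auto simp: sgn_real_def abs_if split: if_splits)

context psd_form
begin

lemma residual_restricted_lasso:
  assumes l: "0 < l" and min: "is_arg_min (lasso_obj a l) (supported A) \<theta>"
  shows "q (residual a \<theta>) (residual a \<theta>) \<le> q (unit_coeff a) (unit_coeff a)"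
    and "k < p \<Longrightarrow> \<bar>\<theta> k\<bar> \<le> q (unit_coeff a) (unit_coeff a) / l"
proof -
  have "lasso_obj a l \<theta> \<le> lasso_obj a l (\<lambda>_. 0)"
    using min by (auto simp: is_arg_min_linorder supported_def)
  then have le: "q (residual a \<theta>) (residual a \<theta>) + l * norm1 p \<theta> \<le> q (unit_coeff a) (unit_coeff a)"
    by (simp add: lasso_obj_def residual_def norm1_def)
  have n: "0 \<le> l * norm1 p \<theta>" using l by (simp add: norm1_def sum_nonneg)
  show "q (residual a \<theta>) (residual a \<theta>) \<le> q (unit_coeff a) (unit_coeff a)" using le n by linarith
  assume "k < p"
  then have "l * \<bar>\<theta> k\<bar> \<le> l * norm1 p \<theta>"
    unfolding norm1_def using l by (intro mult_left_mono member_le_sum) auto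
  also have "\<dots> \<le> q (unit_coeff a) (unit_coeff a)" using le nonneg[of "residual a \<theta>"] by linarith
  finally show "\<bar>\<theta> k\<bar> \<le> q (unit_coeff a) (unit_coeff a) / l" using l by (simp add: field_simps)
qed

lemma q_residual_right:
  assumes "k < p" "supported A t" "A \<subseteq> {..<p}"
  shows "q u (residual k t) = q u (unit_coeff k) - (\<Sum>j\<in>A. t j * q u (unit_coeff j))"
  unfolding residual_def qform_diff_right qform_expand_supported[OF assms(2,3)] ..

end

definition orth_nodes :: "nat \<Rightarrow> nat set \<Rightarrow> nat \<Rightarrow> nat set" where
  "orth_nodes a N k = (if k \<in> insert a N then N - {k} else insert a N)"

text \<open>Deterministic heart of the argument. The vector \<open>t k\<close> stands for the population regression of
  node \<open>k\<close> on \<open>N - {k}\<close>, and the form \<open>q\<close> for the empirical second moments. The population residual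
  \<open>residual k (t k)\<close> is uncorrelated with every combination of the nodes in \<open>orth_nodes a N k\<close>; \<open>near_orth\<close> says that
  this survives, up to a small multiple of the penalty, when empirical moments replace the true ones.\<close>

locale lasso_design = psd_form +
  fixes a :: nat and N :: "nat set" and t :: "nat \<Rightarrow> nat \<Rightarrow> real"
    and l \<rho> v Th B R s1 :: real
  assumes a: "a < p" and N: "N \<subseteq> {..<p} - {a}"
    and pos: "0 < l" "0 < v" "0 \<le> \<rho>" "0 \<le> Th" "0 \<le> B"
    and t_supp: "k < p \<Longrightarrow> supported (N - {k}) (t k)"
    and diag_le: "k < p \<Longrightarrow> q (unit_coeff k) (unit_coeff k) \<le> 4"
    and resid_le: "k \<in> insert a N \<Longrightarrow> q (residual k (t k)) (residual k (t k)) \<le> 4"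
    and resid_ge: "k \<in> N \<Longrightarrow> v\<^sup>2 / 8 \<le> q (residual k (t k)) (residual k (t k))"
    and near_orth: "k < p \<Longrightarrow> supported (orth_nodes a N k) \<beta> \<Longrightarrow> (\<And>j. \<bar>\<beta> j\<bar> \<le> R) \<Longrightarrow> q \<beta> \<beta> \<le> 1 \<Longrightarrow>
        \<bar>q \<beta> (residual k (t k))\<bar> \<le> \<rho> * l"
    and t_norm: "k \<in> N \<Longrightarrow> (\<Sum>j\<in>N - {k}. \<bar>t k j\<bar>) \<le> Th"
    and ta_le: "k \<in> N \<Longrightarrow> \<bar>t a k\<bar> \<le> B"
    and R: "(1 + B + 4 / l) * (1 + Th) \<le> R"
    and gap: "k \<in> N \<Longrightarrow> 8 / v\<^sup>2 * ((1 + Th) / 2 + 8 * \<rho>) * l < \<bar>t a k\<bar>"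
    and small: "\<rho> * l \<le> v\<^sup>2 / 16" "\<rho> * l \<le> 1 / 2"
    and incoherent: "k < p \<Longrightarrow> k \<noteq> a \<Longrightarrow> k \<notin> N \<Longrightarrow> \<bar>\<Sum>j\<in>N. sgn (t a j) * t k j\<bar> < s1"
    and s1: "4 * \<rho> \<le> 1 - s1"
begin

lemma finN: "finite N" and Np: "N \<subseteq> {..<p}"
  using N finite_subset[of N "{..<p} - {a}"] by auto

lemma R_ge: "1 + 4 / l \<le> R" "1 + Th \<le> R" "0 \<le> R"
proof -
  have e: "(1 + B + 4 / l) * (1 + Th) = 1 + B + 4 / l + Th + B * Th + 4 / l * Th"
    by (simp add: ring_distribs)
  have "0 \<le> 4 / l" "0 \<le> B * Th" "0 \<le> 4 / l * Th" using pos by auto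
  then show "1 + 4 / l \<le> R" "1 + Th \<le> R" "0 \<le> R" using R pos unfolding e by linarith+
qed

text \<open>The near-orthogonality is only assumed on the unit ball of \<open>q\<close>; shrinking \<open>\<beta>\<close> extends it.\<close>

lemma near_orth_scaled:
  assumes k: "k < p" "supported (orth_nodes a N k) \<beta>" and bd: "\<And>j. \<bar>\<beta> j\<bar> \<le> R"
  shows "\<bar>q \<beta> (residual k (t k))\<bar> \<le> \<rho> * l * max 1 (sqrt (q \<beta> \<beta>))"
proof -
  define m where "m = max 1 (sqrt (q \<beta> \<beta>))"
  have m: "1 \<le> m" "sqrt (q \<beta> \<beta>) \<le> m" by (auto simp: m_def)
  have qm: "q \<beta> \<beta> \<le> m * m"
    using m nonneg[of \<beta>] by (metis real_sqrt_ge_zero mult_mono' real_sqrt_mult_self abs_of_nonneg)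
  have "\<bar>q (\<lambda>j. (1 / m) * \<beta> j) (residual k (t k))\<bar> \<le> \<rho> * l"
  proof (rule near_orth[OF k(1)])
    show "supported (orth_nodes a N k) (\<lambda>j. (1 / m) * \<beta> j)" using k(2) by (auto simp: supported_def)
    show "\<bar>(1 / m) * \<beta> j\<bar> \<le> R" for j
    proof -
      have "\<bar>\<beta> j\<bar> / m \<le> \<bar>\<beta> j\<bar>" using m(1) by (simp add: divide_le_eq mult_le_cancel_left1)
      then show ?thesis using m(1) bd[of j] by (simp add: abs_mult)
    qed
    show "q (\<lambda>j. (1 / m) * \<beta> j) (\<lambda>j. (1 / m) * \<beta> j) \<le> 1"
      using qm m(1) unfolding qform_linear by (simp add: field_simps)
  qed
  then have "\<bar>q \<beta> (residual k (t k))\<bar> / m \<le> \<rho> * l"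
    unfolding qform_scale_left using m(1) by (simp add: abs_mult)
  then show ?thesis using m(1) by (simp add: m_def[symmetric] field_simps)
qed

lemma restricted_lasso_bounds:
  assumes min: "is_arg_min (lasso_obj a l) (supported N) \<theta>"
  shows "q (residual a \<theta>) (residual a \<theta>) \<le> 4" and "k < p \<Longrightarrow> \<bar>\<theta> k\<bar> \<le> 4 / l"
proof -
  show "q (residual a \<theta>) (residual a \<theta>) \<le> 4"
    using residual_restricted_lasso(1)[OF pos(1) min] diag_le[OF a] by linarith
  assume "k < p"
  then have "\<bar>\<theta> k\<bar> \<le> q (unit_coeff a) (unit_coeff a) / l"
    by (rule residual_restricted_lasso(2)[OF pos(1) min])
  also have "\<dots> \<le> 4 / l" using diag_le[OF a] pos(1) by (intro divide_right_mono) auto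
  finally show "\<bar>\<theta> k\<bar> \<le> 4 / l" .
qed

text \<open>The residual of the restricted Lasso is \<open>wa + \<beta> + \<tau> * wb\<close>, where \<open>\<tau>\<close> is the error in coefficient \<open>b\<close>,
  \<open>wa\<close> and \<open>wb\<close> are the population residuals of \<open>a\<close> and \<open>b\<close>, and \<open>\<beta>\<close> is supported in \<open>N - {b}\<close>. Since
  \<open>wa\<close> and \<open>\<beta>\<close> are nearly orthogonal to \<open>wb\<close>, testing the residual against \<open>wb\<close> isolates \<open>\<tau>\<close>, and the
  stationarity conditions bound the result by a multiple of \<open>l\<close>.\<close>

lemma restricted_lasso_close:
  assumes min: "is_arg_min (lasso_obj a l) (supported N) \<theta>" and b: "b \<in> N"
  shows "\<bar>t a b - \<theta> b\<bar> < \<bar>t a b\<bar>"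
proof -
  define r where "r = residual a \<theta>"
  define wa where "wa = residual a (t a)"
  define wb where "wb = residual b (t b)"
  define \<tau> where "\<tau> = t a b - \<theta> b"
  define \<beta> where "\<beta> = (\<lambda>j. if j = b then 0 else t a j - \<theta> j + \<tau> * t b j)"
  define m where "m = \<rho> * l"
  have bp: "b < p" "b \<noteq> a" using b N by auto
  have \<theta>s: "supported N \<theta>" using min by (auto simp: is_arg_min_linorder)
  have rr: "q r r \<le> 4" and \<theta>b: "k < p \<Longrightarrow> \<bar>\<theta> k\<bar> \<le> 4 / l" for k
    using restricted_lasso_bounds[OF min] by (auto simp: r_def)
  have tas: "supported N (t a)" using t_supp[OF a] by (rule supported_mono) auto
  have tbs: "supported (N - {b}) (t b)" using t_supp[OF bp(1)] .
  have tb_le: "\<bar>t b j\<bar> \<le> Th" for j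
  proof (cases "j \<in> N - {b}")
    case True
    then have "\<bar>t b j\<bar> \<le> (\<Sum>j\<in>N - {b}. \<bar>t b j\<bar>)" using finN by (intro member_le_sum) auto
    then show ?thesis using t_norm[OF b] by linarith
  next
    case False then show ?thesis using tbs pos by (simp add: supported_def)
  qed
  have dec: "r = (\<lambda>j. wa j + (\<beta> j + \<tau> * wb j))"
    using tbs by (auto simp: r_def wa_def wb_def residual_def \<beta>_def \<tau>_def supported_def unit_coeff_def fun_eq_iff algebra_simps)
  have "\<bar>\<tau>\<bar> \<le> B + 4 / l" using ta_le[OF b] \<theta>b[OF bp(1)] by (auto simp: \<tau>_def)
  have \<beta>_le: "\<bar>\<beta> j\<bar> \<le> R" for j
  proof (cases "j \<in> N - {b}")
    case True
    then have jp: "j < p" using Np by auto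
    have "\<bar>\<tau> * t b j\<bar> \<le> (B + 4 / l) * Th"
      unfolding abs_mult using \<open>\<bar>\<tau>\<bar> \<le> _\<close> tb_le[of j] pos by (intro mult_mono) auto
    moreover have "\<bar>t a j - \<theta> j\<bar> \<le> B + 4 / l" using ta_le[of j] \<theta>b[OF jp] True by auto
    ultimately have "\<bar>\<beta> j\<bar> \<le> B + 4 / l + (B + 4 / l) * Th" using True by (simp add: \<beta>_def)
    also have "\<dots> \<le> B + 4 / l + (B + 4 / l) * Th + (1 + Th)" using pos by simp
    also have "\<dots> = (1 + B + 4 / l) * (1 + Th)" by (simp add: ring_distribs)
    finally show ?thesis using R by linarith
  next
    case False
    then show ?thesis using R_ge tas \<theta>s tbs by (auto simp: \<beta>_def supported_def)
  qed
  have \<beta>s: "supported (orth_nodes a N b) \<beta>" using tas \<theta>s tbs b by (auto simp: \<beta>_def orth_nodes_def supported_def)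
  have wbs: "supported (orth_nodes a N a) wb" "\<bar>wb j\<bar> \<le> R" for j
  proof -
    show "supported (orth_nodes a N a) wb"
      using tbs b bp N by (auto simp: wb_def residual_def orth_nodes_def supported_def unit_coeff_def)
    have "\<bar>wb j\<bar> \<le> 1 + Th"
      using tb_le[of j] by (auto simp: wb_def residual_def unit_coeff_def)
    then show "\<bar>wb j\<bar> \<le> R" using R_ge by linarith
  qed
  have wbwb: "q wb wb \<le> 4" "v\<^sup>2 / 8 \<le> q wb wb" and wawa: "q wa wa \<le> 4"
    using resid_le[of b] resid_le[of a] resid_ge[of b] b by (auto simp: wb_def wa_def)
  have m: "0 \<le> m" "m \<le> v\<^sup>2 / 16" "m \<le> 1 / 2" using pos small by (auto simp: m_def)
  have c1: "\<bar>q wb wa\<bar> \<le> 2 * m"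
  proof -
    have "sqrt (q wb wb) \<le> 2" using wbwb by (simp add: real_le_lsqrt)
    then have "m * max 1 (sqrt (q wb wb)) \<le> m * 2" using m by (intro mult_left_mono) auto
    moreover have "\<bar>q wb wa\<bar> \<le> m * max 1 (sqrt (q wb wb))"
      unfolding wa_def m_def using wbs by (intro near_orth_scaled[OF a]) auto
    ultimately show ?thesis by linarith
  qed
  define s where "s = sqrt (q \<beta> \<beta>)"
  have s: "0 \<le> s" "s\<^sup>2 = q \<beta> \<beta>" using nonneg[of \<beta>] by (auto simp: s_def)
  have c2: "\<bar>q \<beta> wb\<bar> \<le> m * max 1 s"
    unfolding wb_def m_def s_def by (intro near_orth_scaled[OF bp(1) \<beta>s] \<beta>_le)
  have q16: "q (\<lambda>j. \<beta> j + \<tau> * wb j) (\<lambda>j. \<beta> j + \<tau> * wb j) \<le> 16"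
  proof -
    have e: "(\<lambda>j. \<beta> j + \<tau> * wb j) = (\<lambda>j. r j - wa j)" by (simp add: dec)
    have "sqrt (q r r) \<le> 2" "sqrt (q wa wa) \<le> 2" using rr wawa by (auto simp: real_le_lsqrt)
    then have "sqrt (q (\<lambda>j. r j - wa j) (\<lambda>j. r j - wa j)) \<le> 4" using triangle_diff[of r wa] by linarith
    then show ?thesis unfolding e using sqrt_le_D by fastforce
  qed
  \<comment> \<open>\<beta> has no a priori bound. Near-orthogonality makes its length and that of \<open>\<tau> * wb\<close> almost add up
    to the length of their sum, which is bounded, so neither can be large.\<close>
  have s6: "max 1 s \<le> 6"
  proof -
    have "(max 1 s)\<^sup>2 \<le> 1 + s\<^sup>2" by (auto simp: max_def)
    have "2 * \<bar>\<tau>\<bar> * max 1 s \<le> \<tau>\<^sup>2 + (max 1 s)\<^sup>2"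
      using sum_squares_bound[of "\<bar>\<tau>\<bar>" "max 1 s"] by simp
    then have "2 * \<bar>\<tau>\<bar> * max 1 s \<le> \<tau>\<^sup>2 + (1 + s\<^sup>2)" using \<open>(max 1 s)\<^sup>2 \<le> 1 + s\<^sup>2\<close> by linarith
    then have "m * (2 * \<bar>\<tau>\<bar> * max 1 s) \<le> m * (\<tau>\<^sup>2 + (1 + s\<^sup>2))" by (intro mult_left_mono m(1))
    also have "\<dots> = m * \<tau>\<^sup>2 + m * (1 + s\<^sup>2)" by (simp add: algebra_simps)
    also have "\<dots> \<le> v\<^sup>2 / 16 * \<tau>\<^sup>2 + 1 / 2 * (1 + s\<^sup>2)"
      using m by (intro add_mono mult_right_mono) auto
    finally have u1: "m * (2 * \<bar>\<tau>\<bar> * max 1 s) \<le> v\<^sup>2 / 16 * \<tau>\<^sup>2 + 1 / 2 * (1 + s\<^sup>2)" .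
    have "\<bar>2 * \<tau> * q \<beta> wb\<bar> \<le> 2 * \<bar>\<tau>\<bar> * (m * max 1 s)"
      using c2 by (simp add: abs_mult mult_left_mono)
    then have u2: "- (2 * \<tau> * q \<beta> wb) \<le> v\<^sup>2 / 16 * \<tau>\<^sup>2 + 1 / 2 * (1 + s\<^sup>2)" using u1 by (simp add: mult_ac)
    have u3: "v\<^sup>2 / 8 * \<tau>\<^sup>2 \<le> q wb wb * \<tau>\<^sup>2" using wbwb by (intro mult_right_mono) auto
    have u4: "v\<^sup>2 / 16 * \<tau>\<^sup>2 \<le> v\<^sup>2 / 8 * \<tau>\<^sup>2" by (intro mult_right_mono) auto
    have "s\<^sup>2 + 2 * \<tau> * q \<beta> wb + q wb wb * \<tau>\<^sup>2 \<le> 16"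
      using q16 unfolding q_add_self qform_scale_left qform_scale_right s(2)
      by (simp add: power2_eq_square mult_ac)
    then have "s\<^sup>2 \<le> 33" using u2 u3 u4 by argo
    then have "s\<^sup>2 \<le> 6\<^sup>2" by simp
    then show ?thesis using s(1) power2_le_imp_le[of s 6] by auto
  qed
  then have "m * max 1 s \<le> m * 6" by (intro mult_left_mono m(1))
  then have c3: "\<bar>q \<beta> wb\<bar> \<le> 6 * m" using c2 by linarith
  have kkt: "\<bar>q r (unit_coeff j)\<bar> \<le> l / 2" if "j \<in> N" for j
    using restricted_lasso_KKT(1)[OF _ min that Np] pos(1) by (simp add: r_def)
  have rwb: "\<bar>q r wb\<bar> \<le> (1 + Th) / 2 * l"
  proof -
    have "\<bar>\<Sum>j\<in>N - {b}. t b j * q r (unit_coeff j)\<bar> \<le> (\<Sum>j\<in>N - {b}. \<bar>t b j\<bar> * (l / 2))"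
    proof (rule sum_abs[THEN order_trans], rule sum_mono)
      fix j assume "j \<in> N - {b}"
      then show "\<bar>t b j * q r (unit_coeff j)\<bar> \<le> \<bar>t b j\<bar> * (l / 2)"
        unfolding abs_mult using kkt by (intro mult_left_mono) auto
    qed
    also have "\<dots> \<le> Th * (l / 2)"
      unfolding sum_distrib_right[symmetric] using t_norm[OF b] pos by (intro mult_right_mono) auto
    finally have "\<bar>\<Sum>j\<in>N - {b}. t b j * q r (unit_coeff j)\<bar> \<le> Th * (l / 2)" .
    moreover have "q r wb = q r (unit_coeff b) - (\<Sum>j\<in>N - {b}. t b j * q r (unit_coeff j))"
      unfolding wb_def using Np by (intro q_residual_right[OF bp(1) tbs]) auto
    moreover have "\<bar>q r (unit_coeff b)\<bar> \<le> l / 2" using kkt[OF b] .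
    ultimately show ?thesis by (simp add: field_simps)
  qed
  have "q r wb = q wa wb + (q \<beta> wb + \<tau> * q wb wb)" unfolding dec by (simp add: qform_linear)
  then have "\<bar>\<tau> * q wb wb\<bar> \<le> (1 + Th) / 2 * l + 8 * m"
    using rwb c1 c3 q_sym[of wa wb] by linarith
  moreover have "\<bar>\<tau>\<bar> * (v\<^sup>2 / 8) \<le> \<bar>\<tau> * q wb wb\<bar>"
    unfolding abs_mult using wbwb nonneg[of wb] by (intro mult_left_mono) auto
  ultimately have "\<bar>\<tau>\<bar> * (v\<^sup>2 / 8) \<le> ((1 + Th) / 2 + 8 * \<rho>) * l"
    unfolding m_def distrib_right[of _ _ l] by linarith
  then have "\<bar>\<tau>\<bar> \<le> 8 / v\<^sup>2 * ((1 + Th) / 2 + 8 * \<rho>) * l" using pos by (simp add: field_simps)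
  then show ?thesis using gap[OF b] by (simp add: \<tau>_def)
qed

text \<open>Splitting node \<open>k\<close> into its regression on \<open>N\<close> and the residual turns the gradient in direction \<open>k\<close>
  into \<open>l\<close> times the sum that \<open>incoherent\<close> bounds, because the gradients on \<open>N\<close> are \<open>l\<close> times the signs
  of the true coefficients, plus a term that \<open>near_orth\<close> makes smaller than the slack \<open>1 - s1\<close>.\<close>

lemma restricted_lasso_dual:
  assumes min: "is_arg_min (lasso_obj a l) (supported N) \<theta>"
    and k: "k < p" "k \<noteq> a" "k \<notin> N"
  shows "\<bar>2 * q (residual a \<theta>) (unit_coeff k)\<bar> < l"
proof -
  define r where "r = residual a \<theta>"
  have \<theta>s: "supported N \<theta>" using min by (auto simp: is_arg_min_linorder)
  have rr: "q r r \<le> 4" and \<theta>b: "j < p \<Longrightarrow> \<bar>\<theta> j\<bar> \<le> 4 / l" for j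
    using restricted_lasso_bounds[OF min] by (auto simp: r_def)
  have rs: "supported (orth_nodes a N k) r"
    using \<theta>s k by (auto simp: r_def orth_nodes_def residual_def supported_def unit_coeff_def)
  have "\<bar>r j\<bar> \<le> R" for j
  proof -
    have "\<bar>\<theta> j\<bar> \<le> 4 / l" using \<theta>b[of j] \<theta>s Np pos by (cases "j \<in> N") (auto simp: supported_def)
    then show ?thesis using R_ge by (auto simp: r_def residual_def unit_coeff_def)
  qed
  then have "\<bar>q r (residual k (t k))\<bar> \<le> \<rho> * l * max 1 (sqrt (q r r))"
    by (intro near_orth_scaled[OF k(1) rs]) auto
  moreover have "\<rho> * l * max 1 (sqrt (q r r)) \<le> \<rho> * l * 2"
    using rr pos by (intro mult_left_mono) (auto simp: real_le_lsqrt)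
  ultimately have e1: "\<bar>q r (residual k (t k))\<bar> \<le> 2 * \<rho> * l" by simp
  have "2 * q r (unit_coeff j) = l * sgn (t a j)" if j: "j \<in> N" for j
  proof -
    have sg: "sgn (\<theta> j) = sgn (t a j)" by (rule sgn_eq_of_close[OF restricted_lasso_close[OF min j]])
    have "\<theta> j \<noteq> 0" using restricted_lasso_close[OF min j] by auto
    then show ?thesis using restricted_lasso_KKT(2)[OF _ min j Np] pos(1) sg by (simp add: r_def)
  qed
  then have "(\<Sum>j\<in>N. t k j * (2 * q r (unit_coeff j))) = (\<Sum>j\<in>N. t k j * (l * sgn (t a j)))"
    by (intro sum.cong) auto
  then have e2: "2 * (\<Sum>j\<in>N. t k j * q r (unit_coeff j)) = l * (\<Sum>j\<in>N. sgn (t a j) * t k j)"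
    by (simp add: sum_distrib_left mult_ac)
  have "q r (residual k (t k)) = q r (unit_coeff k) - (\<Sum>j\<in>N. t k j * q r (unit_coeff j))"
    using t_supp[OF k(1)] k by (intro q_residual_right[OF k(1) _ Np]) simp
  then have "2 * q r (unit_coeff k) = 2 * q r (residual k (t k)) + l * (\<Sum>j\<in>N. sgn (t a j) * t k j)"
    using e2 by linarith
  moreover have "\<bar>l * (\<Sum>j\<in>N. sgn (t a j) * t k j)\<bar> < l * s1"
    unfolding abs_mult using incoherent[OF k] pos by simp
  moreover have "l * (4 * \<rho>) \<le> l * (1 - s1)" using s1 pos by (intro mult_left_mono) auto
  ultimately show ?thesis using e1 unfolding r_def by (simp add: algebra_simps)
qed

theorem lasso_detects_neighbours:
  assumes full: "is_arg_min (lasso_obj a l) (supported ({..<p} - {a})) \<theta>" and b: "b \<in> N"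
  shows "\<theta> b \<noteq> 0"
proof -
  obtain \<theta>0 where m0: "is_arg_min (lasso_obj a l) (supported N) \<theta>0"
    using restricted_lasso_exists[OF finN Np pos(1)] by blast
  have "is_arg_min (lasso_obj a l) (supported N) \<theta>"
    by (rule lasso_supported_if_strictly_dual_feasible[OF pos(1) m0 N _ _ full])
       (use restricted_lasso_dual[OF m0] in auto)
  then show ?thesis using restricted_lasso_close[OF _ b] by force
qed

end

section \<open>Nonsingular normal vectors\<close>

lemma nn_integral_PiM_lborel_translate:
  fixes c :: "nat \<Rightarrow> real"
  assumes I: "finite I" and f[measurable]: "f \<in> borel_measurable (\<Pi>\<^sub>M i\<in>I. lborel)"
  shows "(\<integral>\<^sup>+x. f x \<partial>(\<Pi>\<^sub>M i\<in>I. lborel)) = (\<integral>\<^sup>+x. f (\<lambda>i\<in>I. c i + x i) \<partial>(\<Pi>\<^sub>M i\<in>I. lborel))"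
proof -
  interpret product_sigma_finite "\<lambda>_::nat. lborel :: real measure" ..
  let ?P = "\<Pi>\<^sub>M i\<in>I. (lborel :: real measure)"
  let ?h = "\<lambda>x. \<lambda>i\<in>I. c i + x i"
  have h[measurable]: "?h \<in> measurable ?P ?P" by measurable
  have "distr ?P ?P ?h = ?P"
  proof (rule PiM_eqI[OF I])
    fix A assume A: "\<And>i. i \<in> I \<Longrightarrow> A i \<in> sets (lborel :: real measure)"
    have shift: "(+) (c i) -` A i \<in> sets lborel" if "i \<in> I" for i
      using measurable_sets[of "(+) (c i)" borel borel "A i"] A[OF that] by simp
    have "?h -` PiE I A \<inter> space ?P = PiE I (\<lambda>i. (+) (c i) -` A i)"
      by (auto simp: space_PiM PiE_iff)
    then have "emeasure (distr ?P ?P ?h) (PiE I A) = emeasure ?P (PiE I (\<lambda>i. (+) (c i) -` A i))"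
      using A I by (subst emeasure_distr) (auto intro!: sets_PiM_I_finite)
    also have "\<dots> = (\<Prod>i\<in>I. emeasure lborel ((+) (c i) -` A i))"
      using I shift by (subst emeasure_PiM) auto
    also have "\<dots> = (\<Prod>i\<in>I. emeasure lborel (A i))"
    proof (rule prod.cong[OF refl])
      fix i assume i: "i \<in> I"
      have "emeasure (distr lborel borel ((+) (c i))) (A i) = emeasure lborel ((+) (c i) -` A i)"
        using A[OF i] by (subst emeasure_distr) auto
      then show "emeasure lborel ((+) (c i) -` A i) = emeasure lborel (A i)"
        by (simp add: lborel_distr_plus)
    qed
    finally show "emeasure (distr ?P ?P ?h) (PiE I A) = (\<Prod>i\<in>I. emeasure lborel (A i))" .
  qed simp
  then have "(\<integral>\<^sup>+x. f x \<partial>?P) = (\<integral>\<^sup>+x. f x \<partial>distr ?P ?P ?h)" by simp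
  also have "\<dots> = (\<integral>\<^sup>+x. f (?h x) \<partial>?P)" by (rule nn_integral_distr) auto
  finally show ?thesis .
qed

lemma nonsingular_covarianceD:
  assumes "nonsingular_covariance p S"
  shows nonsingular_covariance_sym: "i < p \<Longrightarrow> j < p \<Longrightarrow> S $$ (i, j) = S $$ (j, i)"
    and nonsingular_covariance_psd: "0 \<le> qform p (\<lambda>i j. S $$ (i, j)) u u"
    and precision_sym: "i < p \<Longrightarrow> j < p \<Longrightarrow> precision_mat S $$ (i, j) = precision_mat S $$ (j, i)"
    and covariance_precision:
      "i < p \<Longrightarrow> k < p \<Longrightarrow> (\<Sum>j<p. S $$ (i, j) * precision_mat S $$ (j, k)) = (if i = k then 1 else 0)"
    and precision_covariance:
      "i < p \<Longrightarrow> k < p \<Longrightarrow> (\<Sum>j<p. precision_mat S $$ (i, j) * S $$ (j, k)) = (if i = k then 1 else 0)"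
proof -
  have S: "S \<in> carrier_mat p p" "transpose_mat S = S" "invertible_mat S"
    and psd: "\<And>x. x \<in> carrier_vec p \<Longrightarrow> 0 \<le> scalar_prod x (S *\<^sub>v x)"
    using assms by (auto simp: nonsingular_covariance_def)
  obtain B where B: "inverts_mat S B" "inverts_mat B S" using S(3) by (auto simp: invertible_mat_def)
  have SB: "S * B = 1\<^sub>m p" and BS: "B * S = 1\<^sub>m (dim_row B)"
    using B S(1) by (simp_all add: inverts_mat_def carrier_matD)
  have dimB: "B \<in> carrier_mat p p"
    using arg_cong[OF SB, of dim_col] arg_cong[OF BS, of dim_col] S(1) by (intro carrier_matI) auto
  have "S \<in> Units (ring_mat TYPE(real) p ())"
    using S(1) dimB B by (auto simp: Units_def ring_mat_def inverts_mat_def intro!: bexI[of _ B])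
  then obtain P where P: "mat_inverse S = Some P"
    using mat_inverse(1)[OF S(1), of "()"] by (cases "mat_inverse S") auto
  note PP = mat_inverse(2)[OF S(1) P]
  have pm: "precision_mat S = P" by (simp add: precision_mat_def P)
  have Pc: "P \<in> carrier_mat p p" and SP: "S * P = 1\<^sub>m p" and PS: "P * S = 1\<^sub>m p" using PP by auto
  have PT: "transpose_mat P = P"
  proof -
    have PTc: "transpose_mat P \<in> carrier_mat p p" using Pc by simp
    have "transpose_mat P * S = 1\<^sub>m p"
      using arg_cong[OF SP, of transpose_mat] S(1,2) Pc by (simp add: transpose_mult)
    then have "transpose_mat P * S * P = P" using Pc by simp
    then show ?thesis using assoc_mult_mat[OF PTc S(1) Pc] SP PTc by simp
  qed
  show "i < p \<Longrightarrow> j < p \<Longrightarrow> S $$ (i, j) = S $$ (j, i)"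
    using S(1,2) by (metis carrier_matD index_transpose_mat(1))
  show "i < p \<Longrightarrow> j < p \<Longrightarrow> precision_mat S $$ (i, j) = precision_mat S $$ (j, i)"
    using Pc PT pm by (metis carrier_matD index_transpose_mat(1))
  have entry: "(A * C) $$ (i, k) = (\<Sum>j<p. A $$ (i, j) * C $$ (j, k))"
    if "A \<in> carrier_mat p p" "C \<in> carrier_mat p p" "i < p" "k < p" for A C :: "real mat" and i k
    using that by (auto simp: scalar_prod_def atLeast0LessThan)
  show "i < p \<Longrightarrow> k < p \<Longrightarrow> (\<Sum>j<p. S $$ (i, j) * precision_mat S $$ (j, k)) = (if i = k then 1 else 0)"
    using entry[OF S(1) Pc, of i k] SP pm by simp
  show "i < p \<Longrightarrow> k < p \<Longrightarrow> (\<Sum>j<p. precision_mat S $$ (i, j) * S $$ (j, k)) = (if i = k then 1 else 0)"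
    using entry[OF Pc S(1), of i k] PS pm by simp
  have "scalar_prod (vec p u) (S *\<^sub>v vec p u) = qform p (\<lambda>i j. S $$ (i, j)) u u"
    using S(1) by (auto simp: scalar_prod_def qform_def atLeast0LessThan sum_distrib_left mult_ac)
  then show "0 \<le> qform p (\<lambda>i j. S $$ (i, j)) u u" using psd[of "vec p u"] by simp
qed

definition lincomb :: "nat \<Rightarrow> (nat \<Rightarrow> 'w \<Rightarrow> real) \<Rightarrow> (nat \<Rightarrow> real) \<Rightarrow> 'w \<Rightarrow> real" where
  "lincomb p X u \<omega> = (\<Sum>k<p. u k * X k \<omega>)"

locale normal_vector = prob_space M for M :: "'w measure" +
  fixes p :: nat and S :: "real mat" and X :: "nat \<Rightarrow> 'w \<Rightarrow> real"
  assumes normal: "multivariate_normal M p S X"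
begin

abbreviation cov :: "nat \<Rightarrow> nat \<Rightarrow> real" where "cov i j \<equiv> S $$ (i, j)"
abbreviation prec :: "nat \<Rightarrow> nat \<Rightarrow> real" where "prec i j \<equiv> precision_mat S $$ (i, j)"
abbreviation gen :: "nat set \<Rightarrow> 'w measure" where "gen I \<equiv> generated_algebra M I X"
abbreviation cov_vec :: "(nat \<Rightarrow> real) \<Rightarrow> nat \<Rightarrow> real" where "cov_vec u i \<equiv> \<Sum>j<p. cov i j * u j"

lemma nonsingular: "nonsingular_covariance p S"
  and distributed_X: "distributed M (\<Pi>\<^sub>M k\<in>{..<p}. lborel) (random_vec {..<p} X)
       (\<lambda>x. ennreal (normal_vec_density p S x))"
  using normal by (auto simp: multivariate_normal_def)

sublocale psd_form p cov
  by standard (use nonsingular_covarianceD[OF nonsingular] in auto)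

lemmas prec_sym = precision_sym[OF nonsingular]
  and cov_prec = covariance_precision[OF nonsingular]
  and prec_cov = precision_covariance[OF nonsingular]

lemma random_vec_measurable[measurable]: "random_vec {..<p} X \<in> measurable M (\<Pi>\<^sub>M k\<in>{..<p}. lborel)"
  using distributed_measurable[OF distributed_X] .

lemma X_measurable[measurable]: "k < p \<Longrightarrow> X k \<in> borel_measurable M"
proof -
  assume k: "k < p"
  have "(\<lambda>\<omega>. random_vec {..<p} X \<omega> k) \<in> measurable M lborel"
    using k by (intro measurable_compose[OF random_vec_measurable] measurable_component_singleton) auto
  then show ?thesis using k by (simp add: random_vec_def)
qed

lemma random_vec_sub_measurable[measurable]:
  "I \<subseteq> {..<p} \<Longrightarrow> random_vec I X \<in> measurable M (\<Pi>\<^sub>M k\<in>I. borel)"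
  unfolding random_vec_def by (intro measurable_restrict) auto

lemma lincomb_measurable[measurable]: "lincomb p X u \<in> borel_measurable M"
  unfolding lincomb_def by measurable

lemma q_cov_vec: "q u v = (\<Sum>i<p. u i * cov_vec v i)"
  by (simp add: qform_def sum_distrib_left mult.assoc)

lemma cov_vec_prec:
  assumes "k < p" "i < p"
  shows "cov_vec (\<lambda>j. prec j k) i = (if i = k then 1 else 0)"
  using cov_prec[OF assms(2,1)] by simp

lemma prec_cov_vec:
  assumes "i < p"
  shows "(\<Sum>j<p. prec i j * cov_vec u j) = u i"
proof -
  have "(\<Sum>j<p. prec i j * cov_vec u j) = (\<Sum>j<p. \<Sum>k<p. prec i j * cov j k * u k)"
    by (simp add: sum_distrib_left mult.assoc)
  also have "\<dots> = (\<Sum>k<p. (\<Sum>j<p. prec i j * cov j k) * u k)"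
    by (subst sum.swap) (simp add: sum_distrib_right)
  also have "\<dots> = (\<Sum>k<p. (if i = k then 1 else 0) * u k)"
    using assms by (intro sum.cong) (simp_all add: prec_cov)
  also have "\<dots> = u i" using assms by (simp add: if_distrib[where f = "\<lambda>x. x * _"] cong: if_cong)
  finally show ?thesis .
qed

text \<open>Completing the square in the density: tilting by \<open>exp (u \<bullet> X)\<close> translates the law by the
  covariance vector of \<open>u\<close>. All independence statements come from the case in which that vector
  vanishes in the coordinates that \<open>g\<close> looks at.\<close>

lemma exponential_tilt:
  assumes g[measurable]: "g \<in> borel_measurable (\<Pi>\<^sub>M k\<in>{..<p}. (lborel :: real measure))"
  shows "(\<integral>\<^sup>+\<omega>. ennreal (exp (lincomb p X u \<omega>)) * g (random_vec {..<p} X \<omega>) \<partial>M)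
    = ennreal (exp (q u u / 2)) * (\<integral>\<^sup>+\<omega>. g (\<lambda>i\<in>{..<p}. cov_vec u i + X i \<omega>) \<partial>M)"
proof -
  let ?P = "\<Pi>\<^sub>M k\<in>{..<p}. (lborel :: real measure)"
  define lin where "lin = (\<lambda>x::nat\<Rightarrow>real. \<Sum>k<p. u k * x k)"
  define sh where "sh = (\<lambda>x. \<lambda>i\<in>{..<p}. cov_vec u i + x i)"
  define f where "f = normal_vec_density p S"
  have lin[measurable]: "lin \<in> borel_measurable ?P" unfolding lin_def by measurable
  have sh[measurable]: "sh \<in> measurable ?P ?P" unfolding sh_def by measurable
  have f[measurable]: "(\<lambda>x. ennreal (f x)) \<in> borel_measurable ?P"
    using distributed_borel_measurable[OF distributed_X] by (simp add: f_def)
  have fsh: "ennreal (f (sh x)) * ennreal (exp (lin (sh x))) = ennreal (exp (q u u / 2)) * ennreal (f x)" for x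
  proof -
    define Q where "Q = (\<lambda>x y. \<Sum>i<p. \<Sum>j<p. x i * prec i j * y j)"
    have fQ: "f y = exp (- Q y y / 2) / sqrt ((2 * pi) ^ p * Determinant.det S)" for y
      by (simp add: f_def normal_vec_density_def Q_def)
    have Qq: "Q = qform p prec" by (simp add: fun_eq_iff Q_def qform_def)
    have Qc: "Q y (cov_vec u) = (\<Sum>i<p. y i * u i)" for y
    proof -
      have "Q y (cov_vec u) = (\<Sum>i<p. y i * (\<Sum>j<p. prec i j * cov_vec u j))"
        unfolding Q_def by (intro sum.cong) (simp_all add: sum_distrib_left mult.assoc)
      then show ?thesis by (simp add: prec_cov_vec)
    qed
    have Qs: "Q (cov_vec u) y = Q y (cov_vec u)" for y
      unfolding Q_def by (subst sum.swap) (intro sum.cong, auto simp: prec_sym mult_ac)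
    have "Q (sh x) (sh x) = Q (\<lambda>i. cov_vec u i + x i) (\<lambda>i. cov_vec u i + x i)"
      unfolding Q_def sh_def by (intro sum.cong) auto
    also have "\<dots> = Q (cov_vec u) (cov_vec u) + Q x (cov_vec u) + (Q (cov_vec u) x + Q x x)"
      unfolding Qq qform_add_right qform_add_left by (rule refl)
    also have "\<dots> = q u u + 2 * lin x + Q x x"
    proof -
      have "Q (cov_vec u) (cov_vec u) = q u u"
        unfolding Qc q_cov_vec by (intro sum.cong) (simp_all add: mult.commute)
      moreover have "Q x (cov_vec u) = lin x"
        unfolding Qc lin_def by (intro sum.cong) (simp_all add: mult.commute)
      ultimately show ?thesis using Qs[of x] by linarith
    qed
    finally have Q: "Q (sh x) (sh x) = q u u + 2 * lin x + Q x x" .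
    have "lin (sh x) = (\<Sum>i<p. u i * cov_vec u i + u i * x i)"
      unfolding lin_def sh_def by (intro sum.cong) (simp_all add: distrib_left)
    then have L: "lin (sh x) = q u u + lin x"
      unfolding lin_def q_cov_vec by (simp only: sum.distrib)
    have "exp (- Q (sh x) (sh x) / 2) * exp (lin (sh x)) = exp (q u u / 2) * exp (- Q x x / 2)"
      unfolding exp_add[symmetric] Q L by (simp add: field_simps)
    then have "f (sh x) * exp (lin (sh x)) = exp (q u u / 2) * f x"
      unfolding fQ times_divide_eq_left times_divide_eq_right by simp
    moreover have "ennreal (f (sh x)) * ennreal (exp (lin (sh x))) = ennreal (f (sh x) * exp (lin (sh x)))"
      by (subst ennreal_mult'') auto
    moreover have "ennreal (exp (q u u / 2)) * ennreal (f x) = ennreal (exp (q u u / 2) * f x)"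
      by (subst ennreal_mult') auto
    ultimately show ?thesis by simp
  qed
  have shX: "sh (random_vec {..<p} X \<omega>) = (\<lambda>i\<in>{..<p}. cov_vec u i + X i \<omega>)" for \<omega>
    by (auto simp: sh_def random_vec_def restrict_def fun_eq_iff)
  have "(\<integral>\<^sup>+\<omega>. ennreal (exp (lincomb p X u \<omega>)) * g (random_vec {..<p} X \<omega>) \<partial>M)
      = (\<integral>\<^sup>+\<omega>. ennreal (exp (lin (random_vec {..<p} X \<omega>))) * g (random_vec {..<p} X \<omega>) \<partial>M)"
    by (simp add: lin_def lincomb_def random_vec_def)
  also have "\<dots> = (\<integral>\<^sup>+x. ennreal (f x) * (ennreal (exp (lin x)) * g x) \<partial>?P)"
    unfolding f_def by (rule distributed_nn_integral[OF distributed_X, symmetric]) measurable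
  also have "\<dots> = (\<integral>\<^sup>+x. ennreal (f (sh x)) * (ennreal (exp (lin (sh x))) * g (sh x)) \<partial>?P)"
    unfolding sh_def by (rule nn_integral_PiM_lborel_translate) auto
  also have "\<dots> = (\<integral>\<^sup>+x. ennreal (exp (q u u / 2)) * (ennreal (f x) * g (sh x)) \<partial>?P)"
    by (simp add: mult.assoc[symmetric] fsh)
  also have "\<dots> = ennreal (exp (q u u / 2)) * (\<integral>\<^sup>+x. ennreal (f x) * g (sh x) \<partial>?P)"
    by (rule nn_integral_cmult) auto
  also have "(\<integral>\<^sup>+x. ennreal (f x) * g (sh x) \<partial>?P) = (\<integral>\<^sup>+\<omega>. g (sh (random_vec {..<p} X \<omega>)) \<partial>M)"
    unfolding f_def by (rule distributed_nn_integral[OF distributed_X]) measurable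
  also have "\<dots> = (\<integral>\<^sup>+\<omega>. g (\<lambda>i\<in>{..<p}. cov_vec u i + X i \<omega>) \<partial>M)"
    unfolding shX by (rule refl)
  finally show ?thesis .
qed

lemma exponential_moment: "(\<integral>\<^sup>+\<omega>. ennreal (exp (lincomb p X u \<omega>)) \<partial>M) = ennreal (exp (q u u / 2))"
  using exponential_tilt[of "\<lambda>_. 1" u] by (simp add: emeasure_space_1)

end

lemma exp_diff_le: "\<bar>exp b - exp (- b)\<bar> \<le> 2 * \<bar>b\<bar> * exp \<bar>b\<bar>" for b :: real
proof -
  have *: "exp b - exp (- b) \<le> 2 * b * exp b" if "0 \<le> b" for b :: real
  proof -
    have "exp b * (1 - exp (- (2 * b))) \<le> exp b * (2 * b)"
      using exp_ge_add_one_self[of "- (2 * b)"] by (intro mult_left_mono) auto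
    then show ?thesis by (simp add: right_diff_distrib exp_add[symmetric] mult_ac)
  qed
  show ?thesis
  proof (cases "0 \<le> b")
    case True then show ?thesis using *[of b] by simp
  next
    case False then show ?thesis using *[of "- b"] by simp
  qed
qed

lemma exp_second_diff_le: "\<bar>exp b + exp (- b) - 2\<bar> \<le> b\<^sup>2 * exp \<bar>b\<bar>" for b :: real
proof -
  have e: "exp b + exp (- b) - 2 = (exp (b / 2) - exp (- (b / 2)))\<^sup>2"
    by (simp add: power2_diff exp_double[symmetric] exp_minus field_simps)
       (simp add: exp_add[symmetric] power2_eq_square)
  have "\<bar>exp (b / 2) - exp (- (b / 2))\<bar>\<^sup>2 \<le> (2 * \<bar>b / 2\<bar> * exp \<bar>b / 2\<bar>)\<^sup>2"
    by (intro power_mono exp_diff_le) auto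
  also have "\<dots> = b\<^sup>2 * exp \<bar>b\<bar>" by (simp add: power_mult_distrib exp_double[symmetric])
  finally show ?thesis unfolding e by simp
qed

text \<open>First and second derivative in \<open>s = 0\<close> of the identity \<open>mgf\<close>, by dominated convergence
  for symmetric difference quotients.\<close>

lemma (in prob_space) moments_of_weighted_mgf:
  fixes Y G :: "'a \<Rightarrow> real"
  assumes [measurable]: "Y \<in> borel_measurable M" "G \<in> borel_measurable M"
    and G: "\<And>\<omega>. 0 \<le> G \<omega>" and c: "0 \<le> c"
    and mgf: "\<And>s. (\<integral>\<^sup>+\<omega>. ennreal (exp (s * Y \<omega>) * G \<omega>) \<partial>M) = ennreal (c * exp (s\<^sup>2 * \<tau> / 2))"
  shows "integrable M (\<lambda>\<omega>. Y \<omega> * G \<omega>)" "(\<integral>\<omega>. Y \<omega> * G \<omega> \<partial>M) = 0"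
    and "integrable M (\<lambda>\<omega>. (Y \<omega>)\<^sup>2 * G \<omega>)" "(\<integral>\<omega>. (Y \<omega>)\<^sup>2 * G \<omega> \<partial>M) = c * \<tau>"
proof -
  have int: "integrable M (\<lambda>\<omega>. exp (s * Y \<omega>) * G \<omega>)" for s
    by (rule integrableI_nonneg) (use mgf[of s] G in auto)
  have val: "(\<integral>\<omega>. exp (s * Y \<omega>) * G \<omega> \<partial>M) = c * exp (s\<^sup>2 * \<tau> / 2)" for s
    by (rule integral_eq_nn_integral[THEN trans]) (use mgf[of s] G c in auto)
  define h :: "nat \<Rightarrow> real" where "h n = 1 / (real n + 1)" for n
  have h: "0 < h n" "h n \<le> 1" for n by (auto simp: h_def)
  have exp2: "exp (2 * \<bar>y\<bar>) \<le> exp (2 * y) + exp (- 2 * y)" for y :: real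
    by (cases "y \<ge> 0") auto
  define W where "W = (\<lambda>\<omega>. 2 * (exp (2 * Y \<omega>) * G \<omega> + exp (- 2 * Y \<omega>) * G \<omega>))"
  have W: "integrable M W" unfolding W_def using int[of 2] int[of "-2"] by simp
  have domW: "\<bar>f * G \<omega>\<bar> \<le> W \<omega>" if "\<bar>f\<bar> \<le> 2 * exp (2 * \<bar>Y \<omega>\<bar>)" for f \<omega>
  proof -
    have "\<bar>f * G \<omega>\<bar> = \<bar>f\<bar> * G \<omega>" using G by (simp add: abs_mult)
    also have "\<dots> \<le> (2 * (exp (2 * Y \<omega>) + exp (- 2 * Y \<omega>))) * G \<omega>"
      using that exp2[of "Y \<omega>"] G by (intro mult_right_mono) auto
    finally show ?thesis by (simp add: W_def algebra_simps)
  qed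
  have hY: "exp \<bar>h n * y\<bar> \<le> exp \<bar>y\<bar>" for n y
    using h[of n] by (auto simp: abs_mult intro: mult_left_le_one_le)
  have yexp: "\<bar>y\<bar> \<le> exp \<bar>y\<bar>" "y\<^sup>2 \<le> 2 * exp \<bar>y\<bar>" for y :: real
  proof -
    have "1 + \<bar>y\<bar> + \<bar>y\<bar>\<^sup>2 / 2 \<le> exp \<bar>y\<bar>" by (rule exp_lower_Taylor_quadratic) simp
    moreover have "0 \<le> \<bar>y\<bar>\<^sup>2" by simp
    moreover have "\<bar>y\<bar>\<^sup>2 = y\<^sup>2" by simp
    ultimately show "\<bar>y\<bar> \<le> exp \<bar>y\<bar>" "y\<^sup>2 \<le> 2 * exp \<bar>y\<bar>" using abs_ge_zero[of y] by linarith+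
  qed
  define f1 where "f1 n y = (exp (h n * y) - exp (- h n * y)) / (2 * h n)" for n y
  define f2 where "f2 n y = (exp (h n * y) + exp (- h n * y) - 2) / (h n)\<^sup>2" for n y
  have f1_le: "\<bar>f1 n y\<bar> \<le> 2 * exp (2 * \<bar>y\<bar>)" for n y
  proof -
    have "\<bar>f1 n y\<bar> \<le> (2 * \<bar>h n * y\<bar> * exp \<bar>h n * y\<bar>) / (2 * h n)"
    proof -
      have "\<bar>f1 n y\<bar> = \<bar>exp (h n * y) - exp (- (h n * y))\<bar> / (2 * h n)"
        unfolding f1_def abs_divide using h[of n] by (simp only: abs_of_pos mult_minus_left mult_pos_pos zero_less_numeral)
      also have "\<dots> \<le> (2 * \<bar>h n * y\<bar> * exp \<bar>h n * y\<bar>) / (2 * h n)"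
        using h[of n] by (intro divide_right_mono exp_diff_le) auto
      finally show ?thesis .
    qed
    also have "\<dots> = \<bar>y\<bar> * exp \<bar>h n * y\<bar>" using h[of n] by (simp add: abs_mult)
    also have "\<dots> \<le> exp \<bar>y\<bar> * exp \<bar>y\<bar>" using yexp hY by (intro mult_mono) auto
    also have "\<dots> = exp (2 * \<bar>y\<bar>)" by (simp add: exp_add[symmetric])
    also have "\<dots> \<le> 2 * exp (2 * \<bar>y\<bar>)" by simp
    finally show ?thesis .
  qed
  have f2_le: "\<bar>f2 n y\<bar> \<le> 2 * exp (2 * \<bar>y\<bar>)" for n y
  proof -
    have "\<bar>f2 n y\<bar> \<le> ((h n * y)\<^sup>2 * exp \<bar>h n * y\<bar>) / (h n)\<^sup>2"
    proof -
      have "\<bar>f2 n y\<bar> = \<bar>exp (h n * y) + exp (- (h n * y)) - 2\<bar> / (h n)\<^sup>2"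
        unfolding f2_def abs_divide by (simp only: abs_power2 mult_minus_left)
      also have "\<dots> \<le> ((h n * y)\<^sup>2 * exp \<bar>h n * y\<bar>) / (h n)\<^sup>2"
        by (intro divide_right_mono exp_second_diff_le) auto
      finally show ?thesis .
    qed
    also have "\<dots> = y\<^sup>2 * exp \<bar>h n * y\<bar>" using h[of n] by (simp add: power_mult_distrib)
    also have "\<dots> \<le> (2 * exp \<bar>y\<bar>) * exp \<bar>y\<bar>" using yexp hY by (intro mult_mono) auto
    also have "\<dots> = 2 * exp (2 * \<bar>y\<bar>)" by (simp add: exp_add[symmetric])
    finally show ?thesis .
  qed
  have l1: "(\<lambda>n. f1 n y) \<longlonglongrightarrow> y" for y unfolding f1_def h_def by real_asymp
  have l2: "(\<lambda>n. f2 n y) \<longlonglongrightarrow> y\<^sup>2" for y unfolding f2_def h_def power2_eq_square by real_asymp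
  have h0: "h n \<noteq> 0" for n using h(1)[of n] by simp
  have f1m: "f1 n \<in> borel_measurable borel" and f2m: "f2 n \<in> borel_measurable borel" for n
    unfolding f1_def[abs_def] f2_def[abs_def]
    by (intro borel_measurable_continuous_onI continuous_intros; simp add: h0)+
  have [measurable]: "(\<lambda>\<omega>. f1 n (Y \<omega>)) \<in> borel_measurable M" "(\<lambda>\<omega>. f2 n (Y \<omega>)) \<in> borel_measurable M" for n
    by (rule measurable_compose[OF assms(1) f1m], rule measurable_compose[OF assms(1) f2m])
  have a1: "AE \<omega> in M. (\<lambda>n. f1 n (Y \<omega>) * G \<omega>) \<longlonglongrightarrow> Y \<omega> * G \<omega>"
    and b1: "AE \<omega> in M. norm (f1 n (Y \<omega>) * G \<omega>) \<le> W \<omega>" for n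
    using domW[OF f1_le] by (auto intro!: AE_I2 tendsto_mult_right l1)
  have a2: "AE \<omega> in M. (\<lambda>n. f2 n (Y \<omega>) * G \<omega>) \<longlonglongrightarrow> (Y \<omega>)\<^sup>2 * G \<omega>"
    and b2: "AE \<omega> in M. norm (f2 n (Y \<omega>) * G \<omega>) \<le> W \<omega>" for n
    using domW[OF f2_le] by (auto intro!: AE_I2 tendsto_mult_right l2)
  have d1: "integrable M (\<lambda>\<omega>. Y \<omega> * G \<omega>)"
    "(\<lambda>n. \<integral>\<omega>. f1 n (Y \<omega>) * G \<omega> \<partial>M) \<longlonglongrightarrow> (\<integral>\<omega>. Y \<omega> * G \<omega> \<partial>M)"
    by (rule integrable_dominated_convergence[OF _ _ W a1 b1], measurable)
       (rule integral_dominated_convergence[OF _ _ W a1 b1], measurable)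
  have d2: "integrable M (\<lambda>\<omega>. (Y \<omega>)\<^sup>2 * G \<omega>)"
    "(\<lambda>n. \<integral>\<omega>. f2 n (Y \<omega>) * G \<omega> \<partial>M) \<longlonglongrightarrow> (\<integral>\<omega>. (Y \<omega>)\<^sup>2 * G \<omega> \<partial>M)"
    by (rule integrable_dominated_convergence[OF _ _ W a2 b2], measurable)
       (rule integral_dominated_convergence[OF _ _ W a2 b2], measurable)
  have v1: "(\<integral>\<omega>. f1 n (Y \<omega>) * G \<omega> \<partial>M) = 0" for n
  proof -
    have "(\<lambda>\<omega>. f1 n (Y \<omega>) * G \<omega>)
        = (\<lambda>\<omega>. (exp (h n * Y \<omega>) * G \<omega> - exp (- h n * Y \<omega>) * G \<omega>) / (2 * h n))"
      by (simp add: f1_def fun_eq_iff algebra_simps diff_divide_distrib)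
    then show ?thesis using val[of "h n"] val[of "- h n"] int[of "h n"] int[of "- h n"] by simp
  qed
  have v2: "(\<integral>\<omega>. f2 n (Y \<omega>) * G \<omega> \<partial>M) = c * ((2 * exp ((h n)\<^sup>2 * \<tau> / 2) - 2) / (h n)\<^sup>2)" for n
  proof -
    have "(\<lambda>\<omega>. f2 n (Y \<omega>) * G \<omega>)
        = (\<lambda>\<omega>. (exp (h n * Y \<omega>) * G \<omega> + exp (- h n * Y \<omega>) * G \<omega> - 2 * (exp (0 * Y \<omega>) * G \<omega>)) / (h n)\<^sup>2)"
      by (simp add: f2_def fun_eq_iff algebra_simps diff_divide_distrib add_divide_distrib)
    then have "(\<integral>\<omega>. f2 n (Y \<omega>) * G \<omega> \<partial>M)
        = (c * exp ((h n)\<^sup>2 * \<tau> / 2) + c * exp ((- h n)\<^sup>2 * \<tau> / 2) - 2 * (c * exp (0\<^sup>2 * \<tau> / 2))) / (h n)\<^sup>2"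
      using int[of "h n"] int[of "- h n"] int[of 0] by (simp only: val[symmetric]) simp
    then show ?thesis by (simp add: algebra_simps diff_divide_distrib)
  qed
  have l3: "(\<lambda>n. (2 * exp ((h n)\<^sup>2 * \<tau> / 2) - 2) / (h n)\<^sup>2) \<longlonglongrightarrow> \<tau>" unfolding h_def by real_asymp
  show "integrable M (\<lambda>\<omega>. Y \<omega> * G \<omega>)" "integrable M (\<lambda>\<omega>. (Y \<omega>)\<^sup>2 * G \<omega>)" by fact+
  show "(\<integral>\<omega>. Y \<omega> * G \<omega> \<partial>M) = 0" using d1(2) v1 LIMSEQ_unique by (simp add: LIMSEQ_const_iff)
  show "(\<integral>\<omega>. (Y \<omega>)\<^sup>2 * G \<omega> \<partial>M) = c * \<tau>"
    using d2(2) tendsto_mult_left[OF l3, of c] unfolding v2 by (rule LIMSEQ_unique)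
qed

lemma lincomb_scale: "lincomb p X (\<lambda>k. s * u k) \<omega> = s * lincomb p X u \<omega>"
  and lincomb_add: "lincomb p X (\<lambda>k. u k + w k) \<omega> = lincomb p X u \<omega> + lincomb p X w \<omega>"
  and lincomb_diff: "lincomb p X (\<lambda>k. u k - w k) \<omega> = lincomb p X u \<omega> - lincomb p X w \<omega>"
  and lincomb_unit: "k < p \<Longrightarrow> lincomb p X (unit_coeff k) \<omega> = X k \<omega>"
  using sum_unit_coeff[of k p "\<lambda>k. X k \<omega>"]
  by (simp_all add: lincomb_def sum_distrib_left sum.distrib sum_subtractf algebra_simps)

lemma lincomb_supported: "supported I u \<Longrightarrow> I \<subseteq> {..<p} \<Longrightarrow> lincomb p X u \<omega> = (\<Sum>k\<in>I. u k * X k \<omega>)"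
  unfolding lincomb_def by (rule sum.mono_neutral_right) (auto simp: supported_def)

context normal_vector
begin

lemma subalgebra_generated:
  assumes I: "I \<subseteq> {..<p}"
  shows "subalgebra M (gen I)"
  unfolding subalgebra_def generated_algebra_def
  using random_vec_sub_measurable[OF I] by (auto simp: sets_vimage_algebra2 measurable_space)

lemma finite_measure_subalgebra_generated:
  "I \<subseteq> {..<p} \<Longrightarrow> finite_measure_subalgebra M (gen I)"
  by (intro finite_measure_subalgebra.intro finite_measure_subalgebra_axioms.intro
      subalgebra_generated finite_measure_axioms)

lemma X_generated_measurable:
  assumes "k \<in> I"
  shows "X k \<in> borel_measurable (gen I)"
proof -
  have "random_vec I X \<in> measurable (gen I) (\<Pi>\<^sub>M k\<in>I. borel)"
    unfolding generated_algebra_def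
    by (rule measurable_vimage_algebra1) (auto simp: random_vec_def space_PiM)
  then have "(\<lambda>\<omega>. random_vec I X \<omega> k) \<in> borel_measurable (gen I)"
    by (rule measurable_compose[OF _ measurable_component_singleton[OF assms]])
  moreover have "random_vec I X \<omega> k = X k \<omega>" for \<omega> using assms by (simp add: random_vec_def)
  ultimately show ?thesis by simp
qed

lemma lincomb_generated_measurable:
  assumes "supported I u" "I \<subseteq> {..<p}"
  shows "lincomb p X u \<in> borel_measurable (gen I)"
  unfolding lincomb_supported[OF assms, abs_def]
  by (intro borel_measurable_sum borel_measurable_times X_generated_measurable) auto

text \<open>A combination uncorrelated with \<open>X i\<close> for all \<open>i \<in> I\<close> behaves on events of these nodes as if it were
  independent of them: the translation in \<open>exponential_tilt\<close> does not move the coordinates in \<open>I\<close>.\<close>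

lemma moments_on_generated:
  assumes I: "I \<subseteq> {..<p}" and orth: "\<And>i. i \<in> I \<Longrightarrow> cov_vec u i = 0"
    and A: "A \<in> sets (gen I)"
  shows "integrable M (\<lambda>\<omega>. lincomb p X u \<omega> * indicator A \<omega>)"
    "(\<integral>\<omega>. lincomb p X u \<omega> * indicator A \<omega> \<partial>M) = 0"
    "integrable M (\<lambda>\<omega>. (lincomb p X u \<omega>)\<^sup>2 * indicator A \<omega>)"
    "(\<integral>\<omega>. (lincomb p X u \<omega>)\<^sup>2 * indicator A \<omega> \<partial>M) = prob A * q u u"
proof -
  note rv = random_vec_sub_measurable[OF I]
  obtain B where B: "B \<in> sets (\<Pi>\<^sub>M k\<in>I. (borel :: real measure))" "A = random_vec I X -` B \<inter> space M"
    using A rv by (auto simp: generated_algebra_def sets_vimage_algebra2 measurable_space)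
  have AM[measurable]: "A \<in> sets M" using B rv by (auto intro: measurable_sets)
  define g where "g = (\<lambda>x. indicator B (restrict x I) :: ennreal)"
  have "(\<lambda>x. restrict x I) \<in> measurable (\<Pi>\<^sub>M k\<in>{..<p}. (lborel :: real measure)) (\<Pi>\<^sub>M k\<in>I. (borel :: real measure))"
    using I by (intro measurable_restrict) (auto intro!: measurable_component_singleton[where M = "\<lambda>_. lborel", simplified measurable_lborel1])
  then have g[measurable]: "g \<in> borel_measurable (\<Pi>\<^sub>M k\<in>{..<p}. (lborel :: real measure))"
    unfolding g_def using B(1) by measurable
  have gA: "g (random_vec {..<p} X \<omega>) = indicator A \<omega>" if "\<omega> \<in> space M" for \<omega>
  proof -
    have "restrict (random_vec {..<p} X \<omega>) I = random_vec I X \<omega>"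
      using I by (auto simp: random_vec_def restrict_def fun_eq_iff)
    then show ?thesis using that by (auto simp: g_def B(2) indicator_def)
  qed
  have gS: "g (\<lambda>i\<in>{..<p}. cov_vec (\<lambda>k. s * u k) i + X i \<omega>) = indicator A \<omega>" if "\<omega> \<in> space M" for \<omega> s
  proof -
    have "cov_vec (\<lambda>k. s * u k) i = 0" if "i \<in> I" for i
      using orth[OF that] by (simp add: sum_distrib_left[symmetric] mult.left_commute)
    then have "restrict (\<lambda>i\<in>{..<p}. cov_vec (\<lambda>k. s * u k) i + X i \<omega>) I = random_vec I X \<omega>"
      using I by (auto simp: random_vec_def restrict_def fun_eq_iff)
    then show ?thesis using that by (auto simp: g_def B(2) indicator_def)
  qed
  have mgf: "(\<integral>\<^sup>+\<omega>. ennreal (exp (s * lincomb p X u \<omega>) * indicator A \<omega>) \<partial>M)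
      = ennreal (prob A * exp (s\<^sup>2 * q u u / 2))" for s
  proof -
    have "(\<integral>\<^sup>+\<omega>. ennreal (exp (s * lincomb p X u \<omega>) * indicator A \<omega>) \<partial>M)
        = (\<integral>\<^sup>+\<omega>. ennreal (exp (lincomb p X (\<lambda>k. s * u k) \<omega>)) * g (random_vec {..<p} X \<omega>) \<partial>M)"
      by (intro nn_integral_cong) (simp add: gA lincomb_scale indicator_def)
    also have "\<dots> = ennreal (exp (q (\<lambda>k. s * u k) (\<lambda>k. s * u k) / 2))
        * (\<integral>\<^sup>+\<omega>. g (\<lambda>i\<in>{..<p}. cov_vec (\<lambda>k. s * u k) i + X i \<omega>) \<partial>M)"
      by (rule exponential_tilt[OF g])
    also have "(\<integral>\<^sup>+\<omega>. g (\<lambda>i\<in>{..<p}. cov_vec (\<lambda>k. s * u k) i + X i \<omega>) \<partial>M) = (\<integral>\<^sup>+\<omega>. indicator A \<omega> \<partial>M)"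
      by (intro nn_integral_cong gS)
    also have "\<dots> = ennreal (prob A)" by (simp add: emeasure_eq_measure)
    finally show ?thesis
      by (simp add: qform_scale_left qform_scale_right power2_eq_square ennreal_mult'[symmetric] mult_ac)
  qed
  note m = moments_of_weighted_mgf[of "lincomb p X u" "indicator A" "prob A" "q u u", OF _ _ _ _ mgf]
  show "integrable M (\<lambda>\<omega>. lincomb p X u \<omega> * indicator A \<omega>)"
    "(\<integral>\<omega>. lincomb p X u \<omega> * indicator A \<omega> \<partial>M) = 0"
    "integrable M (\<lambda>\<omega>. (lincomb p X u \<omega>)\<^sup>2 * indicator A \<omega>)"
    "(\<integral>\<omega>. (lincomb p X u \<omega>)\<^sup>2 * indicator A \<omega> \<partial>M) = prob A * q u u"
    by (rule m; simp)+
qed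

lemma lincomb_moments:
  shows lincomb_integrable: "integrable M (lincomb p X u)"
    and lincomb_mean: "(\<integral>\<omega>. lincomb p X u \<omega> \<partial>M) = 0"
    and lincomb_sq_integrable: "integrable M (\<lambda>\<omega>. (lincomb p X u \<omega>)\<^sup>2)"
    and lincomb_sq: "(\<integral>\<omega>. (lincomb p X u \<omega>)\<^sup>2 \<partial>M) = q u u"
proof -
  have sp: "space M \<in> sets (generated_algebra M {} X)"
    using sets.top[of "generated_algebra M {} X"] by (simp add: generated_algebra_def)
  have c: "f \<omega> * indicator (space M) \<omega> = f \<omega>" if "\<omega> \<in> space M" for f :: "'w \<Rightarrow> real" and \<omega>
    using that by simp
  note m = moments_on_generated[of "{}" u "space M", OF _ _ sp, simplified]
  show "integrable M (lincomb p X u)" "(\<integral>\<omega>. lincomb p X u \<omega> \<partial>M) = 0"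
    "integrable M (\<lambda>\<omega>. (lincomb p X u \<omega>)\<^sup>2)" "(\<integral>\<omega>. (lincomb p X u \<omega>)\<^sup>2 \<partial>M) = q u u"
    using m by (simp_all add: prob_space cong: Bochner_Integration.integrable_cong Bochner_Integration.integral_cong)
qed

lemma lincomb_product:
  "integrable M (\<lambda>\<omega>. lincomb p X u \<omega> * lincomb p X w \<omega>)"
  "(\<integral>\<omega>. lincomb p X u \<omega> * lincomb p X w \<omega> \<partial>M) = q u w"
proof -
  have e: "lincomb p X u \<omega> * lincomb p X w \<omega> =
      ((lincomb p X (\<lambda>k. u k + w k) \<omega>)\<^sup>2 - (lincomb p X u \<omega>)\<^sup>2 - (lincomb p X w \<omega>)\<^sup>2) / 2" for \<omega>
    by (simp add: lincomb_add power2_sum)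
  show "integrable M (\<lambda>\<omega>. lincomb p X u \<omega> * lincomb p X w \<omega>)"
    unfolding e using lincomb_sq_integrable by simp
  show "(\<integral>\<omega>. lincomb p X u \<omega> * lincomb p X w \<omega> \<partial>M) = q u w"
    unfolding e using lincomb_sq_integrable by (simp add: lincomb_sq q_add_self)
qed

lemma cond_exp_lincomb_zero:
  assumes I: "I \<subseteq> {..<p}" and orth: "\<And>i. i \<in> I \<Longrightarrow> cov_vec u i = 0"
  shows "AE \<omega> in M. real_cond_exp M (gen I) (lincomb p X u) \<omega> = 0"
proof -
  interpret F: finite_measure_subalgebra M "gen I"
    by (rule finite_measure_subalgebra_generated[OF I])
  show ?thesis
  proof (rule F.real_cond_exp_charact)
    fix A assume "A \<in> sets (gen I)"
    then show "(\<integral>\<omega>\<in>A. lincomb p X u \<omega> \<partial>M) = (\<integral>\<omega>\<in>A. 0 \<partial>M)"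
      using moments_on_generated(2)[OF I orth] by (simp add: set_lebesgue_integral_def mult.commute)
  qed (auto simp: lincomb_integrable)
qed

end

section \<open>Precision matrix, conditional independence and regression\<close>

text \<open>Vanishing against all events \<open>Y \<in> A\<close> means vanishing conditional expectation given \<open>Y\<close>, and so
  vanishing against \<open>Y\<close> itself.\<close>

lemma (in prob_space) orthogonal_if_orthogonal_to_events:
  fixes Y Q :: "'a \<Rightarrow> real"
  assumes [measurable]: "Y \<in> borel_measurable M"
    and Q: "integrable M Q" and YQ: "integrable M (\<lambda>\<omega>. Y \<omega> * Q \<omega>)"
    and orth: "\<And>A. A \<in> sets borel \<Longrightarrow> (\<integral>\<omega>. indicator {\<eta> \<in> space M. Y \<eta> \<in> A} \<omega> * Q \<omega> \<partial>M) = 0"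
  shows "(\<integral>\<omega>. Y \<omega> * Q \<omega> \<partial>M) = 0"
proof -
  define G where "G = vimage_algebra (space M) Y (borel :: real measure)"
  have sub: "subalgebra M G"
    unfolding subalgebra_def G_def by (auto simp: sets_vimage_algebra2)
  interpret G: finite_measure_subalgebra M G
    by (intro finite_measure_subalgebra.intro finite_measure_subalgebra_axioms.intro sub finite_measure_axioms)
  have YG: "Y \<in> borel_measurable G"
    unfolding G_def by (rule measurable_vimage_algebra1) auto
  have "AE \<omega> in M. real_cond_exp M G Q \<omega> = 0"
  proof (rule G.real_cond_exp_charact)
    fix A assume "A \<in> sets G"
    then obtain B where B: "B \<in> sets borel" "A = Y -` B \<inter> space M"
      by (auto simp: G_def sets_vimage_algebra2)
    then have "A = {\<eta> \<in> space M. Y \<eta> \<in> B}" by auto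
    then show "(\<integral>\<omega>\<in>A. Q \<omega> \<partial>M) = (\<integral>\<omega>\<in>A. 0 \<partial>M)"
      using orth[OF B(1)] by (simp add: set_lebesgue_integral_def)
  qed (use Q in auto)
  then have "AE \<omega> in M. Y \<omega> * real_cond_exp M G Q \<omega> = 0" by auto
  then have "(\<integral>\<omega>. Y \<omega> * real_cond_exp M G Q \<omega> \<partial>M) = 0" by (subst integral_cong_AE[where g = "\<lambda>_. 0"]) auto
  then show ?thesis using G.real_cond_exp_intg(2)[OF YQ YG] Q by auto
qed

context normal_vector
begin

abbreviation prec_col :: "nat \<Rightarrow> nat \<Rightarrow> real" where "prec_col k \<equiv> \<lambda>j. prec j k"

text \<open>Column \<open>k\<close> of the precision matrix represents evaluation at \<open>k\<close> with respect to the covariance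
  form; that is what makes coefficients controllable by variances.\<close>

lemma q_prec_col: "k < p \<Longrightarrow> q u (prec_col k) = u k"
proof -
  assume k: "k < p"
  have "q u (prec_col k) = (\<Sum>i<p. u i * (if i = k then 1 else 0))"
    unfolding q_cov_vec using cov_vec_prec[OF k] by (intro sum.cong) auto
  then show "q u (prec_col k) = u k" using k by (simp add: if_distrib cong: if_cong)
qed

lemma cov_vec_eq_q: "i < p \<Longrightarrow> cov_vec u i = q (unit_coeff i) u"
  by (simp add: qform_unit_left)

lemma X_moments:
  assumes "k < p"
  shows X_mean: "(\<integral>\<omega>. X k \<omega> \<partial>M) = 0"
    and X_sq: "(\<integral>\<omega>. (X k \<omega>)\<^sup>2 \<partial>M) = cov k k"
proof -
  have "lincomb p X (unit_coeff k) = X k" using assms by (simp add: lincomb_unit fun_eq_iff)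
  then show "(\<integral>\<omega>. X k \<omega> \<partial>M) = 0" "(\<integral>\<omega>. (X k \<omega>)\<^sup>2 \<partial>M) = cov k k"
    using lincomb_mean[of "unit_coeff k"] lincomb_sq[of "unit_coeff k"]
      assms by (simp_all add: qform_unit_unit)
qed

lemma variance_X: "k < p \<Longrightarrow> variance (X k) = cov k k"
  by (simp add: X_mean X_sq)

lemma integrable_lincomb_mult_bounded:
  assumes [measurable]: "H \<in> borel_measurable M" and H: "AE \<omega> in M. \<bar>H \<omega>\<bar> \<le> 1"
  shows "integrable M (\<lambda>\<omega>. lincomb p X u \<omega> * H \<omega>)"
proof (rule Bochner_Integration.integrable_bound[OF lincomb_integrable[of u]])
  show "AE \<omega> in M. norm (lincomb p X u \<omega> * H \<omega>) \<le> norm (lincomb p X u \<omega>)"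
    using H by eventually_elim (simp add: abs_mult mult_left_le)
qed measurable

lemma lincomb_orthogonal_to_generated:
  assumes I: "I \<subseteq> {..<p}" and orth: "\<And>i. i \<in> I \<Longrightarrow> cov_vec u i = 0"
    and H: "H \<in> borel_measurable (gen I)" "integrable M (\<lambda>\<omega>. H \<omega> * lincomb p X u \<omega>)"
  shows "(\<integral>\<omega>. H \<omega> * lincomb p X u \<omega> \<partial>M) = 0"
proof -
  interpret F: finite_measure_subalgebra M "gen I"
    by (rule finite_measure_subalgebra_generated[OF I])
  have "AE \<omega> in M. real_cond_exp M (gen I) (lincomb p X u) \<omega> = 0"
    by (rule cond_exp_lincomb_zero[OF I orth])
  then have "AE \<omega> in M. H \<omega> * real_cond_exp M (gen I) (lincomb p X u) \<omega> = 0"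
    by eventually_elim simp
  then have "(\<integral>\<omega>. H \<omega> * real_cond_exp M (gen I) (lincomb p X u) \<omega> \<partial>M) = 0"
    using measurable_from_subalg[OF F.subalg H(1)]
    by (subst integral_cong_AE[where g = "\<lambda>_. 0"]) auto
  then show ?thesis using F.real_cond_exp_intg(2)[OF H(2,1)] by simp
qed

lemma prec_diag_ge_1:
  assumes k: "k < p" and cov1: "cov k k = 1"
  shows "1 \<le> prec k k"
  using Cauchy_Schwarz[of "unit_coeff k" "prec_col k"] k cov1
  by (simp add: q_prec_col qform_unit_unit) (simp add: unit_coeff_def)

text \<open>The regression residual of \<open>X k\<close> on all other nodes is \<open>(K X) k / K k k\<close>, so the conditional
  variance is \<open>1 / K k k\<close>.\<close>

lemma prec_diag_le:
  assumes k: "k < p" and pos: "0 < prec k k"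
    and v: "AE \<omega> in M. v\<^sup>2 \<le> cond_variance M (generated_algebra M ({..<p} - {k}) X) (X k) \<omega>"
  shows "v\<^sup>2 * prec k k \<le> 1"
proof -
  let ?I = "{..<p} - {k}"
  let ?F = "generated_algebra M ?I X"
  define L where "L = lincomb p X (\<lambda>j. 1 / prec k k * prec j k)"
  define Z where "Z = (\<lambda>\<omega>. lincomb p X (\<lambda>j. unit_coeff k j - 1 / prec k k * prec j k) \<omega>)"
  have I: "?I \<subseteq> {..<p}" by auto
  interpret F: finite_measure_subalgebra M ?F by (rule finite_measure_subalgebra_generated[OF I])
  have ZF: "Z \<in> borel_measurable ?F"
  proof -
    have e: "Z = lincomb p X (\<lambda>j. if j < p then unit_coeff k j - 1 / prec k k * prec j k else 0)"
      by (auto simp: Z_def lincomb_def fun_eq_iff)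
    show ?thesis
      unfolding e using pos by (intro lincomb_generated_measurable) (auto simp: supported_def unit_coeff_def)
  qed
  have dec: "X k \<omega> = Z \<omega> + L \<omega>" for \<omega>
    unfolding Z_def L_def lincomb_diff lincomb_unit[OF k] by simp
  have [measurable]: "L \<in> borel_measurable M" "Z \<in> borel_measurable M" by (simp_all add: L_def Z_def)
  have Lz: "AE \<omega> in M. real_cond_exp M ?F L \<omega> = 0"
    unfolding L_def
  proof (rule cond_exp_lincomb_zero[OF I])
    fix i assume i: "i \<in> ?I"
    have "cov_vec (\<lambda>j. 1 / prec k k * prec j k) i = 1 / prec k k * cov_vec (prec_col k) i"
      by (simp add: sum_divide_distrib)
    then show "cov_vec (\<lambda>j. 1 / prec k k * prec j k) i = 0" using i k by (simp add: cov_prec)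
  qed
  have Li: "integrable M L" and Zi: "integrable M Z" by (simp_all add: L_def Z_def lincomb_integrable)
  have "AE \<omega> in M. real_cond_exp M ?F (X k) \<omega> = real_cond_exp M ?F Z \<omega> + real_cond_exp M ?F L \<omega>"
    unfolding dec[abs_def] by (rule F.real_cond_exp_add[OF Zi Li])
  moreover have "AE \<omega> in M. real_cond_exp M ?F Z \<omega> = Z \<omega>" by (rule F.real_cond_exp_F_meas[OF Zi ZF])
  ultimately have ce: "AE \<omega> in M. real_cond_exp M ?F (X k) \<omega> = Z \<omega>"
    using Lz by eventually_elim simp
  have L2: "(\<integral>\<omega>. (L \<omega>)\<^sup>2 \<partial>M) = 1 / prec k k" "integrable M (\<lambda>\<omega>. (L \<omega>)\<^sup>2)"
    unfolding L_def lincomb_sq using pos k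
    by (simp_all add: lincomb_sq_integrable qform_scale_left[of p cov "1 / prec k k" "prec_col k", simplified]
        qform_scale_right[of p cov _ "1 / prec k k" "prec_col k", simplified] q_prec_col)
  let ?W = "\<lambda>\<omega>. (X k \<omega> - real_cond_exp M ?F (X k) \<omega>)\<^sup>2"
  have [measurable]: "X k \<in> borel_measurable M" using k by simp
  have WL: "AE \<omega> in M. ?W \<omega> = (L \<omega>)\<^sup>2" using ce by eventually_elim (simp add: dec)
  have Wi: "integrable M ?W"
    using integrable_cong_AE[THEN iffD2, OF _ _ WL] L2(2) by simp
  have "(\<integral>\<omega>. real_cond_exp M ?F ?W \<omega> \<partial>M) = (\<integral>\<omega>. ?W \<omega> \<partial>M)" by (rule F.real_cond_exp_int(2)[OF Wi])
  also have "\<dots> = 1 / prec k k" using integral_cong_AE[OF _ _ WL] L2(1) by simp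
  finally have eq: "(\<integral>\<omega>. real_cond_exp M ?F ?W \<omega> \<partial>M) = 1 / prec k k" .
  have "(\<integral>\<omega>. v\<^sup>2 \<partial>M) \<le> (\<integral>\<omega>. real_cond_exp M ?F ?W \<omega> \<partial>M)"
    by (rule integral_mono_AE) (use v F.real_cond_exp_int(1)[OF Wi] in \<open>auto simp: cond_variance_def\<close>)
  then show ?thesis using eq pos by (simp add: prob_space field_simps)
qed

text \<open>Conditional independence forces the off-diagonal entry of the precision matrix to vanish. Write
  \<open>Q\<close> for the event \<open>X b \<in> B\<close> centred at its conditional probability given the other nodes. Then
  \<open>X a\<close> is orthogonal to \<open>Q\<close> by conditional independence and \<open>(K X) a\<close> is orthogonal to \<open>Q\<close> because it
  is independent of all nodes but \<open>a\<close>; if \<open>K a b \<noteq> 0\<close>, then \<open>X b\<close> is orthogonal to \<open>Q\<close> as well. This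
  holds for all \<open>B\<close>, so the residual of \<open>X b\<close> on the other nodes would be orthogonal to \<open>X b\<close>.\<close>

lemma prec_zero_if_cond_indep:
  assumes ab: "a < p" "b < p" "a \<noteq> b"
    and ci: "cond_indep M (generated_algebra M ({..<p} - {a, b}) X) (X a) (X b)"
  shows "prec a b = 0"
proof (rule ccontr)
  assume nz: "prec a b \<noteq> 0"
  let ?I = "{..<p} - {a, b}"
  let ?F = "generated_algebra M ?I X"
  have I: "?I \<subseteq> {..<p}" by auto
  interpret F: finite_measure_subalgebra M ?F by (rule finite_measure_subalgebra_generated[OF I])
  have Xm[measurable]: "X a \<in> borel_measurable M" "X b \<in> borel_measurable M" using ab by auto
  have paa: "prec a a \<noteq> 0"
  proof
    assume "prec a a = 0"
    then have "q (prec_col a) (prec_col a) = 0" using ab by (simp add: q_prec_col)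
    then show False using Cauchy_Schwarz[of "unit_coeff a" "prec_col a"] ab
      by (simp add: q_prec_col) (simp add: unit_coeff_def)
  qed
  \<comment> \<open>\<open>l\<close> is the combination of \<open>(K X) a\<close> and \<open>(K X) b\<close> that does not involve \<open>X a\<close>; up to scaling it is the
    residual of \<open>X b\<close> on the nodes other than \<open>a\<close> and \<open>b\<close>.\<close>
  define l where "l = (\<lambda>j. prec_col b j - prec b a / prec a a * prec_col a j)"
  have cov_l: "cov_vec l i = (if i = b then 1 else 0) - prec b a / prec a a * (if i = a then 1 else 0)"
    if "i < p" for i
    unfolding cov_vec_eq_q[OF that] l_def qform_diff_right qform_scale_right
    using ab that by (simp add: q_prec_col) (simp add: unit_coeff_def)
  have la: "l a = 0" using ab paa by (simp add: l_def prec_sym[of a b])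
  have Ll: "(\<integral>\<omega>. indicator {\<eta> \<in> space M. X b \<eta> \<in> B} \<omega> * lincomb p X l \<omega> \<partial>M) = 0"
    if B: "B \<in> sets borel" for B
  proof -
    define eB where "eB = {\<eta> \<in> space M. X b \<eta> \<in> B}"
    have eB[measurable]: "eB \<in> sets M" unfolding eB_def using B by measurable
    define PB where "PB = cond_prob_given M ?F eB"
    have iB: "integrable M (indicator eB :: 'w \<Rightarrow> real)" using eB by (simp add: emeasure_eq_measure)
    have PBF: "PB \<in> borel_measurable ?F" by (simp add: PB_def cond_prob_given_def)
    have PB[measurable]: "PB \<in> borel_measurable M" by (rule measurable_from_subalg[OF F.subalg PBF])
    have PB1: "AE \<omega> in M. \<bar>PB \<omega>\<bar> \<le> 1"
    proof -
      have "AE \<omega> in M. 0 \<le> PB \<omega>" "AE \<omega> in M. PB \<omega> \<le> 1"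
        unfolding PB_def cond_prob_given_def
        by (rule F.real_cond_exp_ge_c[OF iB] F.real_cond_exp_le_c[OF iB]; simp add: indicator_def)+
      then show ?thesis by eventually_elim simp
    qed
    define Q where "Q = (\<lambda>\<omega>. indicator eB \<omega> - PB \<omega>)"
    have [measurable]: "Q \<in> borel_measurable M" by (simp add: Q_def)
    have iPB: "integrable M PB" unfolding PB_def cond_prob_given_def by (rule F.real_cond_exp_int(1)[OF iB])
    have iQ: "integrable M Q" unfolding Q_def using iB iPB by simp
    have i1: "integrable M (\<lambda>\<omega>. lincomb p X u \<omega> * indicator eB \<omega>)" for u
      by (rule integrable_lincomb_mult_bounded) (auto simp: indicator_def)
    have i2: "integrable M (\<lambda>\<omega>. lincomb p X u \<omega> * PB \<omega>)" for u
      by (rule integrable_lincomb_mult_bounded[OF PB PB1])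
    have iuQ: "integrable M (\<lambda>\<omega>. lincomb p X u \<omega> * Q \<omega>)" for u
      using i1[of u] i2[of u] by (simp add: Q_def right_diff_distrib)
    have split: "(\<integral>\<omega>. lincomb p X u \<omega> * Q \<omega> \<partial>M)
        = (\<integral>\<omega>. lincomb p X u \<omega> * indicator eB \<omega> \<partial>M) - (\<integral>\<omega>. lincomb p X u \<omega> * PB \<omega> \<partial>M)" for u
      using i1[of u] i2[of u] by (simp add: Q_def right_diff_distrib)
    have PBorth: "(\<integral>\<omega>. lincomb p X u \<omega> * PB \<omega> \<partial>M) = 0" if "\<And>i. i \<in> ?I \<Longrightarrow> cov_vec u i = 0" for u
      using lincomb_orthogonal_to_generated[OF I that PBF] i2[of u] by (simp add: mult.commute)
    have Qa: "(\<integral>\<omega>. X a \<omega> * Q \<omega> \<partial>M) = 0"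
    proof (rule orthogonal_if_orthogonal_to_events[OF Xm(1) iQ])
      show "integrable M (\<lambda>\<omega>. X a \<omega> * Q \<omega>)"
        using iuQ[of "unit_coeff a"] ab by (simp add: lincomb_unit)
      fix A :: "real set" assume A: "A \<in> sets borel"
      define eA where "eA = {\<eta> \<in> space M. X a \<eta> \<in> A}"
      have eA[measurable]: "eA \<in> sets M" unfolding eA_def using A by measurable
      define PA where "PA = cond_prob_given M ?F eA"
      have inter: "{\<eta> \<in> space M. X a \<eta> \<in> A \<and> X b \<eta> \<in> B} = eA \<inter> eB" by (auto simp: eA_def eB_def)
      have iA: "integrable M (indicator C :: 'w \<Rightarrow> real)" if "C \<in> sets M" for C
        using that by (simp add: emeasure_eq_measure)
      have "AE \<omega> in M. real_cond_exp M ?F (indicator (eA \<inter> eB)) \<omega> = PA \<omega> * PB \<omega>"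
        using ci A B unfolding cond_indep_def PA_def PB_def cond_prob_given_def eA_def eB_def inter[unfolded eA_def eB_def, symmetric] by blast
      then have "(\<integral>\<omega>. real_cond_exp M ?F (indicator (eA \<inter> eB)) \<omega> \<partial>M) = (\<integral>\<omega>. PA \<omega> * PB \<omega> \<partial>M)"
        unfolding PA_def cond_prob_given_def by (intro integral_cong_AE) auto
      then have e1: "(\<integral>\<omega>. indicator (eA \<inter> eB) \<omega> \<partial>M) = (\<integral>\<omega>. PA \<omega> * PB \<omega> \<partial>M)"
        using F.real_cond_exp_int(2)[OF iA, of "eA \<inter> eB"] by simp
      have iAPB: "integrable M (\<lambda>\<omega>. PB \<omega> * indicator eA \<omega>)"
        by (rule Bochner_Integration.integrable_bound[OF iPB]) (auto simp: indicator_def)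
      have e2: "(\<integral>\<omega>. PB \<omega> * indicator eA \<omega> \<partial>M) = (\<integral>\<omega>. PB \<omega> * PA \<omega> \<partial>M)"
        using F.real_cond_exp_intg(2)[OF iAPB PBF] by (simp add: PA_def cond_prob_given_def)
      have "(\<integral>\<omega>. indicator eA \<omega> * Q \<omega> \<partial>M)
          = (\<integral>\<omega>. indicator (eA \<inter> eB) \<omega> - PB \<omega> * indicator eA \<omega> \<partial>M)"
        by (intro Bochner_Integration.integral_cong refl) (auto simp: Q_def indicator_def)
      also have "\<dots> = 0"
        using iA[of "eA \<inter> eB"] iAPB e1 e2 by (simp add: mult.commute)
      finally show "(\<integral>\<omega>. indicator {\<eta> \<in> space M. X a \<eta> \<in> A} \<omega> * Q \<omega> \<partial>M) = 0"
        by (simp add: eA_def)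
    qed
    have Qz: "(\<integral>\<omega>. lincomb p X z \<omega> * Q \<omega> \<partial>M) = 0" if z: "supported ?I z" for z
      using F.real_cond_exp_intg(2)[OF i1[of z] lincomb_generated_measurable[OF z I]]
      by (simp add: split PB_def cond_prob_given_def)
    have split3: "(\<integral>\<omega>. lincomb p X u \<omega> * Q \<omega> \<partial>M)
        = u a * (\<integral>\<omega>. X a \<omega> * Q \<omega> \<partial>M) + u b * (\<integral>\<omega>. X b \<omega> * Q \<omega> \<partial>M)" for u
    proof -
      define z where "z = (\<lambda>j. if j \<in> ?I then u j else 0)"
      have zs: "supported ?I z" by (simp add: z_def supported_def)
      have "lincomb p X u \<omega> = u a * lincomb p X (unit_coeff a) \<omega> + u b * lincomb p X (unit_coeff b) \<omega> + lincomb p X z \<omega>" for \<omega>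
        unfolding lincomb_scale[symmetric] lincomb_add[symmetric] unfolding lincomb_def
        using ab by (intro sum.cong) (auto simp: z_def unit_coeff_def)
      then have "(\<integral>\<omega>. lincomb p X u \<omega> * Q \<omega> \<partial>M)
        = (\<integral>\<omega>. u a * (lincomb p X (unit_coeff a) \<omega> * Q \<omega>) + u b * (lincomb p X (unit_coeff b) \<omega> * Q \<omega>)
              + lincomb p X z \<omega> * Q \<omega> \<partial>M)"
        by (simp add: algebra_simps)
      also have "\<dots> = u a * (\<integral>\<omega>. lincomb p X (unit_coeff a) \<omega> * Q \<omega> \<partial>M)
          + u b * (\<integral>\<omega>. lincomb p X (unit_coeff b) \<omega> * Q \<omega> \<partial>M)
          + (\<integral>\<omega>. lincomb p X z \<omega> * Q \<omega> \<partial>M)"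
        using iuQ[of "unit_coeff a"] iuQ[of "unit_coeff b"] iuQ[of z] by simp
      finally show ?thesis using Qz[OF zs] ab by (simp add: lincomb_unit)
    qed
    have K: "(\<integral>\<omega>. lincomb p X (prec_col a) \<omega> * Q \<omega> \<partial>M) = 0"
    proof -
      have "eB \<in> sets (generated_algebra M ({..<p} - {a}) X)"
        unfolding eB_def
      proof -
        have "X b \<in> borel_measurable (generated_algebra M ({..<p} - {a}) X)"
          using ab by (intro X_generated_measurable) auto
        from measurable_sets[OF this B]
        show "{\<eta> \<in> space M. X b \<eta> \<in> B} \<in> sets (generated_algebra M ({..<p} - {a}) X)"
          by (simp add: generated_algebra_def vimage_def Int_def conj_commute)
      qed
      then have "(\<integral>\<omega>. lincomb p X (prec_col a) \<omega> * indicator eB \<omega> \<partial>M) = 0"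
        using ab by (intro moments_on_generated(2)[of "{..<p} - {a}"]) (auto simp: cov_prec)
      then show ?thesis unfolding split using ab by (subst PBorth) (auto simp: cov_prec)
    qed
    have Qb: "(\<integral>\<omega>. X b \<omega> * Q \<omega> \<partial>M) = 0"
      using K nz ab unfolding split3[of "prec_col a"] Qa by (simp add: prec_sym[of a b])
    have "(\<integral>\<omega>. lincomb p X l \<omega> * Q \<omega> \<partial>M) = 0" unfolding split3[of l] by (simp add: Qb la)
    then have "(\<integral>\<omega>. lincomb p X l \<omega> * indicator eB \<omega> \<partial>M) = 0"
      unfolding split by (subst (asm) PBorth) (auto simp: cov_l)
    then show ?thesis by (simp add: eB_def mult.commute)
  qed
  have "(\<integral>\<omega>. X b \<omega> * lincomb p X l \<omega> \<partial>M) = 0"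
    by (rule orthogonal_if_orthogonal_to_events[OF Xm(2) lincomb_integrable _ Ll])
       (use lincomb_product(1)[of "unit_coeff b" l] ab in \<open>simp add: lincomb_unit\<close>)
  moreover have "(\<integral>\<omega>. X b \<omega> * lincomb p X l \<omega> \<partial>M) = cov_vec l b"
    using lincomb_product(2)[of "unit_coeff b" l] ab by (simp add: lincomb_unit cov_vec_eq_q)
  ultimately show False using cov_l[OF ab(2)] ab by simp
qed

end


locale gaussian_graph = normal_vector +
  fixes v :: real
  assumes v: "v \<noteq> 0" and cov1: "k < p \<Longrightarrow> cov k k = 1"
    and cond_var: "k < p \<Longrightarrow>
      AE \<omega> in M. v\<^sup>2 \<le> cond_variance M (generated_algebra M ({..<p} - {k}) X) (X k) \<omega>"
begin

abbreviation nbh :: "nat \<Rightarrow> nat set" where "nbh \<equiv> ne M p X"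
abbreviation regress :: "nat \<Rightarrow> nat set \<Rightarrow> nat \<Rightarrow> real" where "regress \<equiv> opt_coeff M p X"

lemma prec_bounds:
  assumes "k < p"
  shows prec_ge1: "1 \<le> prec k k" and prec_pos: "0 < prec k k" and prec_le: "v\<^sup>2 * prec k k \<le> 1"
proof -
  show "1 \<le> prec k k" by (rule prec_diag_ge_1[OF assms cov1[OF assms]])
  then show "0 < prec k k" by linarith
  then show "v\<^sup>2 * prec k k \<le> 1" by (rule prec_diag_le[OF assms _ cond_var[OF assms]])
qed

lemma coercive:
  assumes k: "k < p"
  shows "v\<^sup>2 * (u k)\<^sup>2 \<le> q u u"
proof -
  have "(u k)\<^sup>2 \<le> q u u * prec k k"
    using Cauchy_Schwarz[of u "prec_col k"] k by (simp add: q_prec_col)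
  then have "v\<^sup>2 * (u k)\<^sup>2 \<le> v\<^sup>2 * (q u u * prec k k)" by (intro mult_left_mono) auto
  also have "\<dots> = q u u * (v\<^sup>2 * prec k k)" by simp
  also have "\<dots> \<le> q u u * 1" using prec_le[OF k] nonneg[of u] by (intro mult_left_mono)
  finally show ?thesis by simp
qed

lemma abs_le_of_q_le_1: "k < p \<Longrightarrow> q u u \<le> 1 \<Longrightarrow> \<bar>u k\<bar> \<le> 1 / \<bar>v\<bar>"
proof -
  assume "k < p" "q u u \<le> 1"
  then have "(v * u k)\<^sup>2 \<le> 1\<^sup>2" using coercive[of k u] by (simp add: power_mult_distrib)
  then have "\<bar>v\<bar> * \<bar>u k\<bar> \<le> 1" unfolding abs_mult[symmetric] using abs_le_square_iff[of "v * u k" 1] by simp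
  then show ?thesis using v by (simp add: field_simps)
qed

text \<open>Least squares is the Lasso with zero penalty, so the stationarity conditions below are those of
  the Lasso.\<close>

lemma regress_arg_min:
  assumes a: "a < p" and A: "A \<subseteq> {..<p}"
  shows "is_arg_min (lasso_obj a 0) (supported A) (regress a A)"
proof -
  have e: "(\<integral>\<omega>. (X a \<omega> - (\<Sum>k<p. \<theta> k * X k \<omega>))\<^sup>2 \<partial>M) = lasso_obj a 0 \<theta>" for \<theta>
    using lincomb_sq[of "residual a \<theta>"] a
    by (simp add: lasso_obj_def residual_def lincomb_diff lincomb_unit) (simp add: lincomb_def)
  have "\<exists>u. is_arg_min (lasso_obj a 0) (supported A) u"
  proof (rule minimizer_exists[where R = "1 + 1 / \<bar>v\<bar>"])
    show "finite A" using A finite_subset by blast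
    show "continuous_on UNIV (lasso_obj a 0)"
      unfolding lasso_obj_def residual_def norm1_def
      by (intro continuous_intros continuous_qform_residual continuous_on_product_coordinates)
    fix u k assume u: "lasso_obj a 0 u \<le> lasso_obj a 0 (\<lambda>_. 0)" and k: "k \<in> A"
    have "q (residual a u) (residual a u) \<le> 1"
      using u a cov1[OF a] by (simp add: lasso_obj_def residual_def qform_unit_unit)
    then have "\<bar>residual a u k\<bar> \<le> 1 / \<bar>v\<bar>" using abs_le_of_q_le_1[of k] k A by auto
    then show "\<bar>u k\<bar> \<le> 1 + 1 / \<bar>v\<bar>" by (auto simp: residual_def unit_coeff_def split: if_splits)
  qed
  then have "is_arg_min (lasso_obj a 0) (supported A) (arg_min (lasso_obj a 0) (supported A))"
    unfolding arg_min_def by (rule someI_ex)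
  moreover have "regress a A = arg_min (lasso_obj a 0) (supported A)"
    unfolding opt_coeff_def e supported_def[abs_def] by (rule refl)
  ultimately show ?thesis by simp
qed

lemma regress_supported: "a < p \<Longrightarrow> A \<subseteq> {..<p} \<Longrightarrow> supported A (regress a A)"
  using regress_arg_min by (auto simp: is_arg_min_linorder)

lemma regress_orthogonal:
  assumes "a < p" "A \<subseteq> {..<p}" "k \<in> A"
  shows "q (residual a (regress a A)) (unit_coeff k) = 0"
  using restricted_lasso_KKT(1)[OF _ regress_arg_min[OF assms(1,2)] assms(3,2)] by simp

lemma regress_orthogonal_supported:
  assumes "a < p" "A \<subseteq> {..<p}" "supported A u"
  shows "q u (residual a (regress a A)) = 0"
  unfolding q_sym[of u] qform_expand_supported[OF assms(3,2)]
  using regress_orthogonal[OF assms(1,2)] by simp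

lemma regress_residual_le: 
  assumes "a < p" "A \<subseteq> {..<p}"
  shows "q (residual a (regress a A)) (residual a (regress a A)) \<le> 1"
proof -
  have "lasso_obj a 0 (regress a A) \<le> lasso_obj a 0 (\<lambda>_. 0)"
    using regress_arg_min[OF assms] by (auto simp: is_arg_min_linorder supported_def)
  then show ?thesis using cov1[OF assms(1)] assms(1) by (simp add: lasso_obj_def residual_def qform_unit_unit)
qed

lemma regress_residual_ge:
  assumes "a < p" "A \<subseteq> {..<p}" "a \<notin> A"
  shows "v\<^sup>2 \<le> q (residual a (regress a A)) (residual a (regress a A))"
  using coercive[OF assms(1), of "residual a (regress a A)"] regress_supported[OF assms(1,2)] assms(3)
  by (simp add: residual_def supported_def unit_coeff_def)

lemma nbh_subset: "nbh a \<subseteq> {..<p} - {a}"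
  by (auto simp: ne_def)

lemma prec_zero_outside_nbh: "a < p \<Longrightarrow> k < p \<Longrightarrow> k \<noteq> a \<Longrightarrow> k \<notin> nbh a \<Longrightarrow> prec a k = 0"
  by (rule prec_zero_if_cond_indep) (auto simp: ne_def edges_def)

lemma nbh_sym:
  assumes "a < p" "b \<in> nbh a"
  shows "a \<in> nbh b"
proof -
  have "cond_indep M F (X a) (X b)" if ci: "cond_indep M F (X b) (X a)" for F
    unfolding cond_indep_def
  proof (intro ballI)
    fix A B :: "real set" assume "A \<in> sets borel" "B \<in> sets borel"
    then have "AE \<omega> in M. cond_prob_given M F {\<eta> \<in> space M. X b \<eta> \<in> B \<and> X a \<eta> \<in> A} \<omega> =
          cond_prob_given M F {\<eta> \<in> space M. X b \<eta> \<in> B} \<omega> * cond_prob_given M F {\<eta> \<in> space M. X a \<eta> \<in> A} \<omega>"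
      using ci by (auto simp: cond_indep_def)
    then show "AE \<omega> in M. cond_prob_given M F {\<eta> \<in> space M. X a \<eta> \<in> A \<and> X b \<eta> \<in> B} \<omega> =
          cond_prob_given M F {\<eta> \<in> space M. X a \<eta> \<in> A} \<omega> * cond_prob_given M F {\<eta> \<in> space M. X b \<eta> \<in> B} \<omega>"
      by eventually_elim (simp add: conj_commute mult.commute)
  qed
  then show ?thesis using assms by (auto simp: ne_def edges_def insert_commute)
qed

text \<open>The optimal predictor of \<open>X a\<close> from its neighbours is the one from all other nodes, with
  coefficients \<open>- K a k / K a a\<close>: that vector is supported on the neighbourhood and its residual is
  orthogonal to all other nodes.\<close>

lemma residual_regress_nbh:
  assumes a: "a < p"
  shows "j < p \<Longrightarrow> residual a (regress a (nbh a)) j = prec j a / prec a a"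
proof -
  let ?N = "nbh a"
  have N: "?N \<subseteq> {..<p}" using nbh_subset by auto
  define \<beta> where "\<beta> = (\<lambda>k. if k \<in> ?N then - prec k a / prec a a else 0)"
  define d where "d = (\<lambda>k. regress a ?N k - \<beta> k)"
  have paa: "prec a a \<noteq> 0" using prec_pos[OF a] by simp
  have res: "residual a \<beta> j = prec j a / prec a a" if "j < p" for j
    using that a paa prec_zero_outside_nbh[OF a, of j] nbh_subset[of a] prec_sym[OF that a]
    by (auto simp: residual_def \<beta>_def unit_coeff_def)
  have "q (residual a \<beta>) (unit_coeff k) = 0" if k: "k \<in> ?N" for k
  proof -
    have kp: "k < p" "k \<noteq> a" using k nbh_subset by auto
    have "q (unit_coeff k) (residual a \<beta>) = q (unit_coeff k) (\<lambda>j. 1 / prec a a * prec j a)"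
      unfolding qform_def by (intro sum.cong refl) (simp add: res)
    also have "\<dots> = 1 / prec a a * unit_coeff k a"
      using a by (simp only: qform_scale_right q_prec_col)
    finally show ?thesis using kp by (simp add: q_sym unit_coeff_def)
  qed
  moreover have "d k = residual a \<beta> k - residual a (regress a ?N) k" for k by (simp add: d_def residual_def)
  ultimately have orth: "q d (unit_coeff k) = 0" if "k \<in> ?N" for k
    using regress_orthogonal[OF a N that] that unfolding d_def
    by (simp add: qform_diff_left residual_def)
  have ds: "supported ?N d"
    using regress_supported[OF a N] by (auto simp: d_def \<beta>_def supported_def)
  have "q d d = 0" unfolding qform_expand_supported[OF ds N] using orth by simp
  then have "d k = 0" if "k < p" for k
    using coercive[OF that, of d] v by (simp add: mult_le_0_iff)
  moreover assume "j < p"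
  ultimately show ?thesis using res[of j] by (simp add: d_def residual_def)
qed

text \<open>The regression coefficient is \<open>- K a k / K a a\<close> and the partial correlation
  \<open>- K a k / sqrt (K a a * K k k)\<close>; their ratio is at least \<open>\<bar>v\<bar>\<close> because \<open>K k k \<ge> 1\<close> and
  \<open>K a a \<le> 1 / v\<^sup>2\<close>.\<close>

lemma regress_nbh_ge:
  assumes a: "a < p" and k: "k \<in> nbh a"
  shows "\<bar>v\<bar> * \<bar>partial_correlation S a k\<bar> \<le> \<bar>regress a (nbh a) k\<bar>"
proof -
  have kp: "k < p" "k \<noteq> a" using k nbh_subset by auto
  have pa: "1 \<le> prec a a" "v\<^sup>2 * prec a a \<le> 1" and pk: "1 \<le> prec k k"
    using prec_ge1[OF a] prec_le[OF a] prec_ge1[OF kp(1)] by auto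
  have "\<bar>v\<bar> * sqrt (prec a a) = sqrt (v\<^sup>2 * prec a a)" by (simp add: real_sqrt_mult)
  also have "\<dots> \<le> 1" using pa by simp
  also have "1 \<le> sqrt (prec k k)" using pk by simp
  finally have "\<bar>v\<bar> * sqrt (prec a a) * (\<bar>prec a k\<bar> * sqrt (prec a a))
      \<le> sqrt (prec k k) * (\<bar>prec a k\<bar> * sqrt (prec a a))"
    using pa by (intro mult_right_mono) auto
  then have ineq: "\<bar>v\<bar> * \<bar>prec a k\<bar> * prec a a \<le> \<bar>prec a k\<bar> * (sqrt (prec a a) * sqrt (prec k k))"
    using pa by (simp add: mult_ac)
  have pos: "0 < sqrt (prec a a) * sqrt (prec k k)" using pa pk by simp
  have "\<bar>v\<bar> * \<bar>partial_correlation S a k\<bar> = \<bar>v\<bar> * \<bar>prec a k\<bar> / (sqrt (prec a a) * sqrt (prec k k))"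
    using pa pk by (simp add: partial_correlation_def abs_mult real_sqrt_mult)
  also have "\<dots> \<le> \<bar>prec a k\<bar> / prec a a"
    using ineq pos pa by (simp add: divide_le_eq pos_divide_le_eq pos_le_divide_eq mult_ac)
  also have "\<dots> = \<bar>residual a (regress a (nbh a)) k\<bar>"
    using residual_regress_nbh[OF a kp(1)] pa prec_sym[OF a kp(1)] by simp
  also have "\<dots> = \<bar>regress a (nbh a) k\<bar>" using kp by (simp add: residual_def unit_coeff_def)
  finally show ?thesis .
qed

lemma partial_correlation_le_1:
  assumes a: "a < p" and k: "k < p"
  shows "\<bar>partial_correlation S a k\<bar> \<le> 1"
proof -
  have "(prec k a)\<^sup>2 \<le> prec a a * prec k k"
    using Cauchy_Schwarz[of "prec_col a" "prec_col k"] a k by (simp add: q_prec_col)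
  then have "\<bar>prec k a\<bar> \<le> sqrt (prec a a * prec k k)" by (simp add: real_le_rsqrt)
  moreover have "0 < sqrt (prec a a * prec k k)" using prec_pos[OF a] prec_pos[OF k] by simp
  ultimately show ?thesis using prec_sym[OF a k] by (simp add: partial_correlation_def)
qed

text \<open>For \<open>k\<close> outside the neighbourhood of \<open>a\<close> the residual of \<open>k\<close> on \<open>nbh a\<close> is orthogonal to \<open>X a\<close>
  too, because the residual of \<open>X a\<close> on \<open>nbh a\<close> is orthogonal to every node other than \<open>a\<close>.\<close>

lemma residual_orthogonal:
  assumes a: "a < p" and k: "k < p" and \<beta>: "supported (orth_nodes a (nbh a) k) \<beta>"
  shows "q \<beta> (residual k (regress k (nbh a - {k}))) = 0"
proof -
  let ?N = "nbh a"
  let ?w = "residual k (regress k (?N - {k}))"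
  have N: "?N - {k} \<subseteq> {..<p}" "?N \<subseteq> {..<p}" using nbh_subset by auto
  show ?thesis
  proof (cases "k \<in> insert a ?N")
    case True
    then show ?thesis using regress_orthogonal_supported[OF k N(1)] \<beta> by (simp add: orth_nodes_def)
  next
    case False
    then have ka: "k \<noteq> a" "k \<notin> ?N" "?N - {k} = ?N" by auto
    let ?wa = "residual a (regress a ?N)"
    have "q ?wa ?w = q (\<lambda>j. 1 / prec a a * prec j a) ?w"
      unfolding qform_def using residual_regress_nbh[OF a] by (intro sum.cong refl) simp
    also have "\<dots> = 1 / prec a a * ?w a"
      using a by (simp only: qform_scale_left q_sym[of _ ?w] q_prec_col)
    also have "?w a = 0"
      using regress_supported[OF k N(1)] nbh_subset[of a] ka by (auto simp: residual_def supported_def unit_coeff_def)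
    finally have wa: "q ?wa ?w = 0" by simp
    define \<beta>' where "\<beta>' = (\<lambda>j. if j = a then 0 else \<beta> j + \<beta> a * regress a ?N j)"
    have \<beta>': "supported ?N \<beta>'"
      using \<beta> False regress_supported[OF a N(2)] by (auto simp: \<beta>'_def supported_def orth_nodes_def)
    have "\<beta> = (\<lambda>j. \<beta>' j + \<beta> a * ?wa j)"
      using regress_supported[OF a N(2)] nbh_subset[of a]
      by (auto simp: \<beta>'_def residual_def unit_coeff_def supported_def fun_eq_iff)
    then have "q \<beta> ?w = q \<beta>' ?w + \<beta> a * q ?wa ?w"
      using qform_add_left[of p cov \<beta>' "\<lambda>j. \<beta> a * ?wa j" ?w] by (simp add: qform_scale_left)
    then show ?thesis using wa regress_orthogonal_supported[OF k N(1), of \<beta>'] \<beta>' ka by simp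
  qed
qed

end

section \<open>Exponential moments of squares and products\<close>

lemma nn_integral_normal_density: "0 < s \<Longrightarrow> (\<integral>\<^sup>+x. ennreal (normal_density m s x) \<partial>lborel) = 1"
  by (subst nn_integral_eq_integral) (auto simp: integrable_normal_density integral_normal_density)

lemma nn_integral_std_normal_exp:
  "(\<integral>\<^sup>+s. ennreal (std_normal_density s * exp (s * y)) \<partial>lborel) = ennreal (exp (y\<^sup>2 / 2))"
proof -
  have "std_normal_density s * exp (s * y) = exp (y\<^sup>2 / 2) * normal_density y 1 s" for s
    by (simp add: normal_density_def exp_add[symmetric] power2_eq_square field_simps)
  then have "(\<integral>\<^sup>+s. ennreal (std_normal_density s * exp (s * y)) \<partial>lborel)
      = (\<integral>\<^sup>+s. ennreal (exp (y\<^sup>2 / 2)) * ennreal (normal_density y 1 s) \<partial>lborel)"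
    by (simp add: ennreal_mult'')
  also have "\<dots> = ennreal (exp (y\<^sup>2 / 2)) * 1"
    by (subst nn_integral_cmult) (auto simp: nn_integral_normal_density)
  finally show ?thesis by simp
qed

context normal_vector
begin

text \<open>Mixing the exponential moments of \<open>lincomb p X u\<close> over a standard normal parameter turns them into
  the exponential moment of its square.\<close>

lemma exp_square_moment:
  assumes qu: "q u u \<le> 1"
  shows "(\<integral>\<^sup>+\<omega>. ennreal (exp ((lincomb p X u \<omega>)\<^sup>2 / 4)) \<partial>M) \<le> ennreal (sqrt 2)"
proof -
  interpret pair_sigma_finite M lborel ..
  let ?U = "\<lambda>\<omega>. lincomb p X u \<omega> / sqrt 2"
  have "(\<integral>\<^sup>+\<omega>. ennreal (exp ((lincomb p X u \<omega>)\<^sup>2 / 4)) \<partial>M)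
      = (\<integral>\<^sup>+\<omega>. (\<integral>\<^sup>+s. ennreal (std_normal_density s * exp (s * ?U \<omega>)) \<partial>lborel) \<partial>M)"
    unfolding nn_integral_std_normal_exp by (simp add: power_divide)
  also have "\<dots> = (\<integral>\<^sup>+s. (\<integral>\<^sup>+\<omega>. ennreal (std_normal_density s * exp (s * ?U \<omega>)) \<partial>M) \<partial>lborel)"
    by (rule Fubini'[symmetric]) measurable
  also have "\<dots> = (\<integral>\<^sup>+s. ennreal (std_normal_density s * exp (s\<^sup>2 * q u u / 4)) \<partial>lborel)"
  proof (rule nn_integral_cong)
    fix s :: real
    have e: "s * ?U \<omega> = lincomb p X (\<lambda>k. (s / sqrt 2) * u k) \<omega>" for \<omega> by (simp only: lincomb_scale) simp
    have "(\<integral>\<^sup>+\<omega>. ennreal (std_normal_density s * exp (s * ?U \<omega>)) \<partial>M)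
        = ennreal (std_normal_density s) * (\<integral>\<^sup>+\<omega>. ennreal (exp (lincomb p X (\<lambda>k. (s / sqrt 2) * u k) \<omega>)) \<partial>M)"
      unfolding e by (subst nn_integral_cmult[symmetric]) (auto simp: ennreal_mult'')
    also have "(\<integral>\<^sup>+\<omega>. ennreal (exp (lincomb p X (\<lambda>k. (s / sqrt 2) * u k) \<omega>)) \<partial>M) = ennreal (exp (s\<^sup>2 * q u u / 4))"
      unfolding exponential_moment qform_scale_left qform_scale_right
      by (simp add: power2_eq_square)
    finally show "(\<integral>\<^sup>+\<omega>. ennreal (std_normal_density s * exp (s * ?U \<omega>)) \<partial>M)
        = ennreal (std_normal_density s * exp (s\<^sup>2 * q u u / 4))"
      by (simp add: ennreal_mult'')
  qed
  also have "\<dots> \<le> (\<integral>\<^sup>+s. ennreal (sqrt 2) * ennreal (normal_density 0 (sqrt 2) s) \<partial>lborel)"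
  proof (rule nn_integral_mono)
    fix s :: real
    have "std_normal_density s * exp (s\<^sup>2 * q u u / 4) \<le> std_normal_density s * exp (s\<^sup>2 / 4)"
      using qu by (intro mult_left_mono) (auto simp: mult_left_le)
    also have "\<dots> = sqrt 2 * normal_density 0 (sqrt 2) s"
    proof -
      have "exp (- s\<^sup>2 / 2) * exp (s\<^sup>2 / 4) = exp (- s\<^sup>2 / 4)" by (simp add: exp_add[symmetric])
      moreover have "sqrt (2 * pi * (sqrt 2)\<^sup>2) = sqrt 2 * sqrt (2 * pi)" by (simp add: real_sqrt_mult)
      ultimately show ?thesis by (simp add: normal_density_def)
    qed
    finally show "ennreal (std_normal_density s * exp (s\<^sup>2 * q u u / 4))
        \<le> ennreal (sqrt 2) * ennreal (normal_density 0 (sqrt 2) s)"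
      by (simp add: ennreal_mult''[symmetric] ennreal_leI)
  qed
  also have "\<dots> = ennreal (sqrt 2)" by (subst nn_integral_cmult) (auto simp: nn_integral_normal_density)
  finally show ?thesis .
qed

lemma exp_square_integrable:
  assumes "q u u \<le> 1"
  shows "integrable M (\<lambda>\<omega>. exp ((lincomb p X u \<omega>)\<^sup>2 / 4))"
    and "(\<integral>\<omega>. exp ((lincomb p X u \<omega>)\<^sup>2 / 4) \<partial>M) \<le> 1.4143"
proof -
  note b = exp_square_moment[OF assms]
  show i: "integrable M (\<lambda>\<omega>. exp ((lincomb p X u \<omega>)\<^sup>2 / 4))"
    by (rule integrableI_nonneg) (use b in \<open>auto intro: le_less_trans\<close>)
  have "ennreal (\<integral>\<omega>. exp ((lincomb p X u \<omega>)\<^sup>2 / 4) \<partial>M) \<le> ennreal (sqrt 2)"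
    using b nn_integral_eq_integral[OF i] by simp
  then have "(\<integral>\<omega>. exp ((lincomb p X u \<omega>)\<^sup>2 / 4) \<partial>M) \<le> sqrt 2" by (simp add: ennreal_le_iff)
  also have "sqrt 2 \<le> 1.4143" by (rule real_le_lsqrt) (auto simp: power2_eq_square)
  finally show "(\<integral>\<omega>. exp ((lincomb p X u \<omega>)\<^sup>2 / 4) \<partial>M) \<le> 1.4143" .
qed

end

lemma exp_le_quadratic_exp_abs: "exp x \<le> 1 + x + x\<^sup>2 / 2 * exp \<bar>x\<bar>" for x :: real
proof (cases "x = 0")
  case False
  obtain t where t: "\<bar>t\<bar> < \<bar>x\<bar>" "exp x = (\<Sum>m<2. x ^ m / fact m) + exp t / fact 2 * x ^ 2"
    using Maclaurin_exp_lt[OF False, of 2] by auto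
  have "exp t / fact 2 * x ^ 2 \<le> exp \<bar>x\<bar> / fact 2 * x ^ 2"
    using t(1) by (intro mult_right_mono divide_right_mono) auto
  then show ?thesis using t(2) by (simp add: numeral_2_eq_2 field_simps)
qed simp

lemma square_le_exp: "0 \<le> c \<Longrightarrow> 0 \<le> y \<Longrightarrow> (c * y)\<^sup>2 / 2 \<le> exp (c * y)" for c y :: real
proof -
  assume "0 \<le> c" "0 \<le> y"
  then have "0 \<le> c * y" by simp
  with exp_lower_Taylor_quadratic[OF this] show ?thesis by linarith
qed

lemma exp_minus_le_quadratic: "0 \<le> x \<Longrightarrow> exp (- x) \<le> 1 - x + x\<^sup>2 / 2" for x :: real
proof (cases "x = 0")
  case False
  assume x: "0 \<le> x"
  then have mx: "- x < 0" using False by simp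
  obtain t where t: "- x < t" "t < 0" "exp (- x) = (\<Sum>m<3. (- x) ^ m / fact m) + exp t / fact 3 * (- x) ^ 3"
    using Maclaurin_minus[of "- x" 3 "\<lambda>_. exp" exp] mx by (auto simp: DERIV_exp)
  have "exp t / fact 3 * (- x) ^ 3 \<le> 0"
    using x by (intro mult_nonneg_nonpos) (auto simp: power3_eq_cube mult_nonneg_nonneg)
  then show ?thesis using t(3) by (simp add: numeral_3_eq_3 numeral_2_eq_2 field_simps)
qed simp

context normal_vector
begin

text \<open>Bernstein's argument: after a second-order expansion the linear term has mean zero by
  orthogonality, and the remainder is dominated by the exponential moments of the two squares.\<close>

lemma product_mgf:
  assumes u: "q u u \<le> 1" and w: "q w w \<le> 1" and orth: "q u w = 0" and t: "\<bar>t\<bar> \<le> 1 / 16"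
  shows "(\<integral>\<^sup>+\<omega>. ennreal (exp (t * (lincomb p X u \<omega> * lincomb p X w \<omega>))) \<partial>M) \<le> ennreal (exp (41 * t\<^sup>2))"
proof -
  define U where "U = lincomb p X u"
  define V where "V = lincomb p X w"
  define W where "W = (\<lambda>\<omega>. (exp ((U \<omega>)\<^sup>2 / 4) + exp ((V \<omega>)\<^sup>2 / 4)) / 2)"
  have iW: "integrable M W" and W: "(\<integral>\<omega>. W \<omega> \<partial>M) \<le> 1.4143"
    using exp_square_integrable[OF u] exp_square_integrable[OF w] by (simp_all add: W_def U_def V_def)
  have iUV: "integrable M (\<lambda>\<omega>. U \<omega> * V \<omega>)" and UV: "(\<integral>\<omega>. U \<omega> * V \<omega> \<partial>M) = 0"
    using lincomb_product[of u w] orth by (simp_all add: U_def V_def)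
  have pt: "exp (t * (U \<omega> * V \<omega>)) \<le> 1 + t * (U \<omega> * V \<omega>) + 57 / 2 * t\<^sup>2 * W \<omega>" for \<omega>
  proof -
    define y where "y = \<bar>U \<omega> * V \<omega>\<bar>"
    have y: "0 \<le> y" by (simp add: y_def)
    have ty: "\<bar>t * (U \<omega> * V \<omega>)\<bar> \<le> 1 / 16 * y"
      unfolding abs_mult[of t] y_def[symmetric] using t y by (intro mult_right_mono)
    have "(3 / 16 * y)\<^sup>2 / 2 \<le> exp (3 / 16 * y)" by (rule square_le_exp) (use y in auto)
    moreover have "(3 / 16 * y)\<^sup>2 / 2 = 9 / 512 * y\<^sup>2" by (simp add: power2_eq_square)
    ultimately have y2: "y\<^sup>2 \<le> 57 * exp (3 / 16 * y)" using exp_gt_zero[of "3 / 16 * y"] by linarith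
    have "y / 4 \<le> ((U \<omega>)\<^sup>2 / 4 + (V \<omega>)\<^sup>2 / 4) / 2"
      using sum_squares_bound[of "\<bar>U \<omega>\<bar>" "\<bar>V \<omega>\<bar>"] by (simp add: y_def abs_mult)
    then have "exp (y / 4) \<le> exp ((U \<omega>)\<^sup>2 / 4 / 2) * exp ((V \<omega>)\<^sup>2 / 4 / 2)"
      by (simp add: exp_add[symmetric] add_divide_distrib)
    also have "\<dots> \<le> W \<omega>"
    proof -
      have sq: "(exp (x / 2))\<^sup>2 = exp x" for x :: real by (simp add: exp_double[symmetric])
      show ?thesis
        using sum_squares_bound[of "exp ((U \<omega>)\<^sup>2 / 4 / 2)" "exp ((V \<omega>)\<^sup>2 / 4 / 2)"]
        unfolding sq W_def by simp
    qed
    finally have eW: "exp (y / 4) \<le> W \<omega>" .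
    have "(t * (U \<omega> * V \<omega>))\<^sup>2 / 2 * exp \<bar>t * (U \<omega> * V \<omega>)\<bar> \<le> t\<^sup>2 * (57 * exp (3 / 16 * y)) / 2 * exp (1 / 16 * y)"
    proof (rule mult_mono)
      have "(t * (U \<omega> * V \<omega>))\<^sup>2 = t\<^sup>2 * y\<^sup>2" by (simp add: y_def power_mult_distrib)
      then show "(t * (U \<omega> * V \<omega>))\<^sup>2 / 2 \<le> t\<^sup>2 * (57 * exp (3 / 16 * y)) / 2"
        using mult_left_mono[OF y2, of "t\<^sup>2"] by simp
    qed (use ty in auto)
    also have "\<dots> = 57 / 2 * t\<^sup>2 * exp (y / 4)"
      by (simp add: exp_add[symmetric] mult.assoc)
    also have "\<dots> \<le> 57 / 2 * t\<^sup>2 * W \<omega>" using eW by (intro mult_left_mono) auto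
    finally show ?thesis using exp_le_quadratic_exp_abs[of "t * (U \<omega> * V \<omega>)"] by linarith
  qed
  have iR: "integrable M (\<lambda>\<omega>. 1 + t * (U \<omega> * V \<omega>) + 57 / 2 * t\<^sup>2 * W \<omega>)"
    using iUV iW by simp
  have "(\<integral>\<^sup>+\<omega>. ennreal (exp (t * (U \<omega> * V \<omega>))) \<partial>M)
      \<le> (\<integral>\<^sup>+\<omega>. ennreal (1 + t * (U \<omega> * V \<omega>) + 57 / 2 * t\<^sup>2 * W \<omega>) \<partial>M)"
    using pt by (intro nn_integral_mono ennreal_leI)
  also have "\<dots> = ennreal (\<integral>\<omega>. 1 + t * (U \<omega> * V \<omega>) + 57 / 2 * t\<^sup>2 * W \<omega> \<partial>M)"
    by (rule nn_integral_eq_integral[OF iR]) (use pt in \<open>auto intro!: AE_I2 intro: order_trans[OF exp_ge_zero]\<close>)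
  also have "(\<integral>\<omega>. 1 + t * (U \<omega> * V \<omega>) + 57 / 2 * t\<^sup>2 * W \<omega> \<partial>M) = 1 + 57 / 2 * t\<^sup>2 * (\<integral>\<omega>. W \<omega> \<partial>M)"
    using iUV iW UV by (simp add: prob_space)
  also have "\<dots> \<le> 1 + 41 * t\<^sup>2"
  proof -
    have "t\<^sup>2 * (\<integral>\<omega>. W \<omega> \<partial>M) \<le> t\<^sup>2 * 1.4143" using W by (intro mult_left_mono) auto
    then have "57 / 2 * (t\<^sup>2 * (\<integral>\<omega>. W \<omega> \<partial>M)) \<le> 57 / 2 * (t\<^sup>2 * 1.4143)" by linarith
    also have "\<dots> \<le> 41 * t\<^sup>2" by simp
    finally show ?thesis unfolding mult.assoc by linarith
  qed
  also have "\<dots> \<le> exp (41 * t\<^sup>2)" by (rule exp_ge_add_one_self)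
  finally show ?thesis by (simp add: U_def V_def ennreal_leI)
qed

text \<open>The left tail of a square is light: \<open>exp (- x) \<le> 1 - x + x\<^sup>2 / 2\<close> only involves moments up to the
  fourth.\<close>

lemma negative_square_mgf:
  assumes u: "q u u = 1" and s: "0 \<le> s"
  shows "(\<integral>\<^sup>+\<omega>. ennreal (exp (- s * (lincomb p X u \<omega>)\<^sup>2)) \<partial>M) \<le> ennreal (exp (- s + 23 * s\<^sup>2))"
proof -
  define U where "U = lincomb p X u"
  have iU: "integrable M (\<lambda>\<omega>. (U \<omega>)\<^sup>2)" and EU: "(\<integral>\<omega>. (U \<omega>)\<^sup>2 \<partial>M) = 1"
    using lincomb_sq_integrable[of u] lincomb_sq[of u] u by (simp_all add: U_def)
  define W where "W = (\<lambda>\<omega>. exp ((U \<omega>)\<^sup>2 / 4))"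
  have iW: "integrable M W" and W: "(\<integral>\<omega>. W \<omega> \<partial>M) \<le> 1.4143"
    using exp_square_integrable[of u] u by (simp_all add: U_def W_def)
  have pt: "exp (- s * (U \<omega>)\<^sup>2) \<le> 1 - s * (U \<omega>)\<^sup>2 + 16 * s\<^sup>2 * W \<omega>" for \<omega>
  proof -
    have "(1 / 4 * (U \<omega>)\<^sup>2)\<^sup>2 / 2 \<le> exp (1 / 4 * (U \<omega>)\<^sup>2)" by (rule square_le_exp) auto
    then have "((U \<omega>)\<^sup>2)\<^sup>2 \<le> 32 * W \<omega>" by (simp add: W_def power_divide)
    then have "s\<^sup>2 * ((U \<omega>)\<^sup>2)\<^sup>2 \<le> s\<^sup>2 * (32 * W \<omega>)" by (intro mult_left_mono) auto
    then have "(s * (U \<omega>)\<^sup>2)\<^sup>2 / 2 \<le> 16 * s\<^sup>2 * W \<omega>" by (simp add: power_mult_distrib)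
    then show ?thesis using exp_minus_le_quadratic[of "s * (U \<omega>)\<^sup>2"] s by simp
  qed
  have iR: "integrable M (\<lambda>\<omega>. 1 - s * (U \<omega>)\<^sup>2 + 16 * s\<^sup>2 * W \<omega>)" using iU iW by simp
  have "(\<integral>\<^sup>+\<omega>. ennreal (exp (- s * (U \<omega>)\<^sup>2)) \<partial>M) \<le> (\<integral>\<^sup>+\<omega>. ennreal (1 - s * (U \<omega>)\<^sup>2 + 16 * s\<^sup>2 * W \<omega>) \<partial>M)"
    using pt by (intro nn_integral_mono ennreal_leI)
  also have "\<dots> = ennreal (\<integral>\<omega>. 1 - s * (U \<omega>)\<^sup>2 + 16 * s\<^sup>2 * W \<omega> \<partial>M)"
    by (rule nn_integral_eq_integral[OF iR]) (use pt in \<open>auto intro!: AE_I2 intro: order_trans[OF exp_ge_zero]\<close>)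
  also have "(\<integral>\<omega>. 1 - s * (U \<omega>)\<^sup>2 + 16 * s\<^sup>2 * W \<omega> \<partial>M) = 1 - s + 16 * s\<^sup>2 * (\<integral>\<omega>. W \<omega> \<partial>M)"
    using iU iW EU by (simp add: prob_space)
  also have "\<dots> \<le> 1 + (- s + 23 * s\<^sup>2)"
  proof -
    have "s\<^sup>2 * (\<integral>\<omega>. W \<omega> \<partial>M) \<le> s\<^sup>2 * 1.4143" using W by (intro mult_left_mono) auto
    then have "16 * (s\<^sup>2 * (\<integral>\<omega>. W \<omega> \<partial>M)) \<le> 16 * (s\<^sup>2 * 1.4143)" by linarith
    also have "\<dots> \<le> 23 * s\<^sup>2" by simp
    finally show ?thesis unfolding mult.assoc by linarith
  qed
  also have "\<dots> \<le> exp (- s + 23 * s\<^sup>2)" by (rule exp_ge_add_one_self)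
  finally show ?thesis by (simp add: U_def ennreal_leI)
qed

end

section \<open>Concentration of empirical second moments\<close>

locale iid_normal_rows = prob_space M for M :: "'w measure" +
  fixes p n :: nat and S :: "real mat" and D :: "nat \<Rightarrow> nat \<Rightarrow> 'w \<Rightarrow> real"
  assumes n: "1 \<le> n"
    and row_normal: "i < n \<Longrightarrow> multivariate_normal M p S (D i)"
    and row_indep: "indep_vars (\<lambda>i. \<Pi>\<^sub>M k\<in>{..<p}. (borel :: real measure)) (\<lambda>i. random_vec {..<p} (D i)) {..<n}"
begin

abbreviation popq :: "(nat \<Rightarrow> real) \<Rightarrow> (nat \<Rightarrow> real) \<Rightarrow> real" where
  "popq \<equiv> qform p (\<lambda>i j. S $$ (i, j))"

definition emp :: "'w \<Rightarrow> nat \<Rightarrow> nat \<Rightarrow> real" where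
  "emp \<omega> i j = (\<Sum>r<n. D r i \<omega> * D r j \<omega>) / real n"

abbreviation empq :: "'w \<Rightarrow> (nat \<Rightarrow> real) \<Rightarrow> (nat \<Rightarrow> real) \<Rightarrow> real" where
  "empq \<omega> \<equiv> qform p (emp \<omega>)"

lemma row: "r < n \<Longrightarrow> normal_vector M p S (D r)"
  by (intro normal_vector.intro normal_vector_axioms.intro row_normal prob_space_axioms)

lemma empq_eq: "empq \<omega> u w = (\<Sum>r<n. lincomb p (D r) u \<omega> * lincomb p (D r) w \<omega>) / real n"
proof -
  have "(\<Sum>r<n. lincomb p (D r) u \<omega> * lincomb p (D r) w \<omega>)
      = (\<Sum>r<n. \<Sum>i<p. \<Sum>j<p. u i * (D r i \<omega> * D r j \<omega>) * w j)"
    unfolding lincomb_def sum_product by (intro sum.cong refl) (simp add: mult_ac)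
  also have "\<dots> = (\<Sum>i<p. \<Sum>j<p. \<Sum>r<n. u i * (D r i \<omega> * D r j \<omega>) * w j)"
  proof -
    have "(\<Sum>r<n. \<Sum>j<p. u i * (D r i \<omega> * D r j \<omega>) * w j) = (\<Sum>j<p. \<Sum>r<n. u i * (D r i \<omega> * D r j \<omega>) * w j)" for i
      by (rule sum.swap)
    then show ?thesis by (subst sum.swap) simp
  qed
  also have "\<dots> = real n * empq \<omega> u w"
    unfolding qform_def emp_def using n
    by (simp add: sum_distrib_left sum_distrib_right sum_divide_distrib)
  finally show ?thesis using n by simp
qed

lemma empq_sq: "real n * empq \<omega> u u = (\<Sum>r<n. (lincomb p (D r) u \<omega>)\<^sup>2)"
  using n by (simp add: empq_eq power2_eq_square)

lemma psd_emp: "psd_form p (emp \<omega>)"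
proof
  show "emp \<omega> i j = emp \<omega> j i" for i j by (simp add: emp_def mult.commute)
  show "0 \<le> empq \<omega> u u" for u by (simp add: empq_eq sum_nonneg)
qed

lemma lincomb_row_measurable[measurable]: "r < n \<Longrightarrow> lincomb p (D r) u \<in> borel_measurable M"
  using normal_vector.lincomb_measurable[OF row] .

lemma empq_measurable[measurable]: "(\<lambda>\<omega>. empq \<omega> u w) \<in> borel_measurable M"
  unfolding empq_eq by measurable

abbreviation row_space :: "(nat \<Rightarrow> real) measure" where
  "row_space \<equiv> \<Pi>\<^sub>M k\<in>{..<p}. borel"

lemma Chernoff_rows:
  fixes h :: "(nat \<Rightarrow> real) \<Rightarrow> real"
  assumes h: "h \<in> borel_measurable row_space"
    and hY: "\<And>r \<omega>. r < n \<Longrightarrow> h (random_vec {..<p} (D r) \<omega>) = Y r \<omega>"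
    and mgf: "\<And>r. r < n \<Longrightarrow> (\<integral>\<^sup>+\<omega>. ennreal (exp (Y r \<omega>)) \<partial>M) \<le> ennreal (exp c)"
  shows "prob {\<omega> \<in> space M. x \<le> (\<Sum>r<n. Y r \<omega>)} \<le> exp (real n * c - x)"
proof -
  have Z: "indep_vars (\<lambda>_. borel) (\<lambda>r \<omega>. ennreal (exp (h (random_vec {..<p} (D r) \<omega>)))) {..<n}"
    by (rule indep_vars_compose2[OF row_indep]) (use h in measurable)
  have Ym: "Y r \<in> borel_measurable M" if r: "r < n" for r
  proof -
    have "random_vec {..<p} (D r) \<in> measurable M (\<Pi>\<^sub>M k\<in>{..<p}. borel)"
      using row_indep r by (simp add: indep_vars_def)
    from measurable_compose[OF this h] show ?thesis
      using hY[OF r] by simp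
  qed
  have [measurable]: "(\<lambda>\<omega>. \<Sum>r<n. Y r \<omega>) \<in> borel_measurable M" using Ym by measurable
  let ?A = "{\<omega> \<in> space M. x \<le> (\<Sum>r<n. Y r \<omega>)}"
  have set_eq: "?A = {\<omega> \<in> space M. 1 \<le> ennreal (exp (- x)) * ennreal (exp (\<Sum>r<n. Y r \<omega>))}"
    by (auto simp: ennreal_mult''[symmetric] exp_add[symmetric] simp flip: ennreal_1)
  have "emeasure M ?A \<le> ennreal (exp (- x)) * (\<integral>\<^sup>+\<omega>. ennreal (exp (\<Sum>r<n. Y r \<omega>)) * indicator (space M) \<omega> \<partial>M)"
    unfolding set_eq by (rule nn_integral_Markov_inequality) auto
  also have "(\<integral>\<^sup>+\<omega>. ennreal (exp (\<Sum>r<n. Y r \<omega>)) * indicator (space M) \<omega> \<partial>M)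
      = (\<integral>\<^sup>+\<omega>. (\<Prod>r<n. ennreal (exp (h (random_vec {..<p} (D r) \<omega>)))) \<partial>M)"
    by (intro nn_integral_cong) (simp add: exp_sum hY prod_ennreal)
  also have "\<dots> = (\<Prod>r<n. \<integral>\<^sup>+\<omega>. ennreal (exp (h (random_vec {..<p} (D r) \<omega>))) \<partial>M)"
    by (rule indep_vars_nn_integral[OF _ Z]) auto
  also have "\<dots> \<le> (\<Prod>r<n. ennreal (exp c))"
    by (intro prod_mono_ennreal) (use mgf hY in simp)
  also have "\<dots> = ennreal (exp (real n * c))" by (simp add: ennreal_power exp_of_nat_mult)
  finally have "emeasure M ?A \<le> ennreal (exp (- x)) * ennreal (exp (real n * c))"
    by (simp add: mult_left_mono)
  then have "ennreal (prob ?A) \<le> ennreal (exp (real n * c - x))"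
    by (simp add: emeasure_eq_measure ennreal_mult''[symmetric] exp_add[symmetric])
  then show ?thesis by (simp add: ennreal_le_iff)
qed

lemma lincomb_fun_measurable:
  "(\<lambda>x. \<Sum>k<p. u k * x k) \<in> borel_measurable row_space"
  by measurable

lemma emp_large:
  assumes u: "popq u u \<le> 1"
  shows "prob {\<omega> \<in> space M. 4 \<le> empq \<omega> u u} \<le> exp (- real n / 2)"
proof -
  have sq: "sqrt 2 \<le> exp (1 / 2)"
  proof (rule real_le_lsqrt)
    show "2 \<le> (exp (1 / 2 :: real))\<^sup>2" using exp_ge_add_one_self[of "1::real"] by (simp add: exp_double[symmetric])
  qed simp
  have "prob {\<omega> \<in> space M. real n \<le> (\<Sum>r<n. (lincomb p (D r) u \<omega>)\<^sup>2 / 4)} \<le> exp (real n * (1 / 2) - real n)"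
  proof (rule Chernoff_rows[where h = "\<lambda>x. (\<Sum>k<p. u k * x k)\<^sup>2 / 4"])
    show "(\<lambda>x. (\<Sum>k<p. u k * x k)\<^sup>2 / 4) \<in> borel_measurable row_space"
      using lincomb_fun_measurable[of u] by measurable
    fix r assume r: "r < n"
    show "(\<Sum>k<p. u k * random_vec {..<p} (D r) \<omega> k)\<^sup>2 / 4 = (lincomb p (D r) u \<omega>)\<^sup>2 / 4" for \<omega>
      by (simp add: random_vec_def lincomb_def)
    show "(\<integral>\<^sup>+\<omega>. ennreal (exp ((lincomb p (D r) u \<omega>)\<^sup>2 / 4)) \<partial>M) \<le> ennreal (exp (1 / 2))"
      using normal_vector.exp_square_moment[OF row[OF r] u] ennreal_leI[OF sq] by (rule order_trans)
  qed
  moreover have "real n \<le> (\<Sum>r<n. (lincomb p (D r) u \<omega>)\<^sup>2 / 4) \<longleftrightarrow> 4 \<le> empq \<omega> u u" for \<omega>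
    unfolding sum_divide_distrib[symmetric] empq_sq[symmetric] using n by (simp add: field_simps)
  ultimately show ?thesis by simp
qed

lemma emp_small:
  assumes u: "0 < popq u u"
  shows "prob {\<omega> \<in> space M. empq \<omega> u u \<le> popq u u / 8} \<le> exp (- real n / 200)"
proof -
  define \<sigma> where "\<sigma> = popq u u"
  have \<sigma>: "0 < \<sigma>" using u by (simp add: \<sigma>_def)
  \<comment> \<open>\<open>1 / 46\<close> minimises \<open>- s + 23 * s\<^sup>2\<close>, and \<open>368 = 8 * 46\<close>.\<close>
  define u' where "u' = (\<lambda>k. (1 / sqrt \<sigma>) * u k)"
  have u': "popq u' u' = 1" using \<sigma> unfolding u'_def qform_scale_left qform_scale_right \<sigma>_def[symmetric] by simp
  have iff: "- real n / 368 \<le> (\<Sum>r<n. - (1 / 46) * (lincomb p (D r) u' \<omega>)\<^sup>2) \<longleftrightarrow> empq \<omega> u u \<le> \<sigma> / 8" for \<omega>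
  proof -
    have "empq \<omega> u' u' = empq \<omega> u u / \<sigma>" using \<sigma> unfolding u'_def qform_scale_left qform_scale_right by simp
    then have e: "(\<Sum>r<n. - (1 / 46) * (lincomb p (D r) u' \<omega>)\<^sup>2) = - (1 / 46) * (real n * (empq \<omega> u u / \<sigma>))"
      unfolding sum_distrib_left[symmetric] empq_sq[symmetric] by simp
    show ?thesis unfolding e using n \<sigma> by (simp add: field_simps)
  qed
  have "prob {\<omega> \<in> space M. - real n / 368 \<le> (\<Sum>r<n. - (1 / 46) * (lincomb p (D r) u' \<omega>)\<^sup>2)}
      \<le> exp (real n * (- (1 / 46) + 23 * (1 / 46)\<^sup>2) - (- real n / 368))"
  proof (rule Chernoff_rows[where h = "\<lambda>x. - (1 / 46) * (\<Sum>k<p. u' k * x k)\<^sup>2"])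
    show "(\<lambda>x. - (1 / 46) * (\<Sum>k<p. u' k * x k)\<^sup>2) \<in> borel_measurable row_space"
      using lincomb_fun_measurable[of u'] by measurable
    fix r assume r: "r < n"
    show "- (1 / 46) * (\<Sum>k<p. u' k * random_vec {..<p} (D r) \<omega> k)\<^sup>2 = - (1 / 46) * (lincomb p (D r) u' \<omega>)\<^sup>2" for \<omega>
      by (simp add: random_vec_def lincomb_def)
    show "(\<integral>\<^sup>+\<omega>. ennreal (exp (- (1 / 46) * (lincomb p (D r) u' \<omega>)\<^sup>2)) \<partial>M) \<le> ennreal (exp (- (1 / 46) + 23 * (1 / 46)\<^sup>2))"
      by (rule normal_vector.negative_square_mgf[OF row[OF r] u']) simp
  qed
  also have "\<dots> \<le> exp (- real n / 200)" by (simp add: power2_eq_square)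
  finally show ?thesis unfolding iff \<sigma>_def .
qed

lemma emp_cross_large:
  assumes u: "popq u u \<le> 16" and w: "popq w w \<le> 1" and orth: "popq u w = 0" and y: "0 \<le> y" "y \<le> 20"
  shows "prob {\<omega> \<in> space M. y \<le> \<bar>empq \<omega> u w\<bar>} \<le> 2 * exp (- real n * y\<^sup>2 / 2624)"
proof -
  define u' where "u' = (\<lambda>k. (1 / 4) * u k)"
  have u': "popq u' u' \<le> 1" "popq u' w = 0"
    using u orth unfolding u'_def qform_scale_left qform_scale_right by auto
  have one: "prob {\<omega> \<in> space M. y \<le> s * empq \<omega> u w} \<le> exp (- real n * y\<^sup>2 / 2624)" if s: "s = 1 \<or> s = - 1" for s
  proof (cases "y = 0")
    case False
    \<comment> \<open>\<open>y / 328\<close> minimises \<open>41 * t\<^sup>2 - t * y / 4\<close>.\<close>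
    define t where "t = s * (y / 328)"
    have t: "\<bar>t\<bar> \<le> 1 / 16" "t\<^sup>2 = (y / 328)\<^sup>2" using s y by (auto simp: t_def)
    have iff: "real n * (y / 328) * (y / 4) \<le> (\<Sum>r<n. t * (lincomb p (D r) u' \<omega> * lincomb p (D r) w \<omega>))
        \<longleftrightarrow> y \<le> s * empq \<omega> u w" for \<omega>
    proof -
      have "(\<Sum>r<n. t * (lincomb p (D r) u' \<omega> * lincomb p (D r) w \<omega>)) = t * (real n * empq \<omega> u' w)"
        unfolding sum_distrib_left[symmetric] using n by (simp add: empq_eq)
      also have "\<dots> = (real n * (y / 328) / 4) * (s * empq \<omega> u w)"
        unfolding u'_def qform_scale_left t_def by simp
      finally have e: "(\<Sum>r<n. t * (lincomb p (D r) u' \<omega> * lincomb p (D r) w \<omega>))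
          = (real n * (y / 328) / 4) * (s * empq \<omega> u w)" .
      have pos: "0 < real n * (y / 328) / 4" using n y False by simp
      have "real n * (y / 328) * (y / 4) = (real n * (y / 328) / 4) * y" by simp
      then show ?thesis unfolding e using mult_le_cancel_left_pos[OF pos] by metis
    qed
    have "prob {\<omega> \<in> space M. real n * (y / 328) * (y / 4) \<le> (\<Sum>r<n. t * (lincomb p (D r) u' \<omega> * lincomb p (D r) w \<omega>))}
        \<le> exp (real n * (41 * t\<^sup>2) - real n * (y / 328) * (y / 4))"
    proof (rule Chernoff_rows[where h = "\<lambda>x. t * ((\<Sum>k<p. u' k * x k) * (\<Sum>k<p. w k * x k))"])
      show "(\<lambda>x. t * ((\<Sum>k<p. u' k * x k) * (\<Sum>k<p. w k * x k)))
          \<in> borel_measurable row_space"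
        using lincomb_fun_measurable[of u'] lincomb_fun_measurable[of w] by measurable
      fix r assume r: "r < n"
      show "t * ((\<Sum>k<p. u' k * random_vec {..<p} (D r) \<omega> k) * (\<Sum>k<p. w k * random_vec {..<p} (D r) \<omega> k))
          = t * (lincomb p (D r) u' \<omega> * lincomb p (D r) w \<omega>)" for \<omega>
        by (simp add: random_vec_def lincomb_def)
      show "(\<integral>\<^sup>+\<omega>. ennreal (exp (t * (lincomb p (D r) u' \<omega> * lincomb p (D r) w \<omega>))) \<partial>M) \<le> ennreal (exp (41 * t\<^sup>2))"
        by (rule normal_vector.product_mgf[OF row[OF r] u'(1) w u'(2) t(1)])
    qed
    also have "real n * (41 * t\<^sup>2) - real n * (y / 328) * (y / 4) = - real n * y\<^sup>2 / 2624"
      unfolding t(2) by (simp add: power2_eq_square)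
    finally show ?thesis unfolding iff .
  qed simp
  have "prob {\<omega> \<in> space M. y \<le> \<bar>empq \<omega> u w\<bar>}
      \<le> prob ({\<omega> \<in> space M. y \<le> 1 * empq \<omega> u w} \<union> {\<omega> \<in> space M. y \<le> - 1 * empq \<omega> u w})"
    by (intro finite_measure_mono) (auto simp: abs_if split: if_splits)
  also have "\<dots> \<le> prob {\<omega> \<in> space M. y \<le> 1 * empq \<omega> u w} + prob {\<omega> \<in> space M. y \<le> - 1 * empq \<omega> u w}"
    by (intro measure_Un_le) measurable
  also have "\<dots> \<le> 2 * exp (- real n * y\<^sup>2 / 2624)" using one[of 1] one[of "- 1"] by simp
  finally show ?thesis .
qed

end

section \<open>Uniform near-orthogonality\<close>

definition coeff_grid :: "nat set \<Rightarrow> real \<Rightarrow> nat \<Rightarrow> (nat \<Rightarrow> real) set" where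
  "coeff_grid T h L = (\<lambda>z k. if k \<in> T then h * real_of_int (z k) else 0) ` (PiE T (\<lambda>_. {- int L..int L}))"

lemma finite_coeff_grid: "finite T \<Longrightarrow> finite (coeff_grid T h L)"
  by (simp add: coeff_grid_def finite_PiE)

lemma card_coeff_grid:
  assumes "finite T"
  shows "card (coeff_grid T h L) \<le> (2 * L + 1) ^ card T"
proof -
  have "card (coeff_grid T h L) \<le> card (PiE T (\<lambda>_. {- int L..int L}))"
    unfolding coeff_grid_def using assms by (intro card_image_le finite_PiE) auto
  also have "\<dots> = (2 * L + 1) ^ card T" using assms by (simp add: card_PiE nat_add_distrib nat_mult_distrib)
  finally show ?thesis .
qed

lemma coeff_grid_supported: "g \<in> coeff_grid T h L \<Longrightarrow> supported T g"
  by (auto simp: coeff_grid_def supported_def)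

lemma coeff_grid_approx:
  assumes h: "0 < h" and \<beta>: "supported T \<beta>" "\<And>k. \<bar>\<beta> k\<bar> \<le> R" and L: "R / h \<le> real L"
  obtains g where "g \<in> coeff_grid T h L" "\<And>k. \<bar>\<beta> k - g k\<bar> \<le> h"
proof
  define z where "z = (\<lambda>k. if k \<in> T then \<lfloor>\<beta> k / h\<rfloor> else undefined)"
  define g where "g = (\<lambda>k. if k \<in> T then h * real_of_int (z k) else 0)"
  have "z \<in> PiE T (\<lambda>_. {- int L..int L})"
  proof (rule PiE_I)
    fix k assume k: "k \<in> T"
    have "\<bar>\<beta> k / h\<bar> \<le> R / h" using h \<beta>(2)[of k] by (simp add: abs_divide divide_right_mono)
    then have "\<bar>\<beta> k / h\<bar> \<le> real L" using L by linarith
    then have "- real L \<le> \<beta> k / h" "\<beta> k / h \<le> real L" by linarith+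
    then show "z k \<in> {- int L..int L}" using k by (auto simp: z_def le_floor_iff floor_le_iff)
  qed (simp add: z_def)
  then show "g \<in> coeff_grid T h L" unfolding coeff_grid_def g_def by (rule imageI)
  show "\<bar>\<beta> k - g k\<bar> \<le> h" for k
  proof (cases "k \<in> T")
    case True
    have fl: "real_of_int \<lfloor>\<beta> k / h\<rfloor> \<le> \<beta> k / h" "\<beta> k / h \<le> real_of_int \<lfloor>\<beta> k / h\<rfloor> + 1" by linarith+
    have "h * real_of_int \<lfloor>\<beta> k / h\<rfloor> \<le> h * (\<beta> k / h)" "h * (\<beta> k / h) \<le> h * (real_of_int \<lfloor>\<beta> k / h\<rfloor> + 1)"
      using fl h by (intro mult_left_mono; simp)+
    then show ?thesis using True h by (simp add: g_def z_def algebra_simps abs_le_iff)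
  next
    case False then show ?thesis using \<beta>(1) h by (simp add: g_def supported_def)
  qed
qed

context iid_normal_rows
begin

text \<open>The Bernstein bound holds for each single \<open>\<beta>\<close>; a grid makes it uniform. The supports have few
  nodes, so the grid has few points. Bernstein's bound needs a bound on the true variance of \<open>\<beta>\<close>, whereas
  only the empirical one is controlled: a grid point of large variance would have to have a much smaller
  empirical variance, which is exponentially unlikely.\<close>

lemma near_orthogonality:
  assumes T: "T \<subseteq> {..<p}" "card T \<le> m" and m: "1 \<le> m"
    and w: "popq w w \<le> 1" and orth: "\<And>\<beta>. supported T \<beta> \<Longrightarrow> popq \<beta> w = 0"
    and y: "0 < y" "y \<le> 1" and L: "R * (8 * real m) / y \<le> real L"
  obtains B where "B \<in> sets M"
    and "prob B \<le> real (2 * L + 1) ^ m * (2 * exp (- real n * y\<^sup>2 / 10496))"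
    and "\<And>\<omega> \<beta>. \<omega> \<in> space M - B \<Longrightarrow> (\<And>k. k \<in> T \<Longrightarrow> empq \<omega> (unit_coeff k) (unit_coeff k) \<le> 4) \<Longrightarrow>
      empq \<omega> w w \<le> 4 \<Longrightarrow> supported T \<beta> \<Longrightarrow> (\<And>k. \<bar>\<beta> k\<bar> \<le> R) \<Longrightarrow> empq \<omega> \<beta> \<beta> \<le> 1 \<Longrightarrow> \<bar>empq \<omega> \<beta> w\<bar> \<le> y"
proof -
  have finT: "finite T" using T finite_subset by blast
  \<comment> \<open>With this mesh a grid point is within empirical distance \<open>2 * m * h = y / 4\<close> of \<open>\<beta>\<close>, as all
    nodes have empirical second moment at most \<open>4\<close>.\<close>
  define h where "h = y / (8 * real m)"
  have h: "0 < h" using y m by (simp add: h_def)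
  define G where "G = coeff_grid T h L"
  have finG: "finite G" by (simp add: G_def finite_coeff_grid finT)
  have "(2 * L + 1) ^ card T \<le> (2 * L + 1) ^ m" by (rule power_increasing) (use T in auto)
  then have "card G \<le> (2 * L + 1) ^ m" using card_coeff_grid[OF finT, of h L] by (simp add: G_def)
  then have cardG: "real (card G) \<le> real (2 * L + 1) ^ m" unfolding of_nat_power[symmetric] by (rule of_nat_mono)
  define bad where "bad g = (if popq g g \<le> 16 then {\<omega> \<in> space M. y / 2 \<le> \<bar>empq \<omega> g w\<bar>}
      else {\<omega> \<in> space M. empq \<omega> g g \<le> popq g g / 8})" for g
  have bad_sets: "bad g \<in> sets M" for g unfolding bad_def by auto
  have bad_prob: "prob (bad g) \<le> 2 * exp (- real n * y\<^sup>2 / 10496)" if g: "g \<in> G" for g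
  proof (cases "popq g g \<le> 16")
    case True
    have "popq g w = 0" using orth coeff_grid_supported g by (auto simp: G_def)
    then have "prob {\<omega> \<in> space M. y / 2 \<le> \<bar>empq \<omega> g w\<bar>} \<le> 2 * exp (- real n * (y / 2)\<^sup>2 / 2624)"
      using True w y by (intro emp_cross_large) auto
    then show ?thesis using True by (simp add: bad_def power_divide)
  next
    case False
    then have "prob {\<omega> \<in> space M. empq \<omega> g g \<le> popq g g / 8} \<le> exp (- real n / 200)"
      by (intro emp_small) auto
    also have "\<dots> \<le> exp (- real n * y\<^sup>2 / 10496)"
    proof -
      have "y\<^sup>2 \<le> 1" using y by (simp add: power_le_one)
      then have "real n * y\<^sup>2 \<le> real n * 1" by (intro mult_left_mono) auto
      then show ?thesis by simp
    qed
    also have "\<dots> \<le> 2 * exp (- real n * y\<^sup>2 / 10496)" by simp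
    finally show ?thesis using False by (simp add: bad_def)
  qed
  define B where "B = (\<Union>g\<in>G. bad g)"
  have B: "B \<in> sets M" unfolding B_def using finG bad_sets by auto
  have "prob B \<le> (\<Sum>g\<in>G. prob (bad g))"
    unfolding B_def using finG bad_sets by (intro measure_UNION_le) auto
  also have "\<dots> \<le> (\<Sum>g\<in>G. 2 * exp (- real n * y\<^sup>2 / 10496))" by (intro sum_mono bad_prob)
  also have "\<dots> = real (card G) * (2 * exp (- real n * y\<^sup>2 / 10496))" by simp
  also have "\<dots> \<le> real (2 * L + 1) ^ m * (2 * exp (- real n * y\<^sup>2 / 10496))"
    using cardG by (intro mult_right_mono) auto
  finally have pB: "prob B \<le> real (2 * L + 1) ^ m * (2 * exp (- real n * y\<^sup>2 / 10496))" .
  have good: "\<bar>empq \<omega> \<beta> w\<bar> \<le> y"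
    if \<omega>: "\<omega> \<in> space M - B" and diag: "\<And>k. k \<in> T \<Longrightarrow> empq \<omega> (unit_coeff k) (unit_coeff k) \<le> 4"
      and ww: "empq \<omega> w w \<le> 4" and \<beta>: "supported T \<beta>" "\<And>k. \<bar>\<beta> k\<bar> \<le> R" and \<beta>\<beta>: "empq \<omega> \<beta> \<beta> \<le> 1" for \<omega> \<beta>
  proof -
    interpret e: psd_form p "emp \<omega>" by (rule psd_emp)
    have "R / h \<le> real L" using L y m by (simp add: h_def)
    then obtain g where g: "g \<in> coeff_grid T h L" and close: "\<And>k. \<bar>\<beta> k - g k\<bar> \<le> h"
      using coeff_grid_approx[OF h \<beta>] by blast
    have notbad: "\<omega> \<notin> bad g" using g \<omega> by (auto simp: B_def G_def)
    define d where "d = (\<lambda>k. \<beta> k - g k)"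
    have ds: "supported T d" using \<beta>(1) coeff_grid_supported[OF g] by (auto simp: d_def supported_def)
    have "sqrt (e.q d d) \<le> 2 * (\<Sum>k\<in>T. \<bar>d k\<bar>)"
      by (rule e.sqrt_q_le_sum[OF ds T(1)]) (use diag in auto)
    also have "\<dots> \<le> 2 * (\<Sum>k\<in>T. h)" using close by (intro mult_left_mono sum_mono) (auto simp: d_def)
    also have "\<dots> \<le> 2 * (real m * h)" using T(2) h by (simp add: mult_right_mono)
    also have "\<dots> = y / 4" using m by (simp add: h_def)
    finally have dd: "sqrt (e.q d d) \<le> y / 4" .
    have "sqrt (e.q w w) \<le> 2" using ww by (simp add: real_le_lsqrt)
    then have "sqrt (e.q d d) * sqrt (e.q w w) \<le> y / 4 * 2"
      using dd y e.nonneg[of w] by (intro mult_mono) auto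
    then have dw: "\<bar>e.q d w\<bar> \<le> y / 2" using e.Cauchy_Schwarz_sqrt[of d w] by linarith
    have "sqrt (e.q g g) \<le> sqrt (e.q \<beta> \<beta>) + sqrt (e.q d d)"
      using e.triangle_diff[of \<beta> d] by (simp add: d_def)
    moreover have "sqrt (e.q \<beta> \<beta>) \<le> 1" using \<beta>\<beta> by simp
    ultimately have "sqrt (e.q g g) \<le> 5 / 4" using dd y by linarith
    then have "(sqrt (e.q g g))\<^sup>2 \<le> (5 / 4)\<^sup>2" using e.nonneg[of g] by (intro power_mono) auto
    then have gg: "e.q g g < 2" using e.nonneg[of g] by (simp add: power2_eq_square)
    have gw: "\<bar>e.q g w\<bar> < y / 2"
      using notbad gg \<omega> by (auto simp: bad_def split: if_splits)
    have "e.q \<beta> w = e.q g w + e.q d w"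
      unfolding d_def qform_diff_left by simp
    then show ?thesis using gw dw by linarith
  qed
  show thesis by (rule that[OF B pB good])
qed

end

section \<open>Failure probability at a fixed sample size\<close>

locale gaussian_sample = gaussian_graph M p S X v + iid_normal_rows M p n S D
  for M :: "'w measure" and p S X v n D
begin

lemma is_lasso_iff:
  assumes a: "a < p"
  shows "is_lasso n p (\<lambda>i k. D i k \<omega>) a l \<theta>
    \<longleftrightarrow> is_arg_min (psd_form.lasso_obj p (emp \<omega>) a l) (supported ({..<p} - {a})) \<theta>"
proof -
  interpret e: psd_form p "emp \<omega>" by (rule psd_emp)
  have "(L2_set (\<lambda>i. D i a \<omega> - (\<Sum>k<p. D i k \<omega> * \<theta> k)) {..<n})\<^sup>2 / real n + l * norm1 p \<theta> = e.lasso_obj a l \<theta>" for \<theta>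
  proof -
    have "(L2_set (\<lambda>i. D i a \<omega> - (\<Sum>k<p. D i k \<omega> * \<theta> k)) {..<n})\<^sup>2
        = (\<Sum>i<n. (D i a \<omega> - (\<Sum>k<p. D i k \<omega> * \<theta> k))\<^sup>2)"
      by (simp add: L2_set_def sum_nonneg)
    also have "\<dots> = (\<Sum>i<n. (lincomb p (D i) (residual a \<theta>) \<omega>)\<^sup>2)"
      using a by (simp add: residual_def lincomb_diff lincomb_unit) (simp add: lincomb_def mult.commute)
    also have "\<dots> = real n * empq \<omega> (residual a \<theta>) (residual a \<theta>)" by (simp add: empq_sq)
    finally show ?thesis using n by (simp add: e.lasso_obj_def)
  qed
  moreover have "(\<theta> a = 0 \<and> (\<forall>k\<ge>p. \<theta> k = 0)) \<longleftrightarrow> supported ({..<p} - {a}) \<theta>" for \<theta>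
    by (auto simp: supported_def)
  ultimately show ?thesis by (simp add: is_lasso_def)
qed

text \<open>Outside \<open>B\<close> the empirical form satisfies the hypotheses of \<open>lasso_design\<close>. For each of the \<open>p\<close>
  nodes, \<open>B\<close> collects three bad events for the empirical second moments of the node and its residual, and
  one from \<open>near_orthogonality\<close>; the last one dominates. The radius \<open>R\<close> bounds all coefficient vectors to which
  near-orthogonality is applied, since a restricted Lasso solution is bounded by \<open>4 / l\<close>.\<close>

lemma lasso_failure_probability:
  fixes l \<rho> Th s1 :: real and m L a :: nat
  defines "N \<equiv> nbh a"
  defines "R \<equiv> (1 + 1 / \<bar>v\<bar> + 4 / l) * (1 + Th)"
  assumes a: "a < p" and l: "0 < l" and \<rho>: "0 < \<rho>" and Th: "0 \<le> Th"
    and t_norm: "\<And>k. k \<in> N \<Longrightarrow> norm1 p (regress k (N - {k})) \<le> Th"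
    and gap: "\<And>k. k \<in> N \<Longrightarrow> 8 / v\<^sup>2 * ((1 + Th) / 2 + 8 * \<rho>) * l < \<bar>regress a N k\<bar>"
    and small: "\<rho> * l \<le> v\<^sup>2 / 16" "\<rho> * l \<le> 1 / 2"
    and incoherent: "\<And>k. k < p \<Longrightarrow> k \<noteq> a \<Longrightarrow> k \<notin> N \<Longrightarrow> \<bar>S_sum M p X a k\<bar> < s1"
    and s1: "4 * \<rho> \<le> 1 - s1"
    and m: "card N + 1 \<le> m" and L: "R * (8 * real m) / (\<rho> * l) \<le> real L"
  obtains B where "B \<in> sets M"
    and "prob B \<le> 5 * real p * real (2 * L + 1) ^ m * exp (- real n * (\<rho> * l)\<^sup>2 / 10496)"
    and "\<And>\<omega> \<theta>. \<omega> \<in> space M - B \<Longrightarrow> is_lasso n p (\<lambda>i k. D i k \<omega>) a l \<theta> \<Longrightarrow> N \<subseteq> est_ne p \<theta>"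
proof -
  define y where "y = \<rho> * l"
  have y: "0 < y" "y \<le> 1" using l \<rho> small by (auto simp: y_def)
  define t where "t = (\<lambda>k. regress k (N - {k}))"
  define w where "w = (\<lambda>k. residual k (t k))"
  have N: "N \<subseteq> {..<p} - {a}" "N \<subseteq> {..<p}" using nbh_subset by (auto simp: N_def)
  have finN: "finite N" using N(2) finite_subset by blast
  have Na: "N - {a} = N" using N by auto
  define E where "E = exp (- real n * y\<^sup>2 / 10496)"
  have Nk: "N - {k} \<subseteq> {..<p}" for k using N by auto
  have ww1: "popq (w k) (w k) \<le> 1" and wwv: "v\<^sup>2 \<le> popq (w k) (w k)" if "k < p" for k
    using regress_residual_le[OF that Nk] regress_residual_ge[OF that Nk] by (auto simp: w_def t_def)
  define B1 where "B1 k = {\<omega> \<in> space M. 4 \<le> empq \<omega> (unit_coeff k) (unit_coeff k)}" for k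
  define B2 where "B2 k = {\<omega> \<in> space M. 4 \<le> empq \<omega> (w k) (w k)}" for k
  define B3 where "B3 k = {\<omega> \<in> space M. empq \<omega> (w k) (w k) \<le> popq (w k) (w k) / 8}" for k
  have Bsets: "B1 k \<in> sets M" "B2 k \<in> sets M" "B3 k \<in> sets M" for k
    by (auto simp: B1_def B2_def B3_def)
  have yn: "real n * y\<^sup>2 \<le> real n"
    using y mult_left_mono[of "y\<^sup>2" 1 "real n"] by (simp add: power_le_one)
  have Bprob: "prob (B1 k) \<le> E" "prob (B2 k) \<le> E" "prob (B3 k) \<le> E" if k: "k < p" for k
  proof -
    have E1: "exp (- real n / 2) \<le> E" and E2: "exp (- real n / 200) \<le> E" using yn by (auto simp: E_def)
    show "prob (B1 k) \<le> E"
      using emp_large[of "unit_coeff k"] cov1[OF k] k E1 by (simp add: B1_def qform_unit_unit)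
    show "prob (B2 k) \<le> E" using emp_large[OF ww1[OF k]] E1 by (simp add: B2_def)
    have "0 < v\<^sup>2" using v by simp
    then have "0 < popq (w k) (w k)" using wwv[OF k] by linarith
    then show "prob (B3 k) \<le> E" using emp_small[of "w k"] E2 by (simp add: B3_def)
  qed
  have "\<forall>k. \<exists>B. k < p \<longrightarrow> B \<in> sets M \<and> prob B \<le> real (2 * L + 1) ^ m * (2 * E) \<and>
      (\<forall>\<omega> \<beta>. \<omega> \<in> space M - B \<longrightarrow> (\<forall>j \<in> orth_nodes a N k. empq \<omega> (unit_coeff j) (unit_coeff j) \<le> 4) \<longrightarrow>
        empq \<omega> (w k) (w k) \<le> 4 \<longrightarrow> supported (orth_nodes a N k) \<beta> \<longrightarrow> (\<forall>j. \<bar>\<beta> j\<bar> \<le> R) \<longrightarrow>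
        empq \<omega> \<beta> \<beta> \<le> 1 \<longrightarrow> \<bar>empq \<omega> \<beta> (w k)\<bar> \<le> y)" (is "\<forall>k. \<exists>B. k < p \<longrightarrow> ?good k B")
  proof (intro allI)
    fix k
    show "\<exists>B. k < p \<longrightarrow> ?good k B"
    proof (cases "k < p")
      case True
      have T: "orth_nodes a N k \<subseteq> {..<p}" using N a by (auto simp: orth_nodes_def)
      have "card (orth_nodes a N k) \<le> card (insert a N)"
        using finN by (intro card_mono) (auto simp: orth_nodes_def)
      also have "\<dots> \<le> m" using m card_insert_le_m1[of "card N + 1" N a] finN by (simp add: card_insert_if)
      finally have cT: "card (orth_nodes a N k) \<le> m" .
      have orth: "popq \<beta> (w k) = 0" if "supported (orth_nodes a N k) \<beta>" for \<beta>
        using residual_orthogonal[OF a True, of \<beta>] that by (simp add: w_def t_def N_def)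
      have m1: "1 \<le> m" using m by simp
      show ?thesis
        by (rule near_orthogonality[OF T cT m1 ww1[OF True] orth y L[folded y_def]])
           (auto simp: E_def)
    qed simp
  qed
  then obtain B4 where B4: "\<And>k. k < p \<Longrightarrow> B4 k \<in> sets M"
      "\<And>k. k < p \<Longrightarrow> prob (B4 k) \<le> real (2 * L + 1) ^ m * (2 * E)"
      "\<And>k \<omega> \<beta>. k < p \<Longrightarrow> \<omega> \<in> space M - B4 k \<Longrightarrow>
        (\<And>j. j \<in> orth_nodes a N k \<Longrightarrow> empq \<omega> (unit_coeff j) (unit_coeff j) \<le> 4) \<Longrightarrow>
        empq \<omega> (w k) (w k) \<le> 4 \<Longrightarrow> supported (orth_nodes a N k) \<beta> \<Longrightarrow> (\<And>j. \<bar>\<beta> j\<bar> \<le> R) \<Longrightarrow>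
        empq \<omega> \<beta> \<beta> \<le> 1 \<Longrightarrow> \<bar>empq \<omega> \<beta> (w k)\<bar> \<le> y"
    by metis
  define U where "U k = (B1 k \<union> B2 k) \<union> (B3 k \<union> B4 k)" for k
  define B where "B = (\<Union>k<p. U k)"
  have Bk: "U k \<in> sets M" if "k < p" for k using Bsets B4(1)[OF that] by (auto simp: U_def)
  have B: "B \<in> sets M" unfolding B_def using Bk by auto
  have pB: "prob B \<le> 5 * real p * real (2 * L + 1) ^ m * E"
  proof -
    have E0: "0 \<le> E" by (simp add: E_def)
    have "prob B \<le> (\<Sum>k<p. prob (U k))"
      unfolding B_def using Bk by (intro measure_UNION_le) auto
    also have "\<dots> \<le> (\<Sum>k<p. 5 * real (2 * L + 1) ^ m * E)"
    proof (rule sum_mono)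
      fix k assume "k \<in> {..<p}"
      then have k: "k < p" by simp
      have "prob (U k) \<le> prob (B1 k \<union> B2 k) + prob (B3 k \<union> B4 k)"
        unfolding U_def using Bsets B4(1)[OF k] by (intro measure_Un_le) auto
      also have "\<dots> \<le> (prob (B1 k) + prob (B2 k)) + (prob (B3 k) + prob (B4 k))"
        using Bsets B4(1)[OF k] by (intro add_mono measure_Un_le) auto
      also have "\<dots> \<le> 3 * E + real (2 * L + 1) ^ m * (2 * E)"
        using Bprob[OF k] B4(2)[OF k] by linarith
      also have "3 * E \<le> 3 * (real (2 * L + 1) ^ m * E)"
        using mult_right_mono[OF one_le_power[of "real (2 * L + 1)" m] E0] by simp
      finally show "prob (U k) \<le> 5 * real (2 * L + 1) ^ m * E" by (simp add: mult_ac)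
    qed
    also have "\<dots> = 5 * real p * real (2 * L + 1) ^ m * E" by simp
    finally show ?thesis .
  qed
  have good: "N \<subseteq> est_ne p \<theta>" if \<omega>: "\<omega> \<in> space M - B" and \<theta>: "is_lasso n p (\<lambda>i k. D i k \<omega>) a l \<theta>" for \<omega> \<theta>
  proof -
    have nb: "\<omega> \<in> space M" "\<omega> \<notin> B1 k" "\<omega> \<notin> B2 k" "\<omega> \<notin> B3 k" "\<omega> \<notin> B4 k" if "k < p" for k
      using \<omega> that by (auto simp: B_def U_def)
    have d4: "empq \<omega> (unit_coeff k) (unit_coeff k) \<le> 4" and w4: "empq \<omega> (w k) (w k) \<le> 4"
      and w8: "popq (w k) (w k) / 8 \<le> empq \<omega> (w k) (w k)" if "k < p" for k
      using nb[OF that] by (auto simp: B1_def B2_def B3_def)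
    interpret e: lasso_design p "emp \<omega>" a N t l \<rho> "\<bar>v\<bar>" Th "1 / \<bar>v\<bar>" R s1
    proof (intro lasso_design.intro lasso_design_axioms.intro psd_emp)
      show "supported (N - {k}) (t k)" if "k < p" for k
        using regress_supported[OF that Nk] by (simp add: t_def)
      show "empq \<omega> (residual k (t k)) (residual k (t k)) \<le> 4" if "k \<in> insert a N" for k
        using w4[of k] that a N by (auto simp: w_def)
      show "\<bar>v\<bar>\<^sup>2 / 8 \<le> empq \<omega> (residual k (t k)) (residual k (t k))" if "k \<in> N" for k
        using w8[of k] wwv[of k] that N by (auto simp: w_def)
      show "\<bar>empq \<omega> \<beta> (residual k (t k))\<bar> \<le> \<rho> * l"
        if "k < p" "supported (orth_nodes a N k) \<beta>" "\<And>j. \<bar>\<beta> j\<bar> \<le> R" "empq \<omega> \<beta> \<beta> \<le> 1" for k \<beta>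
      proof -
        have "j < p" if "j \<in> orth_nodes a N k" for j using that N a by (auto simp: orth_nodes_def split: if_splits)
        then show ?thesis
          using B4(3)[OF that(1) _ d4 w4[OF that(1)] that(2,3,4)] nb[OF that(1)] by (auto simp: w_def y_def)
      qed
      show "(\<Sum>j\<in>N - {k}. \<bar>t k j\<bar>) \<le> Th" if "k \<in> N" for k
      proof -
        have "(\<Sum>j\<in>N - {k}. \<bar>t k j\<bar>) \<le> norm1 p (t k)"
          unfolding norm1_def using Nk by (intro sum_mono2) auto
        then show ?thesis using t_norm[OF that] by (simp add: t_def)
      qed
      show "\<bar>t a k\<bar> \<le> 1 / \<bar>v\<bar>" if "k \<in> N" for k
      proof -
        have kp: "k < p" "k \<noteq> a" using that N by auto
        have "\<bar>w a k\<bar> \<le> 1 / \<bar>v\<bar>" by (rule abs_le_of_q_le_1[OF kp(1) ww1[OF a]])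
        then show ?thesis using kp by (simp add: w_def residual_def unit_coeff_def)
      qed
      show "(1 + 1 / \<bar>v\<bar> + 4 / l) * (1 + Th) \<le> R" by (simp add: R_def)
      show "8 / \<bar>v\<bar>\<^sup>2 * ((1 + Th) / 2 + 8 * \<rho>) * l < \<bar>t a k\<bar>" if "k \<in> N" for k
        using gap[OF that] by (simp add: t_def Na)
      show "\<bar>\<Sum>j\<in>N. sgn (t a j) * t k j\<bar> < s1" if "k < p" "k \<noteq> a" "k \<notin> N" for k
        using incoherent[OF that] that(3) by (simp add: S_sum_def t_def Na flip: N_def)
    qed (use a N l \<rho> Th v small s1 d4 in auto)
    have "is_arg_min (e.lasso_obj a l) (supported ({..<p} - {a})) \<theta>"
      using \<theta> is_lasso_iff[OF a] by simp
    then have "\<theta> b \<noteq> 0" if "b \<in> N" for b using e.lasso_detects_neighbours that by blast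
    then show ?thesis using N by (auto simp: est_ne_def)
  qed
  show thesis by (rule that[OF B pB[unfolded E_def y_def] good])
qed

end

section \<open>Growth rates and the theorem\<close>

lemma eventually_powr_neg_less:
  fixes K s e :: real
  assumes "0 < s" "0 < e"
  shows "\<forall>\<^sub>F n in sequentially. K * real n powr (- s) < e"
proof -
  have "(\<lambda>n. K * real n powr (- s)) \<longlonglongrightarrow> K * 0"
    by (intro tendsto_mult tendsto_const tendsto_neg_powr filterlim_real_sequentially) (use assms in auto)
  then show ?thesis using order_tendstoD(2)[of _ 0 sequentially e] assms by simp
qed

text \<open>A neighbourhood has order \<open>n powr \<kappa>\<close> nodes, so the logarithm of the number of events in the union
  bound is of order \<open>n powr \<kappa> * ln n\<close>; this is where \<open>\<kappa> < \<epsilon>\<close> is used.\<close>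

lemma union_bound_dominated:
  fixes \<kappa> \<epsilon> \<gamma> c0 Cp Ck :: real
  assumes \<kappa>: "0 \<le> \<kappa>" "\<kappa> < \<epsilon>" and c0: "0 < c0" and C: "0 < Cp" "0 < Ck"
  shows "\<forall>\<^sub>F n in sequentially.
    5 * (Cp * real n powr \<gamma>) * (real n ^ 3) ^ (nat \<lceil>Ck * real n powr \<kappa>\<rceil> + 1) * exp (- (c0 * real n powr \<epsilon>))
      \<le> exp (- (c0 / 2 * real n powr \<epsilon>))"
proof -
  define \<mu> where "\<mu> = (\<kappa> + \<epsilon>) / 2"
  have \<mu>: "0 < \<mu>" "\<mu> < \<epsilon>" "\<kappa> \<le> \<mu>" using \<kappa> by (auto simp: \<mu>_def)
  have e0: "0 < \<epsilon>" using \<kappa> by simp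
  have "\<forall>\<^sub>F n in sequentially. ln (5 * Cp) + \<gamma> * ln (real n) + 3 * (Ck * real n powr \<mu> + 2) * ln (real n)
      \<le> c0 / 2 * real n powr \<epsilon>"
    using \<mu>(1,2) e0 c0 C by real_asymp
  then show ?thesis
    using eventually_ge_at_top[of "1::nat"]
  proof eventually_elim
    case (elim n)
    then have n: "1 \<le> real n" "0 < real n" "0 \<le> ln (real n)" by auto
    define m where "m = nat \<lceil>Ck * real n powr \<kappa>\<rceil> + 1"
    have "real m \<le> Ck * real n powr \<kappa> + 2"
      using C n by (simp add: m_def) linarith
    also have "\<dots> \<le> Ck * real n powr \<mu> + 2"
      using C n \<mu> by (intro add_right_mono mult_left_mono powr_mono) auto
    finally have m: "real m \<le> Ck * real n powr \<mu> + 2" .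
    have "(real n ^ 3) ^ m = exp (ln ((real n ^ 3) ^ m))" using n by simp
    also have "ln ((real n ^ 3) ^ m) = 3 * real m * ln (real n)"
      using n by (simp add: ln_realpow power_mult[symmetric])
    finally have P: "(real n ^ 3) ^ m = exp (3 * real m * ln (real n))" .
    have "5 * (Cp * real n powr \<gamma>) = exp (ln (5 * Cp) + \<gamma> * ln (real n))"
      using C n by (simp add: exp_add powr_def)
    then have "5 * (Cp * real n powr \<gamma>) * (real n ^ 3) ^ m * exp (- (c0 * real n powr \<epsilon>))
        = exp (ln (5 * Cp) + \<gamma> * ln (real n) + 3 * real m * ln (real n) + - (c0 * real n powr \<epsilon>))"
      by (simp only: P exp_add)
    also have "\<dots> \<le> exp (- (c0 / 2 * real n powr \<epsilon>))"
    proof -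
      have "3 * real m * ln (real n) \<le> 3 * (Ck * real n powr \<mu> + 2) * ln (real n)"
        using m n by (intro mult_right_mono) auto
      then show ?thesis using elim(1) by simp
    qed
    finally show ?case by (simp add: m_def)
  qed
qed

lemma exponential_boundI:
  fixes f :: "nat \<Rightarrow> nat \<Rightarrow> real" and c C \<epsilon> :: real
  assumes "\<forall>\<^sub>F n in sequentially. \<forall>a<p n. f n a \<le> C * exp (- c * real n powr \<epsilon>)" "0 < c"
  shows "\<exists>c>0. \<exists>C. \<forall>\<^sub>F n in sequentially. \<forall>a<p n. f n a \<le> C * exp (- c * real n powr \<epsilon>)"
  by (rule exI[where x = c], rule conjI[OF assms(2)], rule exI[where x = C], rule assms(1))

theorem theorem2:
  fixes p :: "nat \<Rightarrow> nat"
    and \<Sigma> :: "nat \<Rightarrow> real mat"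
    and M :: "nat \<Rightarrow> 'w measure"
    and X :: "nat \<Rightarrow> nat \<Rightarrow> 'w \<Rightarrow> real"
    and D :: "nat \<Rightarrow> nat \<Rightarrow> nat \<Rightarrow> 'w \<Rightarrow> real"
    and lam :: "nat \<Rightarrow> real"
    and th :: "nat \<Rightarrow> nat \<Rightarrow> 'w \<Rightarrow> nat \<Rightarrow> real"
    and \<gamma> v \<kappa> vartheta \<delta> \<xi> \<delta>' d \<epsilon> :: real
  assumes prob: "\<And>n. n \<ge> 1 \<Longrightarrow> prob_space (M n)"
    and normal: "\<And>n. n \<ge> 1 \<Longrightarrow> multivariate_normal (M n) (p n) (\<Sigma> n) (X n)"
    and rows_normal: "\<And>n i. n \<ge> 1 \<Longrightarrow> i < n \<Longrightarrow>
          multivariate_normal (M n) (p n) (\<Sigma> n) (D n i)"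
    and rows_indep: "\<And>n. n \<ge> 1 \<Longrightarrow>
          prob_space.indep_vars (M n) (\<lambda>i. \<Pi>\<^sub>M k\<in>{..<p n}. (borel :: real measure))
            (\<lambda>i. random_vec {..<p n} (D n i)) {..<n}"
    and A1: "\<gamma> > 0" "(\<lambda>n. real (p n)) \<in> O(\<lambda>n. real n powr \<gamma>)"
    and A2_var: "\<And>n a. n \<ge> 1 \<Longrightarrow> a < p n \<Longrightarrow> prob_space.variance (M n) (X n a) = 1"
    and A2_cond: "v\<^sup>2 > 0"
          "\<And>n a. n \<ge> 1 \<Longrightarrow> a < p n \<Longrightarrow>
             AE \<omega> in M n. cond_variance (M n)
               (generated_algebra (M n) ({..<p n} - {a}) (X n)) (X n a) \<omega> \<ge> v\<^sup>2"
    and A3: "0 \<le> \<kappa>" "\<kappa> < 1"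
          "(\<lambda>n. real (MAX a\<in>{..<p n}. card (ne (M n) (p n) (X n) a))) \<in> O(\<lambda>n. real n powr \<kappa>)"
    and A4: "\<And>n a b. n \<ge> 1 \<Longrightarrow> a < p n \<Longrightarrow> b \<in> ne (M n) (p n) (X n) a \<Longrightarrow>
          norm1 (p n) (opt_coeff (M n) (p n) (X n) a (ne (M n) (p n) (X n) b - {a})) \<le> vartheta"
    and A5: "\<delta> > 0" "\<xi> > \<kappa>"
          "\<And>n a b. n \<ge> 1 \<Longrightarrow> (a, b) \<in> edges (M n) (p n) (X n) \<Longrightarrow>
             \<bar>partial_correlation (\<Sigma> n) a b\<bar> \<ge> \<delta> * real n powr (- (1 - \<xi>) / 2)"
    and A6: "\<delta>' < 1"
          "\<And>n a b. n \<ge> 1 \<Longrightarrow> a < p n \<Longrightarrow> b < p n \<Longrightarrow> b \<noteq> a \<Longrightarrow> b \<notin> ne (M n) (p n) (X n) a \<Longrightarrow>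
             \<bar>S_sum (M n) (p n) (X n) a b\<bar> < \<delta>'"
    and lam: "\<kappa> < \<epsilon>" "\<epsilon> < \<xi>" "d > 0"
          "lam \<sim>[sequentially] (\<lambda>n. d * real n powr (- (1 - \<epsilon>) / 2))"
    and lasso: "\<And>n a \<omega>. n \<ge> 1 \<Longrightarrow> lam n > 0 \<Longrightarrow> a < p n \<Longrightarrow> \<omega> \<in> space (M n) \<Longrightarrow>
          is_lasso n (p n) (\<lambda>i k. D n i k \<omega>) a (lam n) (th n a \<omega>)"
    and event: "\<And>n a. n \<ge> 1 \<Longrightarrow> a < p n \<Longrightarrow>
          {\<omega> \<in> space (M n). ne (M n) (p n) (X n) a \<subseteq> est_ne (p n) (th n a \<omega>)} \<in> sets (M n)"
  shows "\<exists>c>0. \<exists>C. \<forall>\<^sub>F n in sequentially. \<forall>a<p n.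
           \<bar>1 - measure (M n)
              {\<omega> \<in> space (M n). ne (M n) (p n) (X n) a \<subseteq> est_ne (p n) (th n a \<omega>)}\<bar>
             \<le> C * exp (- c * real n powr \<epsilon>)"
proof -
  have model: "gaussian_graph (M n) (p n) (\<Sigma> n) (X n) v" if n: "1 \<le> n" for n
  proof -
    interpret prob_space "M n" by (rule prob[OF n])
    interpret normal_vector "M n" "p n" "\<Sigma> n" "X n"
      by (intro normal_vector.intro normal_vector_axioms.intro normal[OF n]) unfold_locales
    show ?thesis
    proof unfold_locales
      show "v \<noteq> 0" using A2_cond(1) by auto
      show "\<Sigma> n $$ (k, k) = 1" if "k < p n" for k using A2_var[OF n that] variance_X[OF that] by simp
      show "AE \<omega> in M n. v\<^sup>2 \<le> cond_variance (M n) (generated_algebra (M n) ({..<p n} - {k}) (X n)) (X n k) \<omega>"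
        if "k < p n" for k using A2_cond(2)[OF n that] .
    qed
  qed
  have sample: "gaussian_sample (M n) (p n) (\<Sigma> n) (X n) v n (D n)" if n: "1 \<le> n" for n
    by (intro gaussian_sample.intro model[OF n] iid_normal_rows.intro prob[OF n] iid_normal_rows_axioms.intro
        n rows_normal[OF n] rows_indep[OF n])
  have edge_ge: "\<delta> * real n powr (- (1 - \<xi>) / 2) \<le> \<bar>partial_correlation (\<Sigma> n) a k\<bar>"
    if "1 \<le> n" "k \<in> ne (M n) (p n) (X n) a" for n a k
    using A5(3)[OF that(1), of a k] that(2) by (auto simp: ne_def)
  define event where "event n a = {\<omega> \<in> space (M n). ne (M n) (p n) (X n) a \<subseteq> est_ne (p n) (th n a \<omega>)}" for n a
  show ?thesis
  proof (cases "\<xi> > 1")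
    case True
    \<comment> \<open>Partial correlations are at most 1, so there are no edges for large \<open>n\<close>.\<close>
    have "\<forall>\<^sub>F n in sequentially. 1 / \<delta> * real n powr (- ((\<xi> - 1) / 2)) < 1"
      using True by (intro eventually_powr_neg_less) auto
    then have bound: "\<forall>\<^sub>F n in sequentially. \<forall>a<p n. \<bar>1 - measure (M n) (event n a)\<bar> \<le> 1 * exp (- 1 * real n powr \<epsilon>)"
      using eventually_ge_at_top[of "1::nat"]
    proof eventually_elim
      case (elim n)
      have large: "1 < \<delta> * real n powr (- (1 - \<xi>) / 2)"
      proof -
        define x where "x = real n powr (- ((\<xi> - 1) / 2))"
        define z where "z = real n powr (- (1 - \<xi>) / 2)"
        have "x * z = 1" using elim(2) by (simp add: x_def z_def powr_add[symmetric] field_simps)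
        moreover have "x < \<delta>" using elim(1) A5(1) by (simp add: x_def field_simps)
        moreover have "0 < z" using elim(2) by (simp add: z_def)
        ultimately have "1 < \<delta> * z" using mult_strict_right_mono[of x \<delta> z] by simp
        then show ?thesis by (simp add: z_def)
      qed
      interpret gaussian_graph "M n" "p n" "\<Sigma> n" "X n" v by (rule model[OF elim(2)])
      have "nbh a = {}" if "a < p n" for a
      proof (rule ccontr)
        assume "nbh a \<noteq> {}"
        then obtain k where k: "k \<in> nbh a" by blast
        then have "\<bar>partial_correlation (\<Sigma> n) a k\<bar> \<le> 1"
          using partial_correlation_le_1[OF that, of k] nbh_subset by auto
        then show False using edge_ge[OF elim(2) k] large by linarith
      qed
      then have "event n a = space (M n)" if "a < p n" for a using that by (auto simp: event_def)
      then show ?case by (simp add: prob_space)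
    qed
    show ?thesis
      using bound unfolding event_def by (rule exponential_boundI) simp
  next
    case False
    then have \<epsilon>: "\<epsilon> < 1" "0 < \<epsilon>" using lam(1,2) A3(1) by auto
    define Th where "Th = max vartheta 0"
    define \<rho> where "\<rho> = min 1 ((1 - \<delta>') / 4)"
    have \<rho>: "0 < \<rho>" "4 * \<rho> \<le> 1 - \<delta>'" using A6(1) by (auto simp: \<rho>_def min_def)
    have Th: "0 \<le> Th" "vartheta \<le> Th" by (auto simp: Th_def)
    have v: "v \<noteq> 0" "0 < \<bar>v\<bar>" "0 < v\<^sup>2" using A2_cond(1) by auto
    obtain Cp where Cp: "0 < Cp" "\<forall>\<^sub>F n in sequentially. real (p n) \<le> Cp * real n powr \<gamma>"
      using landau_o.bigE[OF A1(2)] by auto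
    obtain Ck where Ck: "0 < Ck" "\<forall>\<^sub>F n in sequentially.
        real (MAX a\<in>{..<p n}. card (ne (M n) (p n) (X n) a)) \<le> Ck * real n powr \<kappa>"
      using landau_o.bigE[OF A3(3)] by auto
    define r where "r n = real n powr (- ((1 - \<epsilon>) / 2))" for n
    have r_alt: "real n powr (- (1 - \<epsilon>) / 2) = r n" for n by (simp only: r_def minus_divide_left)
    have lam_bounds: "\<forall>\<^sub>F n in sequentially. d / 2 * r n \<le> lam n \<and> lam n \<le> 2 * d * r n"
    proof -
      define u where "u = (\<lambda>n. if lam n = 0 \<and> d * r n = 0 then 1 else lam n / (d * r n))"
      have u: "u \<longlonglongrightarrow> 1" using lam(4) unfolding asymp_equiv_def r_alt u_def .
      have "\<forall>\<^sub>F n in sequentially. 1 / 2 < u n" "\<forall>\<^sub>F n in sequentially. u n < 2"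
        by (rule order_tendstoD[OF u]; simp)+
      then show ?thesis using eventually_ge_at_top[of "1::nat"]
      proof eventually_elim
        case (elim n)
        then have pos: "0 < d * r n" using lam(3) by (simp add: r_def)
        then have "u n = lam n / (d * r n)" by (auto simp: u_def)
        then show ?case using elim pos by (simp add: field_simps)
      qed
    qed
    have ev_small: "\<forall>\<^sub>F n in sequentially. \<rho> * (2 * d) * r n < e" if "0 < e" for e
      unfolding r_def using \<epsilon> that by (intro eventually_powr_neg_less) auto
    define C2 where "C2 = 8 / v\<^sup>2 * ((1 + Th) / 2 + 8 * \<rho>)"
    have "0 < (1 + Th) / 2 + 8 * \<rho>"
    proof (rule add_nonneg_pos)
      show "0 \<le> (1 + Th) / 2" using Th(1) by simp
      show "0 < 8 * \<rho>" using \<rho>(1) by simp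
    qed
    then have C2: "0 < C2" unfolding C2_def using v(3) by (intro mult_pos_pos) auto
    have ev_gap: "\<forall>\<^sub>F n in sequentially. C2 * (2 * d) * real n powr (- ((\<xi> - \<epsilon>) / 2)) < \<bar>v\<bar> * \<delta>"
      using lam(2) v A5(1) by (intro eventually_powr_neg_less) auto
    define K where "K = (1 + 1 / \<bar>v\<bar> + 8 / d) * (1 + Th) * (8 * (Ck + 2)) * (2 / (\<rho> * d))"
    have ev_grid: "\<forall>\<^sub>F n in sequentially. 2 * (K * real n ^ 2 + 1) + 1 \<le> real n ^ 3" by real_asymp
    define c0 where "c0 = (\<rho> * (d / 2))\<^sup>2 / 10496"
    have c0: "0 < c0" using \<rho> lam(3) by (simp add: c0_def)
    define m where "m n = nat \<lceil>Ck * real n powr \<kappa>\<rceil> + 1" for n :: nat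
    have ev_union: "\<forall>\<^sub>F n in sequentially.
        5 * (Cp * real n powr \<gamma>) * (real n ^ 3) ^ m n * exp (- (c0 * real n powr \<epsilon>))
          \<le> exp (- (c0 / 2 * real n powr \<epsilon>))"
      unfolding m_def by (rule union_bound_dominated[OF A3(1) lam(1) c0 Cp(1) Ck(1)])
    have ev_s1: "\<forall>\<^sub>F n in sequentially. \<rho> * (2 * d) * r n < v\<^sup>2 / 16" by (rule ev_small) (use v in simp)
    have ev_s2: "\<forall>\<^sub>F n in sequentially. \<rho> * (2 * d) * r n < 1 / 2" by (rule ev_small) simp
    have bound: "\<forall>\<^sub>F n in sequentially. \<forall>a<p n. \<bar>1 - measure (M n) (event n a)\<bar> \<le> 1 * exp (- (c0 / 2) * real n powr \<epsilon>)"
      using eventually_ge_at_top[of "1::nat"] Cp(2) Ck(2) lam_bounds ev_s1 ev_s2 ev_gap ev_grid ev_union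
    proof eventually_elim
      case (elim n)
      have n1: "1 \<le> real n" using elim(1) by simp
      have rpos: "0 < r n" using elim(1) by (simp add: r_def)
      have lam_ge: "d / 2 * r n \<le> lam n" and lam_le: "lam n \<le> 2 * d * r n" using elim(4) by auto
      have "0 < d / 2 * r n" using lam(3) rpos by simp
      then have l: "0 < lam n" using lam_ge by linarith
      show ?case
      proof (intro allI impI)
        fix a assume a: "a < p n"
        interpret gaussian_sample "M n" "p n" "\<Sigma> n" "X n" v n "D n" by (rule sample[OF elim(1)])
        have rlam: "\<rho> * lam n \<le> \<rho> * (2 * d) * r n"
          using mult_left_mono[OF lam_le, of \<rho>] \<rho>(1) by (simp add: mult_ac)
        have small: "\<rho> * lam n \<le> v\<^sup>2 / 16" "\<rho> * lam n \<le> 1 / 2" using rlam elim(5,6) by linarith+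
        have t_norm: "norm1 (p n) (regress k (nbh a - {k})) \<le> Th" if "k \<in> nbh a" for k
        proof -
          have "k < p n" using that nbh_subset by auto
          then show ?thesis using A4[OF elim(1) _ nbh_sym[OF a that]] Th(2) by fastforce
        qed
        have gap: "8 / v\<^sup>2 * ((1 + Th) / 2 + 8 * \<rho>) * lam n < \<bar>regress a (nbh a) k\<bar>" if k: "k \<in> nbh a" for k
        proof -
          have "C2 * lam n \<le> C2 * (2 * d * r n)" using lam_le C2 by (intro mult_left_mono) auto
          also have "r n = real n powr (- ((\<xi> - \<epsilon>) / 2)) * real n powr (- (1 - \<xi>) / 2)"
          proof -
            have "- ((1 - \<epsilon>) / 2) = - ((\<xi> - \<epsilon>) / 2) + - (1 - \<xi>) / 2" by (simp add: field_simps)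
            then show ?thesis by (simp only: r_def powr_add)
          qed
          also have "C2 * (2 * d * (real n powr (- ((\<xi> - \<epsilon>) / 2)) * real n powr (- (1 - \<xi>) / 2)))
              = C2 * (2 * d) * real n powr (- ((\<xi> - \<epsilon>) / 2)) * real n powr (- (1 - \<xi>) / 2)"
            by (simp add: mult_ac)
          also have "\<dots> < \<bar>v\<bar> * \<delta> * real n powr (- (1 - \<xi>) / 2)"
            using elim(7) n1 by (intro mult_strict_right_mono) auto
          also have "\<dots> \<le> \<bar>v\<bar> * \<bar>partial_correlation (\<Sigma> n) a k\<bar>"
            using mult_left_mono[OF edge_ge[OF elim(1) k], of "\<bar>v\<bar>"] by (simp add: mult_ac)
          also have "\<dots> \<le> \<bar>regress a (nbh a) k\<bar>" by (rule regress_nbh_ge[OF a k])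
          finally show ?thesis by (simp add: C2_def)
        qed
        have incoherent: "\<bar>S_sum (M n) (p n) (X n) a k\<bar> < \<delta>'" if "k < p n" "k \<noteq> a" "k \<notin> nbh a" for k
          using A6(2)[OF elim(1) a that] .
        have "card (nbh a) \<le> (MAX a\<in>{..<p n}. card (nbh a))" using a by (intro Max_ge) auto
        then have "real (card (nbh a)) \<le> Ck * real n powr \<kappa>" using elim(3) by linarith
        then have card_m: "card (nbh a) + 1 \<le> m n" unfolding m_def by linarith
        \<comment> \<open>\<open>x\<close> is the number of grid steps from 0 to \<open>R\<close>; as \<open>1 / lam n\<close> is \<open>O (sqrt n)\<close> and
          \<open>m n\<close> is \<open>O n\<close>, it is \<open>O (n\<^sup>2)\<close>.\<close>
        define x where "x = (1 + 1 / \<bar>v\<bar> + 4 / lam n) * (1 + Th) * (8 * real (m n)) / (\<rho> * lam n)"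
        define L where "L = nat \<lceil>x\<rceil>"
        have xL: "x \<le> real L" unfolding L_def by (rule real_nat_ceiling_ge)
        have x0: "0 \<le> x" using l \<rho>(1) Th(1) by (simp add: x_def)
        have L_le: "real (2 * L + 1) \<le> real n ^ 3"
        proof -
          define s where "s = real n powr (1 / 2)"
          have s: "1 \<le> s" "s * s = real n"
            using n1 by (auto simp: s_def powr_add[symmetric] ge_one_powr_ge_zero)
          have "1 / s = real n powr (- (1 / 2))" by (simp add: s_def powr_minus_divide)
          also have "\<dots> \<le> r n" unfolding r_def using n1 \<epsilon> by (intro powr_mono) auto
          finally have "d / 2 * (1 / s) \<le> d / 2 * r n" using lam(3) by (intro mult_left_mono) auto
          then have ls: "d / (2 * s) \<le> lam n" using lam_ge by simp
          then have "d \<le> 2 * s * lam n" using s by (simp add: field_simps)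
          then have inv: "1 / lam n \<le> 2 / d * s" using l lam(3) by (simp add: field_simps)
          have "m n \<le> Ck * real n powr \<kappa> + 2" unfolding m_def using Ck(1) n1 by (simp add: add_nonneg_nonneg) linarith
          also have "\<dots> \<le> Ck * real n + 2 * real n"
            using n1 A3 powr_mono[of \<kappa> 1 "real n"] Ck(1) by (intro add_mono mult_left_mono) auto
          finally have m_le: "real (m n) \<le> (Ck + 2) * real n" by (simp add: algebra_simps)
          have f1: "1 + 1 / \<bar>v\<bar> + 4 / lam n \<le> (1 + 1 / \<bar>v\<bar> + 8 / d) * s"
          proof -
            have "1 + 1 / \<bar>v\<bar> \<le> (1 + 1 / \<bar>v\<bar>) * s"
              using mult_left_mono[OF s(1), of "1 + 1 / \<bar>v\<bar>"] by simp
            moreover have "4 / lam n \<le> 8 / d * s" using inv by simp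
            ultimately show ?thesis by (simp add: distrib_right)
          qed
          have f4: "1 / (\<rho> * lam n) \<le> 2 / (\<rho> * d) * s"
            using mult_left_mono[OF inv, of "1 / \<rho>"] \<rho>(1) by simp
          have "x = (1 + 1 / \<bar>v\<bar> + 4 / lam n) * (1 + Th) * (8 * real (m n)) * (1 / (\<rho> * lam n))"
            by (simp add: x_def)
          also have "\<dots> \<le> ((1 + 1 / \<bar>v\<bar> + 8 / d) * s) * (1 + Th) * (8 * ((Ck + 2) * real n)) * (2 / (\<rho> * d) * s)"
            using f1 m_le f4 l \<rho>(1) Th(1) lam(3) s(1) Ck(1) by (intro mult_mono) auto
          also have "\<dots> = K * ((s * s) * real n)" by (simp add: K_def mult_ac)
          also have "\<dots> = K * real n ^ 2" unfolding s(2) by (simp add: power2_eq_square)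
          finally have "x \<le> K * real n ^ 2" .
          moreover have "real L \<le> x + 1" using x0 unfolding L_def by linarith
          ultimately show ?thesis using elim(8) by simp
        qed
        obtain B where B: "B \<in> sets (M n)"
          "prob B \<le> 5 * real (p n) * real (2 * L + 1) ^ m n * exp (- real n * (\<rho> * lam n)\<^sup>2 / 10496)"
          "\<And>\<omega> \<theta>. \<omega> \<in> space (M n) - B \<Longrightarrow> is_lasso n (p n) (\<lambda>i k. D n i k \<omega>) a (lam n) \<theta> \<Longrightarrow> nbh a \<subseteq> est_ne (p n) \<theta>"
          by (rule lasso_failure_probability[OF a l \<rho>(1) Th(1) t_norm gap small incoherent \<rho>(2) card_m xL[unfolded x_def]]) blast+
        have "space (M n) - B \<subseteq> event n a"
          using B(3) lasso[OF elim(1) l a] by (auto simp: event_def)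
        then have "prob (space (M n) - B) \<le> prob (event n a)"
          using event[OF elim(1) a] by (intro finite_measure_mono) (auto simp: event_def)
        then have "1 - prob (event n a) \<le> prob B" using prob_compl[OF B(1)] by simp
        also have "prob B \<le> 5 * (Cp * real n powr \<gamma>) * (real n ^ 3) ^ m n * exp (- (c0 * real n powr \<epsilon>))"
        proof -
          have "c0 * real n powr \<epsilon> \<le> real n * (\<rho> * lam n)\<^sup>2 / 10496"
          proof -
            have "real n * (r n)\<^sup>2 = real n powr 1 * (real n powr (- ((1 - \<epsilon>) / 2)) * real n powr (- ((1 - \<epsilon>) / 2)))"
              using n1 by (simp add: r_def power2_eq_square)
            also have "\<dots> = real n powr \<epsilon>"
            proof -
              have "1 + (- ((1 - \<epsilon>) / 2) + - ((1 - \<epsilon>) / 2)) = \<epsilon>" by (simp add: field_simps)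
              then show ?thesis by (simp only: powr_add[symmetric])
            qed
            finally have nr: "real n * (r n)\<^sup>2 = real n powr \<epsilon>" .
            have "\<rho> * (d / 2 * r n) \<le> \<rho> * lam n" using lam_ge \<rho>(1) by (intro mult_left_mono) auto
            then have "(\<rho> * (d / 2 * r n))\<^sup>2 \<le> (\<rho> * lam n)\<^sup>2"
              using \<rho>(1) lam(3) rpos by (intro power_mono) auto
            then have "real n * (\<rho> * (d / 2 * r n))\<^sup>2 \<le> real n * (\<rho> * lam n)\<^sup>2" by (intro mult_left_mono) auto
            moreover have "real n * (\<rho> * (d / 2 * r n))\<^sup>2 = (\<rho> * (d / 2))\<^sup>2 * (real n * (r n)\<^sup>2)"
              by (simp add: power2_eq_square mult_ac)
            ultimately show ?thesis unfolding nr c0_def by simp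
          qed
          then have e: "exp (- real n * (\<rho> * lam n)\<^sup>2 / 10496) \<le> exp (- (c0 * real n powr \<epsilon>))" by simp
          have "5 * real (p n) * real (2 * L + 1) ^ m n * exp (- real n * (\<rho> * lam n)\<^sup>2 / 10496)
              \<le> 5 * (Cp * real n powr \<gamma>) * (real n ^ 3) ^ m n * exp (- (c0 * real n powr \<epsilon>))"
            using elim(2) Cp(1) by (intro mult_mono power_mono L_le e) auto
          then show ?thesis using B(2) by linarith
        qed
        also have "\<dots> \<le> exp (- (c0 / 2 * real n powr \<epsilon>))" by (rule elim(9))
        finally show "\<bar>1 - measure (M n) (event n a)\<bar> \<le> 1 * exp (- (c0 / 2) * real n powr \<epsilon>)"
          using prob_le_1[of "event n a"] by simp
      qed
    qed
    have c0': "0 < c0 / 2" using c0 by simp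
    show ?thesis
      using bound c0' unfolding event_def by (rule exponential_boundI)
  qed
qed

end
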